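(* Let $\mathbb U\subset\mathbb C$ be an open set conformally equivalent to the unit disc, let $\Sigma$ be a complex Banach space and let $\mathscr F$ be an acceptable space of analytic functions $\mathbb U\to\Sigma$. For every $n\ge 2$ there exists an acceptable space $\mathscr T$ of analytic functions $\mathbb U\to\Sigma^n$ with the following properties: (i) for every $f\in\mathscr F$, the array $\tau_{(n,0]}f:\mathbb U\to\Sigma^n$ belongs to $\mathscr T$, and $\|\tau_{(n,0]}f\|_{\mathscr T}=\|f\|_{\mathscr F}$; (ii) for every $u\in\mathbb U$ one has $\mathscr T_u=\mathscr F^{(n)}_u$, with equivalent norms.
   Context: Let $\mathbb D$ be the open unit disc. $A^\infty$ is the Fréchet algebra (pointwise product) of all analytic $f:\mathbb D\to\mathbb C$ whose Taylor coefficients $(c_j)_{j\ge0}$ at $0$ are rapidly decreasing, with the topology given by the norms $\sup_j|c_j|(j+1)^\alpha$, $\alpha>0$. For $\mathbb U$ conformally equivalent to $\mathbb D$, $A^\infty_{\mathbb U}=\{f\circ\psi: f\in A^\infty\}$ with the transported topology, where $\psi:\mathbb U\to\mathbb D$ is any conformal equivalence (the result does not depend on $\psi$). An acceptable space on $\mathbb U$ with values in a complex Banach space $\Sigma$ is a Banach space $\mathscr F$ of analytic functions $f:\mathbb U\to\Sigma$ such that: (a) the evaluation maps $\delta_z:\mathscr F\to\Sigma$ are continuous for all $z\in\mathbb U$; (b) $\mathscr F$ is a module over $A^\infty_{\mathbb U}$ under pointwise multiplication, with jointly continuous product $A^\infty_{\mathbb U}\times\mathscr F\to\mathscr F$; (c)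 for each conformal equivalence $\varphi:\mathbb U\to\mathbb D$ there is a constant $K[\varphi]$ such that, for analytic $f:\mathbb U\to\Sigma$, $\varphi f\in\mathscr F$ if and only if $f\in\mathscr F$, and then $K[\varphi]^{-1}\|\varphi f\|_{\mathscr F}\le\|f\|_{\mathscr F}\le K[\varphi]\|\varphi f\|_{\mathscr F}$. For analytic $f$, $\tau_{(n,0]}f=\left(\frac{f^{(n-1)}}{(n-1)!},\dots,f',f\right)$. The Rochberg spaces of an acceptable space $\mathscr F$ at $z\in\mathbb U$ are $\mathscr F^{(n)}_z=\{w\in\Sigma^n: w=\tau_{(n,0]}f(z)\text{ for some }f\in\mathscr F\}$ with the quotient norm $\|w\|=\inf\{\|f\|_{\mathscr F}: w=\tau_{(n,0]}f(z)\}$, and $\mathscr F_z=\mathscr F^{(1)}_z$; likewise $\mathscr T_u=\{F(u):F\in\mathscr T\}$ with the quotient norm. $\Sigma^n$ is the product of $n$ copies of $\Sigma$ with the sum norm. *)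

theory Defs
  imports "HOL-Analysis.Analysis"
begin

section \<open>Complex Banach spaces\<close>

class complex_banach = banach +
  fixes scaleC :: "complex \<Rightarrow> 'a \<Rightarrow> 'a" (infixr "*\<^sub>C" 75)
  assumes scaleC_add_right: "c *\<^sub>C (x + y) = c *\<^sub>C x + c *\<^sub>C y"
    and scaleC_add_left: "(c + d) *\<^sub>C x = c *\<^sub>C x + d *\<^sub>C x"
    and scaleC_scaleC: "c *\<^sub>C d *\<^sub>C x = (c * d) *\<^sub>C x"
    and scaleR_scaleC: "r *\<^sub>R x = complex_of_real r *\<^sub>C x"
    and norm_scaleC: "norm (c *\<^sub>C x) = cmod c * norm x"


section \<open>Finite powers of a Banach space, with the sum norm\<close>

text \<open>
  The type \<open>('a, 'n) tuple\<close> is the product of \<open>CARD('n)\<close> copies of \<open>'a\<close>.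
  The library type \<open>'a ^ 'n\<close> is not used because its norm is the Euclidean one.
\<close>

typedef ('a, 'n) tuple = "UNIV :: ('n \<Rightarrow> 'a) set"
  morphisms entry Tuple ..

lemma entry_Tuple [simp]: "entry (Tuple f) i = f i"
  by (simp add: Tuple_inverse)

lemma tuple_eq_iff: "x = y \<longleftrightarrow> (\<forall>i. entry x i = entry y i)"
  by (metis entry_inject ext)

instantiation tuple :: (real_normed_vector, finite) real_normed_vector
begin

definition zero_tuple :: "('a, 'b) tuple"
  where "zero_tuple = Tuple (\<lambda>i. 0)"

definition plus_tuple :: "('a, 'b) tuple \<Rightarrow> ('a, 'b) tuple \<Rightarrow> ('a, 'b) tuple"
  where "plus_tuple x y = Tuple (\<lambda>i. entry x i + entry y i)"

definition minus_tuple :: "('a, 'b) tuple \<Rightarrow> ('a, 'b) tuple \<Rightarrow> ('a, 'b) tuple"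
  where "minus_tuple x y = Tuple (\<lambda>i. entry x i - entry y i)"

definition uminus_tuple :: "('a, 'b) tuple \<Rightarrow> ('a, 'b) tuple"
  where "uminus_tuple x = Tuple (\<lambda>i. - entry x i)"

definition scaleR_tuple :: "real \<Rightarrow> ('a, 'b) tuple \<Rightarrow> ('a, 'b) tuple"
  where "scaleR_tuple r x = Tuple (\<lambda>i. r *\<^sub>R entry x i)"

definition norm_tuple :: "('a, 'b) tuple \<Rightarrow> real"
  where "norm_tuple x = (\<Sum>i\<in>UNIV. norm (entry x i))"

definition dist_tuple :: "('a, 'b) tuple \<Rightarrow> ('a, 'b) tuple \<Rightarrow> real"
  where "dist_tuple x y = norm (x - y)"

definition sgn_tuple :: "('a, 'b) tuple \<Rightarrow> ('a, 'b) tuple"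
  where "sgn_tuple x = inverse (norm x) *\<^sub>R x"

definition uniformity_tuple :: "(('a, 'b) tuple \<times> ('a, 'b) tuple) filter"
  where "uniformity_tuple = (INF e\<in>{0 <..}. principal {(x, y). dist x y < e})"

definition open_tuple :: "('a, 'b) tuple set \<Rightarrow> bool"
  where "open_tuple S \<longleftrightarrow> (\<forall>x\<in>S. \<forall>\<^sub>F (x', y) in uniformity. x' = x \<longrightarrow> y \<in> S)"

instance
proof
  fix x y :: "('a, 'b) tuple" and r :: real
  show "norm x = 0 \<longleftrightarrow> x = 0"
    by (simp add: norm_tuple_def zero_tuple_def tuple_eq_iff sum_nonneg_eq_0_iff)
  show "norm (x + y) \<le> norm x + norm y"
    by (simp add: norm_tuple_def plus_tuple_def sum.distrib [symmetric] sum_mono norm_triangle_ineq)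
  show "norm (r *\<^sub>R x) = \<bar>r\<bar> * norm x"
    by (simp add: norm_tuple_def scaleR_tuple_def sum_distrib_left)
qed (simp_all add: tuple_eq_iff zero_tuple_def plus_tuple_def minus_tuple_def uminus_tuple_def
      scaleR_tuple_def dist_tuple_def sgn_tuple_def uniformity_tuple_def open_tuple_def
      algebra_simps)

end

lemma entry_zero [simp]: "entry 0 i = 0"
  and entry_add [simp]: "entry (x + y) i = entry x i + entry y i"
  and entry_diff [simp]: "entry (x - y) i = entry x i - entry y i"
  and entry_minus [simp]: "entry (- x) i = - entry x i"
  and entry_scaleR [simp]: "entry (r *\<^sub>R x) i = r *\<^sub>R entry x i"
  by (simp_all add: zero_tuple_def plus_tuple_def minus_tuple_def uminus_tuple_def scaleR_tuple_def)

lemma norm_entry_le: "norm (entry x i) \<le> norm x"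
  unfolding norm_tuple_def by (rule member_le_sum) auto

instance tuple :: (banach, finite) banach
proof
  fix X :: "nat \<Rightarrow> ('a, 'b) tuple"
  assume X: "Cauchy X"
  have "Cauchy (\<lambda>k. entry (X k) i)" for i
  proof (rule CauchyI)
    fix e :: real assume "0 < e"
    then obtain M where M: "\<forall>m\<ge>M. \<forall>n\<ge>M. norm (X m - X n) < e"
      using X CauchyD by blast
    have "norm (entry (X m) i - entry (X n) i) \<le> norm (X m - X n)" for m n
      using norm_entry_le [of "X m - X n" i] by simp
    with M show "\<exists>M. \<forall>m\<ge>M. \<forall>n\<ge>M. norm (entry (X m) i - entry (X n) i) < e"
      by (meson le_less_trans)
  qed
  then have "\<forall>i. \<exists>l. (\<lambda>k. entry (X k) i) \<longlonglongrightarrow> l"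
    by (simp add: Cauchy_convergent_iff convergent_def)
  then obtain l where l: "\<And>i. (\<lambda>k. entry (X k) i) \<longlonglongrightarrow> l i"
    by metis
  have "(\<lambda>k. \<Sum>i\<in>UNIV. norm (entry (X k) i - l i)) \<longlonglongrightarrow> (\<Sum>i\<in>(UNIV :: 'b set). 0)"
    by (intro tendsto_sum tendsto_norm_zero LIM_zero l)
  then have "(\<lambda>k. norm (X k - Tuple l)) \<longlonglongrightarrow> 0"
    by (simp add: norm_tuple_def)
  then show "convergent X"
    using LIM_zero_cancel tendsto_norm_zero_cancel convergentI by metis
qed

instantiation tuple :: (complex_banach, finite) complex_banach
begin

definition scaleC_tuple :: "complex \<Rightarrow> ('a, 'b) tuple \<Rightarrow> ('a, 'b) tuple"
  where "scaleC_tuple c x = Tuple (\<lambda>i. c *\<^sub>C entry x i)"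

instance
  by standard (simp_all add: scaleC_tuple_def tuple_eq_iff norm_tuple_def scaleC_add_right
      scaleC_add_left scaleC_scaleC scaleR_scaleC norm_scaleC sum_distrib_left)

end


section \<open>Vector-valued analytic functions\<close>

text \<open>
  Functions on a set \<open>U\<close> of complex numbers are represented by total functions vanishing off \<open>U\<close>,
  so that equality of functions on \<open>U\<close> is equality in HOL.
\<close>

definition zero_ext :: "complex set \<Rightarrow> (complex \<Rightarrow> 'b::zero) \<Rightarrow> complex \<Rightarrow> 'b"
  where "zero_ext U f = (\<lambda>z. if z \<in> U then f z else 0)"

definition has_complex_deriv :: "(complex \<Rightarrow> 'a::complex_banach) \<Rightarrow> 'a \<Rightarrow> complex \<Rightarrow> bool"
  where "has_complex_deriv f d z \<longleftrightarrow> (f has_derivative (\<lambda>h. h *\<^sub>C d)) (at z)"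

definition complex_deriv :: "(complex \<Rightarrow> 'a::complex_banach) \<Rightarrow> complex \<Rightarrow> 'a"
  where "complex_deriv f z = (THE d. has_complex_deriv f d z)"

text \<open>Used for open \<open>U\<close> only.\<close>

definition analytic_funs :: "complex set \<Rightarrow> (complex \<Rightarrow> 'a::complex_banach) set"
  where "analytic_funs U = {f. (\<forall>z\<in>U. \<exists>d. has_complex_deriv f d z) \<and> (\<forall>z. z \<notin> U \<longrightarrow> f z = 0)}"

text \<open>
  The array \<open>(f\<^sup>(\<^sup>n\<^sup>-\<^sup>1\<^sup>)/(n-1)!, \<dots>, f', f)\<close> with \<open>n = CARD('n)\<close>: the linear order of the
  index type \<open>'n\<close> gives the position, and the entry with \<open>k\<close> entries after it is \<open>f\<^sup>(\<^sup>k\<^sup>)/k!\<close>.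
\<close>

definition jet :: "(complex \<Rightarrow> 'a::complex_banach) \<Rightarrow> complex \<Rightarrow> ('a, 'n::{finite,linorder}) tuple"
  where "jet f z =
    Tuple (\<lambda>i. let k = card {i<..} in (1 / fact k) *\<^sub>R (complex_deriv ^^ k) f z)"


section \<open>Conformal equivalences and the algebra \<open>A\<^sup>\<infinity>\<close>\<close>

abbreviation unit_disc :: "complex set"
  where "unit_disc \<equiv> ball 0 1"

definition conformal_equiv :: "(complex \<Rightarrow> complex) \<Rightarrow> complex set \<Rightarrow> complex set \<Rightarrow> bool"
  where "conformal_equiv \<psi> U V \<longleftrightarrow> \<psi> holomorphic_on U \<and> bij_betw \<psi> U V"

definition taylor_coeff :: "(complex \<Rightarrow> complex) \<Rightarrow> nat \<Rightarrow> complex"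
  where "taylor_coeff f j = (deriv ^^ j) f 0 / fact j"

definition Ainf :: "(complex \<Rightarrow> complex) set"
  where "Ainf = {f. f holomorphic_on unit_disc \<and> (\<forall>z. z \<notin> unit_disc \<longrightarrow> f z = 0) \<and>
    (\<forall>\<alpha>>0. bdd_above (range (\<lambda>j. cmod (taylor_coeff f j) * (real j + 1) powr \<alpha>)))}"

definition Ainf_norm :: "real \<Rightarrow> (complex \<Rightarrow> complex) \<Rightarrow> real"
  where "Ainf_norm \<alpha> f = (SUP j. cmod (taylor_coeff f j) * (real j + 1) powr \<alpha>)"

definition Ainf_topology :: "(complex \<Rightarrow> complex) topology"
  where "Ainf_topology = topology_generated_by
    {{g \<in> Ainf. Ainf_norm \<alpha> (\<lambda>z. g z - f z) < \<epsilon>} | f \<alpha> \<epsilon>. f \<in> Ainf \<and> \<alpha> > 0 \<and> \<epsilon> > 0}"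

definition Ainf_on :: "complex set \<Rightarrow> (complex \<Rightarrow> complex) \<Rightarrow> (complex \<Rightarrow> complex) set"
  where "Ainf_on U \<psi> = {zero_ext U (f \<circ> \<psi>) | f. f \<in> Ainf}"

text \<open>The topology transported from \<open>A\<^sup>\<infinity>\<close>, i.e. pulled back along \<open>g \<mapsto> g \<circ> \<psi>\<^sup>-\<^sup>1\<close>.\<close>

definition Ainf_on_topology :: "complex set \<Rightarrow> (complex \<Rightarrow> complex) \<Rightarrow> (complex \<Rightarrow> complex) topology"
  where "Ainf_on_topology U \<psi> =
    pullback_topology (Ainf_on U \<psi>) (\<lambda>g. zero_ext unit_disc (g \<circ> inv_into U \<psi>)) Ainf_topology"


section \<open>Acceptable spaces\<close>

text \<open>
  A normed space of functions is a set \<open>F\<close> with a function \<open>N\<close> of which only the values on \<open>F\<close>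
  matter; the distance is cut off outside \<open>F\<close> because the locale \<open>Metric_space\<close> requires
  nonnegativity and symmetry everywhere.
\<close>

definition norm_dist :: "(complex \<Rightarrow> 'a::complex_banach) set \<Rightarrow> ((complex \<Rightarrow> 'a) \<Rightarrow> real) \<Rightarrow>
    (complex \<Rightarrow> 'a) \<Rightarrow> (complex \<Rightarrow> 'a) \<Rightarrow> real"
  where "norm_dist F N f g = (if f \<in> F \<and> g \<in> F then N (\<lambda>z. f z - g z) else 0)"

definition norm_topology :: "(complex \<Rightarrow> 'a::complex_banach) set \<Rightarrow> ((complex \<Rightarrow> 'a) \<Rightarrow> real) \<Rightarrow>
    (complex \<Rightarrow> 'a) topology"
  where "norm_topology F N = Metric_space.mtopology F (norm_dist F N)"

locale banach_space_of_analytic_functions =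
  fixes U :: "complex set"
    and F :: "(complex \<Rightarrow> 'a::complex_banach) set"
    and N :: "(complex \<Rightarrow> 'a) \<Rightarrow> real"
  assumes analytic: "F \<subseteq> analytic_funs U"
    and zero_mem: "(\<lambda>z. 0) \<in> F"
    and add_mem: "\<lbrakk>f \<in> F; g \<in> F\<rbrakk> \<Longrightarrow> (\<lambda>z. f z + g z) \<in> F"
    and scale_mem: "f \<in> F \<Longrightarrow> (\<lambda>z. c *\<^sub>C f z) \<in> F"
    and N_nonneg: "f \<in> F \<Longrightarrow> N f \<ge> 0"
    and N_eq_0_iff: "f \<in> F \<Longrightarrow> N f = 0 \<longleftrightarrow> f = (\<lambda>z. 0)"
    and N_add_le: "\<lbrakk>f \<in> F; g \<in> F\<rbrakk> \<Longrightarrow> N (\<lambda>z. f z + g z) \<le> N f + N g"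
    and N_scale: "f \<in> F \<Longrightarrow> N (\<lambda>z. c *\<^sub>C f z) = cmod c * N f"
    and complete: "Metric_space.mcomplete F (norm_dist F N)"

text \<open>
  The space \<open>Ainf_on U \<psi>\<close> and its topology do not depend on the conformal equivalence \<open>\<psi>\<close>, so
  quantifying over all \<open>\<psi>\<close> below amounts to choosing any one of them.
\<close>

locale acceptable_space = banach_space_of_analytic_functions +
  assumes eval_continuous: "z \<in> U \<Longrightarrow> continuous_map (norm_topology F N) euclidean (\<lambda>f. f z)"
    and module_closed: "\<lbrakk>conformal_equiv \<psi> U unit_disc; a \<in> Ainf_on U \<psi>; f \<in> F\<rbrakk> \<Longrightarrow>
      (\<lambda>z. a z *\<^sub>C f z) \<in> F"
    and module_continuous: "conformal_equiv \<psi> U unit_disc \<Longrightarrow>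
      continuous_map (prod_topology (Ainf_on_topology U \<psi>) (norm_topology F N)) (norm_topology F N)
        (\<lambda>(a, f). \<lambda>z. a z *\<^sub>C f z)"
    and conformal_mult: "conformal_equiv \<phi> U unit_disc \<Longrightarrow>
      \<exists>K>0. \<forall>f\<in>analytic_funs U.
        ((\<lambda>z. \<phi> z *\<^sub>C f z) \<in> F \<longleftrightarrow> f \<in> F) \<and>
        (f \<in> F \<longrightarrow> inverse K * N (\<lambda>z. \<phi> z *\<^sub>C f z) \<le> N f \<and> N f \<le> K * N (\<lambda>z. \<phi> z *\<^sub>C f z))"


section \<open>Rochberg spaces\<close>

definition quotient_norm :: "'f set \<Rightarrow> ('f \<Rightarrow> real) \<Rightarrow> ('f \<Rightarrow> 'w) \<Rightarrow> 'w \<Rightarrow> real"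
  where "quotient_norm F N q w = Inf {N f | f. f \<in> F \<and> q f = w}"

definition rochberg_space ::
    "(complex \<Rightarrow> 'a::complex_banach) set \<Rightarrow> complex \<Rightarrow> ('a, 'n::{finite,linorder}) tuple set"
  where "rochberg_space F z = {w. \<exists>f\<in>F. w = jet f z}"

definition rochberg_norm :: "(complex \<Rightarrow> 'a::complex_banach) set \<Rightarrow> ((complex \<Rightarrow> 'a) \<Rightarrow> real) \<Rightarrow>
    complex \<Rightarrow> ('a, 'n::{finite,linorder}) tuple \<Rightarrow> real"
  where "rochberg_norm F N z = quotient_norm F N (\<lambda>f. jet f z)"

definition fibre :: "(complex \<Rightarrow> 'b) set \<Rightarrow> complex \<Rightarrow> 'b set"
  where "fibre T u = {G u | G. G \<in> T}"

definition fibre_norm :: "(complex \<Rightarrow> 'b) set \<Rightarrow> ((complex \<Rightarrow> 'b) \<Rightarrow> real) \<Rightarrow> complex \<Rightarrow> 'b \<Rightarrow> real"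
  where "fibre_norm T N u = quotient_norm T N (\<lambda>G. G u)"

definition equivalent_norms_on :: "'w set \<Rightarrow> ('w \<Rightarrow> real) \<Rightarrow> ('w \<Rightarrow> real) \<Rightarrow> bool"
  where "equivalent_norms_on W M N \<longleftrightarrow> (\<exists>c>0. \<exists>C>0. \<forall>w\<in>W. c * N w \<le> M w \<and> M w \<le> C * N w)"

end

theory Submission
  imports Defs "HOL-Complex_Analysis.Complex_Analysis"
begin

text \<open>
  Fix a conformal equivalence \<open>\<psi>\<close> of \<open>U\<close> with the disc and write \<open>\<tau>\<close> for the array \<open>\<tau>\<^bsub>(n,0]\<^esub>\<close>. The space
  required by the theorem consists of the functions \<open>G u = (\<Sum>j<n. \<tau> ((\<psi> - \<psi> u)\<^sup>j g\<^sub>j) u)\<close> with all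
  \<open>g\<^sub>j\<close> in \<open>F\<close>, normed by the sum of the norms of the \<open>g\<^sub>j\<close>. The entry of \<open>G\<close> that belongs to the
  derivative of order \<open>k\<close> is \<open>\<psi>'\<^sup>k g\<^sub>k\<close> plus terms in \<open>g\<^sub>j\<close> with \<open>j < k\<close>, so the coordinates \<open>g\<^sub>j\<close> are
  determined by \<open>G\<close>, and every analytic \<open>G\<close> has analytic coordinates. Taking \<open>g\<^sub>0 = f\<close> and
  the other coordinates \<open>0\<close> gives the array of \<open>f\<close>; conversely \<open>G u\<close> is the array at \<open>u\<close> of
  \<open>(\<Sum>j<n. (\<psi> - \<psi> u)\<^sup>j g\<^sub>j)\<close>, which lies in \<open>F\<close>, whence the description of the fibres.

  If \<open>D\<close> is the derivation \<open>(1 / \<psi>') d/dz\<close>, the Taylor expansion of a scalar function \<open>a\<close> in powers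
  of \<open>\<psi> u - \<psi> z\<close> shows that \<open>a G\<close> has the coordinates \<open>(\<Sum>i\<le>k. (- 1)\<^sup>i / i! (D\<^sup>i a) g\<^bsub>k-i\<^esub>)\<close>. Since
  \<open>D\<close> acts continuously on \<open>A\<^sup>\<infinity>\<close>, this gives the module structure, and since the matrix is triangular,
  division by a conformal equivalence reduces to division in \<open>F\<close>.

  The evaluations are bounded by the uniform boundedness principle and the Cauchy inequalities;
  vector-valued holomorphic functions are reduced to scalar ones by norming functionals.
\<close>

section \<open>Norming functionals\<close>

text \<open>The arrays of members of \<open>F\<close> alone do not form a module: the product of a
  scalar function \<open>a\<close> with the array of \<open>f\<close> is in general not the array of
  \<open>a f\<close>, whose entries also carry derivatives of \<open>a\<close>. The powers of
  \<open>\<psi> - \<psi> u\<close>, whose base point moves with \<open>u\<close>, supply the missing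
  directions; as multiplication by them maps \<open>F\<close> into itself for each fixed
  \<open>u\<close>, they do not enlarge the fibres. The price is that multiplication by
  \<open>a\<close> brings in derivatives of \<open>a\<close> up to order \<open>n - 1\<close>, which
  is affordable because the algebra \<open>Ainf\<close> is stable under differentiation. With the
  sum norm on the coordinates, the new space is a copy of the \<open>n\<close>-fold product of
  \<open>F\<close>. Completeness and continuity are therefore checked coordinate by coordinate, and
  the norm of the array of \<open>f\<close> is exactly that of \<open>f\<close>. The evaluations are
  not covered by this: the value of \<open>G\<close> contains derivatives of its coordinates,
  whereas the axioms only control values of members of \<open>F\<close>. This is where boundedness
  has to be made uniform on compact sets.\<close>

definition sublinear :: "('a::real_vector \<Rightarrow> real) \<Rightarrow> bool"
  where "sublinear p \<longleftrightarrow>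
    (\<forall>x y. p (x + y) \<le> p x + p y) \<and> (\<forall>x. \<forall>t>0. p (t *\<^sub>R x) \<le> t * p x)"

lemma sublinear_add: "sublinear p \<Longrightarrow> p (x + y) \<le> p x + p y"
  by (simp add: sublinear_def)

text \<open>The definition bounds \<open>p\<close> of a positive multiple from above; the reverse
  bound is the same one for the vector \<open>t x\<close> and the factor
  \<open>1 / t\<close>.\<close>

lemma sublinear_scale:
  assumes "sublinear p" "t > 0"
  shows "p (t *\<^sub>R x) = t * p x"
proof (rule antisym)
  show "p (t *\<^sub>R x) \<le> t * p x"
    using assms by (simp add: sublinear_def)
  have "p (inverse t *\<^sub>R (t *\<^sub>R x)) \<le> inverse t * p (t *\<^sub>R x)"
    using assms positive_imp_inverse_positive [of t] unfolding sublinear_def by blast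
  then show "t * p x \<le> p (t *\<^sub>R x)"
    using assms by (simp add: field_simps)
qed

lemma sublinear_zero: "sublinear p \<Longrightarrow> p 0 = 0"
  using sublinear_scale [of p 2 0] by simp

lemma sublinear_ge_uminus: "sublinear p \<Longrightarrow> - p (- x) \<le> p x"
  using sublinear_add [of p x "- x"] sublinear_zero [of p] by simp

text \<open>\<open>p\<close> is lowered along the ray spanned by \<open>y\<close>, and the ray
  parameter \<open>1\<close> at \<open>- y\<close> gives the last bound. This takes the place of the
  one-dimensional extension step in the Hahn-Banach theorem: a functional that cannot be lowered any
  further must be odd.\<close>

lemma sublinear_slide:
  assumes p: "sublinear p"
  obtains q where "sublinear q" "\<And>x. q x \<le> p x" "q (- y) \<le> - p y"
proof
  define q where "q = (\<lambda>x. INF t\<in>{0..}. p (x + t *\<^sub>R y) - t * p y)"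
  \<comment> \<open>Subadditivity, applied to \<open>t y = (x + t y) + (- x)\<close>, keeps the
    infimum finite.\<close>
  have lower: "- p (- x) \<le> p (x + t *\<^sub>R y) - t * p y" if "0 \<le> t" for x t
  proof -
    have "t * p y = p (t *\<^sub>R y)"
      using sublinear_scale [OF p] sublinear_zero [OF p] that by (cases "t = 0") auto
    then show ?thesis
      using sublinear_add [OF p, of "- x" "x + t *\<^sub>R y"] by simp
  qed
  then have bdd: "bdd_below ((\<lambda>t. p (x + t *\<^sub>R y) - t * p y) ` {0..})" for x
    by (auto intro!: bdd_belowI [where m = "- p (- x)"])
  have q_le: "q x \<le> p (x + t *\<^sub>R y) - t * p y" if "0 \<le> t" for x t
    unfolding q_def using that by (intro cINF_lower bdd) auto
  have q_ge: "c \<le> q x" if "\<And>t. 0 \<le> t \<Longrightarrow> c \<le> p (x + t *\<^sub>R y) - t * p y" for x c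
    unfolding q_def using that by (intro cINF_greatest) auto
  have "q (x + x') \<le> q x + q x'" for x x'
  proof -
    have "q (x + x') - (p (x + t *\<^sub>R y) - t * p y) \<le> q x'" if "0 \<le> t" for t
    proof (rule q_ge)
      fix t' :: real assume "0 \<le> t'"
      then have "q (x + x') \<le> p (x + x' + (t + t') *\<^sub>R y) - (t + t') * p y"
        using that by (intro q_le) auto
      also have "p (x + x' + (t + t') *\<^sub>R y) \<le> p (x + t *\<^sub>R y) + p (x' + t' *\<^sub>R y)"
        using sublinear_add [OF p, of "x + t *\<^sub>R y" "x' + t' *\<^sub>R y"]
        by (simp add: algebra_simps)
      finally show "q (x + x') - (p (x + t *\<^sub>R y) - t * p y) \<le> p (x' + t' *\<^sub>R y) - t' * p y"
        by (simp add: algebra_simps)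
    qed
    then have "q (x + x') - q x' \<le> q x"
      by (intro q_ge) (simp add: algebra_simps)
    then show ?thesis by simp
  qed
  moreover have "q (s *\<^sub>R x) \<le> s * q x" if "s > 0" for s x
  proof -
    have "inverse s * q (s *\<^sub>R x) \<le> q x"
    proof (rule q_ge)
      fix t :: real assume "0 \<le> t"
      then have "q (s *\<^sub>R x) \<le> p (s *\<^sub>R x + (s * t) *\<^sub>R y) - (s * t) * p y"
        using that by (intro q_le) auto
      also have "\<dots> = s * (p (x + t *\<^sub>R y) - t * p y)"
        using sublinear_scale [OF p that, of "x + t *\<^sub>R y"] by (simp add: algebra_simps)
      finally show "inverse s * q (s *\<^sub>R x) \<le> p (x + t *\<^sub>R y) - t * p y"
        using that by (simp add: field_simps)
    qed
    then show ?thesis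
      using that by (simp add: field_simps)
  qed
  ultimately show "sublinear q"
    by (simp add: sublinear_def)
  show "q x \<le> p x" for x
    using q_le [of 0 x] by simp
  show "q (- y) \<le> - p y"
    using q_le [of 1 "- y"] sublinear_zero [OF p] by simp
qed

text \<open>Zorn's lemma, applied downwards. The pointwise infimum of a chain stays subadditive
  because two members used at \<open>x\<close> and at \<open>y\<close> may both be replaced by the
  smaller of them.\<close>

lemma minimal_sublinear_exists:
  assumes p: "sublinear p"
  obtains m where "sublinear m" "\<And>x. m x \<le> p x"
    "\<And>q. sublinear q \<Longrightarrow> (\<And>x. q x \<le> m x) \<Longrightarrow> q = m"
proof -
  define A where "A = {q. sublinear q \<and> q \<le> p}"
  have "\<exists>m\<in>A. \<forall>q\<in>A. (\<ge>) m q \<longrightarrow> q = m"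
  proof (rule predicate_Zorn)
    show "partial_order_on A (relation_of (\<ge>) A)"
      by (rule partial_order_on_relation_ofI) auto
    fix C assume "C \<in> Chains (relation_of (\<ge>) A)"
    then have CA: "C \<subseteq> A" and chain: "\<And>q r. q \<in> C \<Longrightarrow> r \<in> C \<Longrightarrow> q \<le> r \<or> r \<le> q"
      by (auto simp: Chains_def relation_of_def)
    show "\<exists>u\<in>A. \<forall>q\<in>C. u \<le> q"
    \<comment> \<open>The infimum of an empty set of reals carries no information, so the empty
      chain is bounded by \<open>p\<close> itself.\<close>
    proof (cases "C = {}")
      case True
      with p show ?thesis by (auto simp: A_def)
    next
      case False
      define u where "u = (\<lambda>x. INF q\<in>C. q x)"
      have "- p (- x) \<le> q x" if "q \<in> C" for q x
      proof -
        have "sublinear q" "q (- x) \<le> p (- x)"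
          using that CA by (auto simp: A_def le_fun_def)
        then show ?thesis
          using sublinear_ge_uminus [of q x] by linarith
      qed
      then have bdd: "bdd_below ((\<lambda>q. q x) ` C)" for x
        by (auto intro!: bdd_belowI [where m = "- p (- x)"])
      have u_le: "u x \<le> q x" if "q \<in> C" for q x
        unfolding u_def using that by (intro cINF_lower bdd) auto
      have u_ge: "c \<le> u x" if "\<And>q. q \<in> C \<Longrightarrow> c \<le> q x" for c x
        unfolding u_def using that False by (intro cINF_greatest) auto
      have "u (x + y) \<le> u x + u y" for x y
      proof -
        have "u (x + y) \<le> q x + r y" if "q \<in> C" "r \<in> C" for q r
        proof -
          from chain [OF that] that obtain s where s: "s \<in> C" "s \<le> q" "s \<le> r"
            by blast
          then have "sublinear s"
            using CA by (auto simp: A_def)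
          have "u (x + y) \<le> s (x + y)"
            using s by (intro u_le)
          also have "\<dots> \<le> s x + s y"
            using \<open>sublinear s\<close> by (rule sublinear_add)
          also have "\<dots> \<le> q x + r y"
            using s by (intro add_mono) (auto simp: le_fun_def)
          finally show ?thesis .
        qed
        note le = this
        have "u (x + y) - q x \<le> u y" if "q \<in> C" for q
        proof (rule u_ge)
          fix r assume "r \<in> C"
          from le [OF that this] show "u (x + y) - q x \<le> r y"
            by linarith
        qed
        note le' = this
        have "u (x + y) - u y \<le> u x"
        proof (rule u_ge)
          fix q assume "q \<in> C"
          from le' [OF this] show "u (x + y) - u y \<le> q x"
            by linarith
        qed
        then show ?thesis by linarith
      qed
      moreover have "u (t *\<^sub>R x) \<le> t * u x" if "t > 0" for t x
      proof -
        have "inverse t * u (t *\<^sub>R x) \<le> u x"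
        proof (rule u_ge)
          fix q assume "q \<in> C"
          then have "u (t *\<^sub>R x) \<le> t * q x"
            using CA u_le [of q "t *\<^sub>R x"] sublinear_scale [of q t x] that by (auto simp: A_def)
          then show "inverse t * u (t *\<^sub>R x) \<le> q x"
            using that by (simp add: field_simps)
        qed
        then show ?thesis
          using that by (simp add: field_simps)
      qed
      ultimately have "sublinear u"
        by (simp add: sublinear_def)
      moreover have "u \<le> q" if "q \<in> C" for q
        using u_le [OF that] by (simp add: le_fun_def)
      moreover from this have "u \<le> p"
        using False CA by (force simp: A_def)
      ultimately show ?thesis
        by (auto simp: A_def)
    qed
  qed
  then obtain m where m: "m \<in> A" "\<And>q. q \<in> A \<Longrightarrow> q \<le> m \<Longrightarrow> q = m"
    by blast
  show thesis
  proof
    show "sublinear m" "m x \<le> p x" for x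
      using m by (auto simp: A_def le_fun_def)
    show "q = m" if "sublinear q" "\<And>x. q x \<le> m x" for q
    proof (rule m(2))
      show "q \<le> m"
        using that by (simp add: le_fun_def)
      also have "m \<le> p"
        using m by (simp add: A_def)
      finally show "q \<in> A"
        using that by (simp add: A_def)
    qed
  qed
qed

text \<open>A minimal sublinear functional agrees with each of its slides, hence is odd, hence
  linear. Sliding \<open>p\<close> along \<open>x\<close> before minimising prescribes the value at
  \<open>x\<close>: whatever lies below that slide is at most \<open>- p x\<close> at
  \<open>- x\<close>.\<close>

lemma linear_functional_below_sublinear:
  assumes p: "sublinear (p :: 'a::real_vector \<Rightarrow> real)"
  obtains g where "linear g" "\<And>y. g y \<le> p y" "g x = p x"
proof -
  obtain p' where p': "sublinear p'" "\<And>y. p' y \<le> p y" "p' (- x) \<le> - p x"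
    using sublinear_slide [OF p] by metis
  obtain m where m: "sublinear m" "\<And>y. m y \<le> p' y"
      "\<And>q. sublinear q \<Longrightarrow> (\<And>y. q y \<le> m y) \<Longrightarrow> q = m"
    using minimal_sublinear_exists [OF p'(1)] by metis
  have uminus: "m (- y) = - m y" for y
  proof (rule antisym)
    obtain q where "sublinear q" "\<And>x. q x \<le> m x" "q (- y) \<le> - m y"
      using sublinear_slide [OF m(1)] by metis
    with m(3) show "m (- y) \<le> - m y"
      by metis
    show "- m y \<le> m (- y)"
      using sublinear_ge_uminus [OF m(1), of "- y"] by simp
  qed
  have add: "m (y + z) = m y + m z" for y z
    using sublinear_add [OF m(1), of y z] sublinear_add [OF m(1), of "y + z" "- z"] uminus [of z]
    by simp
  have scale: "m (t *\<^sub>R y) = t * m y" for t y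
  proof (cases t "0 :: real" rule: linorder_cases)
    case less
    then show ?thesis
      using sublinear_scale [OF m(1), of "- t" y] uminus [of "t *\<^sub>R y"] by simp
  next
    case equal
    then show ?thesis by (simp add: sublinear_zero [OF m(1)])
  next
    case greater
    then show ?thesis by (rule sublinear_scale [OF m(1)])
  qed
  show thesis
  proof
    show "linear m"
      by (rule linearI) (simp_all add: add scale)
    show le: "m y \<le> p y" for y
      using m(2) p'(2) by (meson order_trans)
    show "m x = p x"
      using le [of x] m(2) [of "- x"] p'(3) uminus [of x] by simp
  qed
qed

section \<open>Arithmetic of complex scalars in a Banach space\<close>

lemma scaleC_zero_left [simp]: "0 *\<^sub>C x = (0 :: 'a::complex_banach)"
  using scaleC_add_left [of 0 0 x] by simp

lemma scaleC_zero_right [simp]: "c *\<^sub>C 0 = (0 :: 'a::complex_banach)"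
  using scaleC_add_right [of c 0 0] by simp

lemma scaleC_one [simp]: "1 *\<^sub>C x = (x :: 'a::complex_banach)"
  using scaleR_scaleC [of 1 x] by simp

lemma scaleC_minus_left: "(- c) *\<^sub>C x = - (c *\<^sub>C (x :: 'a::complex_banach))"
  using scaleC_add_left [of c "- c" x] by (metis add.right_inverse minus_unique scaleC_zero_left)

lemma scaleC_minus_right: "c *\<^sub>C (- x) = - (c *\<^sub>C (x :: 'a::complex_banach))"
  using scaleC_add_right [of c x "- x"] by (metis add.right_inverse minus_unique scaleC_zero_right)

lemma scaleC_diff_left: "(c - d) *\<^sub>C x = c *\<^sub>C x - d *\<^sub>C (x :: 'a::complex_banach)"
  using scaleC_add_left [of c "- d" x] by (simp add: scaleC_minus_left)

lemma scaleC_diff_right: "c *\<^sub>C (x - y) = c *\<^sub>C x - c *\<^sub>C (y :: 'a::complex_banach)"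
  using scaleC_add_right [of c x "- y"] by (simp add: scaleC_minus_right)

lemma scaleC_minus1: "(- 1) *\<^sub>C x = - (x :: 'a::complex_banach)"
  by (simp add: scaleC_minus_left)

lemma scaleC_scaleR: "c *\<^sub>C (r *\<^sub>R x) = r *\<^sub>R (c *\<^sub>C (x :: 'a::complex_banach))"
  by (simp only: scaleR_scaleC scaleC_scaleC mult.commute)

lemma scaleR_scaleC_left: "(r *\<^sub>R c) *\<^sub>C x = r *\<^sub>R (c *\<^sub>C (x :: 'a::complex_banach))"
  by (simp only: scaleR_scaleC scaleC_scaleC scaleR_conv_of_real)

lemma bounded_bilinear_scaleC: "bounded_bilinear (scaleC :: complex \<Rightarrow> 'a::complex_banach \<Rightarrow> 'a)"
proof
  show "\<exists>K. \<forall>c x. norm (c *\<^sub>C (x :: 'a)) \<le> norm c * norm x * K"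
    by (rule exI [where x = 1]) (simp add: norm_scaleC)
qed (simp_all only: scaleC_add_left scaleC_add_right scaleR_scaleC_left scaleC_scaleR)

lemma scaleC_sum_right: "c *\<^sub>C (\<Sum>i\<in>I. f i) = (\<Sum>i\<in>I. c *\<^sub>C (f i :: 'a::complex_banach))"
  by (rule bounded_bilinear.sum_right [OF bounded_bilinear_scaleC])

lemma scaleC_sum_left: "(\<Sum>i\<in>I. c i) *\<^sub>C x = (\<Sum>i\<in>I. c i *\<^sub>C (x :: 'a::complex_banach))"
  by (rule bounded_bilinear.sum_left [OF bounded_bilinear_scaleC])

lemma scaleC_cancel_left: "c \<noteq> 0 \<Longrightarrow> c *\<^sub>C x = c *\<^sub>C y \<longleftrightarrow> x = (y :: 'a::complex_banach)"
  by (metis scaleC_scaleC left_inverse scaleC_one)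

section \<open>Complex functionals of norm at most one\<close>

definition contractive_functional :: "('a::complex_banach \<Rightarrow> complex) \<Rightarrow> bool"
  where "contractive_functional L \<longleftrightarrow> (\<forall>x y. L (x + y) = L x + L y) \<and>
    (\<forall>c x. L (c *\<^sub>C x) = c * L x) \<and> (\<forall>x. cmod (L x) \<le> norm x)"

text \<open>A real norming functional \<open>g\<close> becomes the real part of the complex one.
  Multiplying \<open>y\<close> by the phase that makes \<open>L y\<close> real and nonnegative turns
  the bound on \<open>g\<close> into a bound on \<open>cmod (L y)\<close>.\<close>

lemma norming_functional:
  fixes x :: "'a::complex_banach"
  obtains L where "contractive_functional L" "cmod (L x) = norm x"
proof -
  have "sublinear (norm :: 'a \<Rightarrow> real)"
    by (simp add: sublinear_def norm_triangle_ineq)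
  then obtain g where g: "linear g" "\<And>y. g y \<le> norm y" "g x = norm x"
    using linear_functional_below_sublinear by metis
  have g_add: "g (y + z) = g y + g z" and g_scale: "g (r *\<^sub>R y) = r * g y" for y z r
    using g(1) by (simp_all add: linear_add linear_scale)
  define L where "L y = Complex (g y) (- g (\<i> *\<^sub>C y))" for y
  have L_add: "L (y + z) = L y + L z" for y z
    by (rule complex_eqI) (simp_all add: L_def scaleC_add_right g_add)
  have L_scale: "L (c *\<^sub>C y) = c * L y" for c y
  proof -
    have "complex_of_real (Re c) + of_real (Im c) * \<i> = c"
      by (simp add: complex_eq_iff)
    then have c: "c *\<^sub>C y = Re c *\<^sub>R y + Im c *\<^sub>R (\<i> *\<^sub>C y)"
      unfolding scaleR_scaleC scaleC_scaleC scaleC_add_left [symmetric] by simp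
    have "complex_of_real (Re c) * \<i> - of_real (Im c) = \<i> * c"
      by (simp add: complex_eq_iff)
    then have ic: "\<i> *\<^sub>C c *\<^sub>C y = Re c *\<^sub>R (\<i> *\<^sub>C y) - Im c *\<^sub>R y"
      unfolding scaleR_scaleC scaleC_scaleC scaleC_diff_left [symmetric] by simp
    have "g (\<i> *\<^sub>C c *\<^sub>C y) = Re c * g (\<i> *\<^sub>C y) - Im c * g y"
      unfolding ic using g(1) by (simp add: linear_diff linear_scale)
    then show ?thesis
      unfolding L_def by (intro complex_eqI) (simp_all add: c g_add g_scale)
  qed
  have L_le: "cmod (L y) \<le> norm y" for y
  proof (cases "L y = 0")
    case False
    define c where "c = cnj (L y) / cmod (L y)"
    have "L (c *\<^sub>C y) = of_real (cmod (L y))"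
      unfolding L_scale c_def using False
      by (simp add: field_simps power2_eq_square flip: complex_norm_square)
    then have "cmod (L y) = g (c *\<^sub>C y)"
      by (metis L_def Re_complex_of_real complex.sel(1))
    also have "\<dots> \<le> norm (c *\<^sub>C y)"
      by (rule g)
    also have "\<dots> = norm y"
      using False by (simp add: norm_scaleC c_def norm_divide)
    finally show ?thesis .
  qed simp
  show thesis
  proof
    show "contractive_functional L"
      by (simp add: contractive_functional_def L_add L_scale L_le)
    have "norm x = Re (L x)"
      by (simp add: L_def g)
    then show "cmod (L x) = norm x"
      using L_le [of x] complex_Re_le_cmod [of "L x"] by simp
  qed
qed

lemma functional_add: "contractive_functional L \<Longrightarrow> L (x + y) = L x + L y"
  and functional_scaleC: "contractive_functional L \<Longrightarrow> L (c *\<^sub>C x) = c * L x"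
  and functional_norm_le: "contractive_functional L \<Longrightarrow> cmod (L x) \<le> norm x"
  by (simp_all add: contractive_functional_def)

lemma functional_scaleR: "contractive_functional L \<Longrightarrow> L (r *\<^sub>R x) = of_real r * L x"
  by (simp add: scaleR_scaleC functional_scaleC)

lemma bounded_linear_functional: "contractive_functional L \<Longrightarrow> bounded_linear L"
  by (rule bounded_linear_intro [where K = 1])
    (simp_all add: functional_add functional_scaleR functional_norm_le scaleR_conv_of_real)

lemma functional_diff: "contractive_functional L \<Longrightarrow> L (x - y) = L x - L y"
  by (simp add: bounded_linear_functional linear_diff bounded_linear.linear)

lemma functional_sum: "contractive_functional L \<Longrightarrow> L (\<Sum>i\<in>I. f i) = (\<Sum>i\<in>I. L (f i))"
  by (simp add: bounded_linear_functional linear_sum bounded_linear.linear)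

text \<open>Identities between vectors, such as the product rule for Taylor coefficients, are
  obtained below by applying an arbitrary functional to both sides.\<close>

lemma functionals_separate:
  assumes "\<And>L. contractive_functional L \<Longrightarrow> L x = L y"
  shows "x = y"
proof -
  obtain L where "contractive_functional L" "cmod (L (x - y)) = norm (x - y)"
    by (rule norming_functional)
  with assms [of L] show ?thesis
    by (simp add: functional_diff)
qed

section \<open>Vector-valued holomorphic functions\<close>

text \<open>In contrast to \<open>analytic_funs\<close> the values off \<open>U\<close> are left
  free, since \<open>complex_deriv\<close>, a definite description, need not vanish there.\<close>

definition vec_holomorphic_on :: "(complex \<Rightarrow> 'a::complex_banach) \<Rightarrow> complex set \<Rightarrow> bool"
    (infixl "(vec'_holomorphic'_on)" 50)
  where "f vec_holomorphic_on U \<longleftrightarrow> (\<forall>z\<in>U. \<exists>d. has_complex_deriv f d z)"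

lemma analytic_funs_iff:
  "f \<in> analytic_funs U \<longleftrightarrow> f vec_holomorphic_on U \<and> (\<forall>z. z \<notin> U \<longrightarrow> f z = 0)"
  by (simp add: analytic_funs_def vec_holomorphic_on_def)

lemma has_complex_deriv_unique:
  assumes "has_complex_deriv f d z" "has_complex_deriv f e z"
  shows "d = e"
proof -
  have "(\<lambda>h. h *\<^sub>C d) = (\<lambda>h. h *\<^sub>C e)"
    using assms unfolding has_complex_deriv_def by (rule has_derivative_unique)
  from fun_cong [OF this, of 1] show ?thesis by simp
qed

lemma complex_deriv_eq: "has_complex_deriv f d z \<Longrightarrow> complex_deriv f z = d"
  unfolding complex_deriv_def using has_complex_deriv_unique by blast

lemma vec_holomorphic_deriv:
  "f vec_holomorphic_on U \<Longrightarrow> z \<in> U \<Longrightarrow> has_complex_deriv f (complex_deriv f z) z"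
  unfolding vec_holomorphic_on_def using complex_deriv_eq by metis

lemma has_complex_deriv_transform:
  assumes "has_complex_deriv f d z" "open U" "z \<in> U" "\<And>w. w \<in> U \<Longrightarrow> f w = g w"
  shows "has_complex_deriv g d z"
  using assms unfolding has_complex_deriv_def by (rule has_derivative_transform_within_open)

lemma vec_holomorphic_cong:
  assumes "open U" "\<And>z. z \<in> U \<Longrightarrow> f z = g z"
  shows "f vec_holomorphic_on U \<longleftrightarrow> g vec_holomorphic_on U"
  unfolding vec_holomorphic_on_def
  using has_complex_deriv_transform [OF _ assms(1), of f _ _ g]
    has_complex_deriv_transform [OF _ assms(1), of g _ _ f] assms(2)
  by metis

lemma has_complex_deriv_scaleC:
  assumes "(a has_field_derivative a') (at z)" "has_complex_deriv f d z"
  shows "has_complex_deriv (\<lambda>z. a z *\<^sub>C f z) (a z *\<^sub>C d + a' *\<^sub>C f z) z"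
proof -
  have "((\<lambda>z. a z *\<^sub>C f z) has_derivative (\<lambda>h. a z *\<^sub>C h *\<^sub>C d + (a' * h) *\<^sub>C f z)) (at z)"
    using assms unfolding has_complex_deriv_def has_field_derivative_def
    by (rule bounded_bilinear.FDERIV [OF bounded_bilinear_scaleC])
  moreover have "(\<lambda>h. a z *\<^sub>C h *\<^sub>C d + (a' * h) *\<^sub>C f z) = (\<lambda>h. h *\<^sub>C (a z *\<^sub>C d + a' *\<^sub>C f z))"
    by (simp add: scaleC_add_right scaleC_scaleC mult.commute)
  ultimately show ?thesis
    by (simp add: has_complex_deriv_def)
qed

lemma has_complex_deriv_add:
  "has_complex_deriv f d z \<Longrightarrow> has_complex_deriv g e z \<Longrightarrow> has_complex_deriv (\<lambda>z. f z + g z) (d + e) z"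
  unfolding has_complex_deriv_def scaleC_add_right by (rule has_derivative_add)

lemma has_complex_deriv_functional:
  assumes "contractive_functional L" "has_complex_deriv f d z"
  shows "((\<lambda>z. L (f z)) has_field_derivative L d) (at z)"
proof -
  have "((\<lambda>z. L (f z)) has_derivative (\<lambda>h. L (h *\<^sub>C d))) (at z)"
    using assms(2) unfolding has_complex_deriv_def
    by (rule bounded_linear.has_derivative [OF bounded_linear_functional [OF assms(1)]])
  moreover have "(\<lambda>h. L (h *\<^sub>C d)) = (*) (L d)"
    using assms(1) by (simp add: fun_eq_iff functional_scaleC)
  ultimately show ?thesis
    by (simp add: has_field_derivative_def)
qed

lemma vec_holomorphic_zero [simp]: "(\<lambda>z. 0) vec_holomorphic_on U"
  unfolding vec_holomorphic_on_def has_complex_deriv_def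
  by (intro ballI exI [where x = 0]) simp

lemma vec_holomorphic_scaleC:
  assumes "a holomorphic_on U" "open U" "f vec_holomorphic_on U"
  shows "(\<lambda>z. a z *\<^sub>C f z) vec_holomorphic_on U"
  using assms holomorphic_derivI has_complex_deriv_scaleC unfolding vec_holomorphic_on_def
  by metis

lemma vec_holomorphic_const_scaleC:
  assumes "f vec_holomorphic_on U"
  shows "(\<lambda>z. c *\<^sub>C f z) vec_holomorphic_on U"
  using assms has_complex_deriv_scaleC [OF DERIV_const] unfolding vec_holomorphic_on_def
  by metis

lemma vec_holomorphic_add:
  "f vec_holomorphic_on U \<Longrightarrow> g vec_holomorphic_on U \<Longrightarrow> (\<lambda>z. f z + g z) vec_holomorphic_on U"
  unfolding vec_holomorphic_on_def using has_complex_deriv_add by metis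

lemma vec_holomorphic_diff:
  assumes "f vec_holomorphic_on U" "g vec_holomorphic_on U"
  shows "(\<lambda>z. f z - g z) vec_holomorphic_on U"
  using vec_holomorphic_add [OF assms(1) vec_holomorphic_const_scaleC [OF assms(2), of "- 1"]]
  by (simp add: scaleC_minus1)

lemma vec_holomorphic_sum:
  "(\<And>i. i \<in> I \<Longrightarrow> f i vec_holomorphic_on U) \<Longrightarrow> (\<lambda>z. \<Sum>i\<in>I. f i z) vec_holomorphic_on U"
  by (induction I rule: infinite_finite_induct) (auto intro: vec_holomorphic_add)

lemma vec_holomorphic_imp_continuous_on: "f vec_holomorphic_on U \<Longrightarrow> continuous_on U f"
  unfolding vec_holomorphic_on_def has_complex_deriv_def
  using has_derivative_continuous continuous_at_imp_continuous_on by blast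

lemma functional_holomorphic:
  assumes "contractive_functional L" "f vec_holomorphic_on U"
  shows "(\<lambda>z. L (f z)) holomorphic_on U"
  unfolding holomorphic_on_def field_differentiable_def
  using has_complex_deriv_functional [OF assms(1)] assms(2)
  unfolding vec_holomorphic_on_def by (meson has_field_derivative_at_within)

text \<open>Taylor's theorem for the derivative of \<open>g\<close>, with a constant that sees
  \<open>g\<close> only through \<open>B\<close>; one estimate thus serves all compositions of a
  vector-valued function with contractive functionals. Discs of radius \<open>r\<close> about points
  of \<open>cball z r\<close> stay inside \<open>cball z (2 * r)\<close>, and Cauchy's inequality on
  them bounds the third derivative by \<open>3! B / r^3\<close>.\<close>

lemma deriv_remainder_bound:
  assumes "open U" "g holomorphic_on U" "0 < r" "cball z (2 * r) \<subseteq> U"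
    and B: "\<And>w. w \<in> cball z (2 * r) \<Longrightarrow> cmod (g w) \<le> B" and h: "cmod h \<le> r"
  shows "cmod (deriv g (z + h) - deriv g z - h * deriv (deriv g) z) \<le> 6 * B / r ^ 3 * (cmod h)\<^sup>2"
proof -
  have sub: "cball x r \<subseteq> cball z (2 * r)" if "x \<in> cball z r" for x
    using that by (simp add: cball_subset_cball_iff dist_commute)
  have "cmod ((deriv ^^ 3) g x) \<le> fact 3 * B / r ^ 3" if "x \<in> cball z r" for x
  proof (rule Cauchy_inequality)
    have "g holomorphic_on cball x r"
      using assms sub [OF that] by (meson holomorphic_on_subset)
    then show "g holomorphic_on ball x r" "continuous_on (cball x r) g"
      by (auto intro: holomorphic_on_subset holomorphic_on_imp_continuous_on)
    show "cmod (g w) \<le> B" if "cmod (x - w) = r" for w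
      using that sub [OF \<open>x \<in> cball z r\<close>] by (intro B) (auto simp: dist_norm)
  qed (use assms in auto)
  then have bound: "cmod ((deriv ^^ 3) g x) \<le> 6 * B / r ^ 3" if "x \<in> cball z r" for x
    using that by (simp add: fact_numeral)
  have "cmod ((deriv ^^ Suc 0) g (z + h)
      - (\<Sum>i\<le>1. (deriv ^^ Suc i) g z * (z + h - z) ^ i / fact i))
    \<le> (6 * B / r ^ 3) * cmod (z + h - z) ^ Suc 1 / fact 1"
  proof (rule complex_Taylor [where S = "cball z r" and f = "\<lambda>i. (deriv ^^ Suc i) g"])
    show "((deriv ^^ Suc i) g has_field_derivative (deriv ^^ Suc (Suc i)) g x) (at x within cball z r)"
      if "x \<in> cball z r" for i x
      using has_field_derivative_higher_deriv [OF assms(2,1)] that assms sub [OF that]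
      by (meson centre_in_cball has_field_derivative_at_within less_imp_le subsetD)
  qed (use assms h bound in \<open>auto simp: numeral_3_eq_3 dist_norm\<close>)
  then show ?thesis
    by (simp add: numeral_2_eq_2 algebra_simps)
qed

text \<open>Functionals by themselves give only weak differentiability of the derivative. As the
  remainder bound is uniform over them, the difference quotients \<open>q h\<close> satisfy a Cauchy
  condition in norm, and completeness supplies the limit.\<close>

lemma vec_holomorphic_complex_deriv:
  fixes f :: "complex \<Rightarrow> 'a::complex_banach"
  assumes "open U" "f vec_holomorphic_on U"
  shows "complex_deriv f vec_holomorphic_on U"
  unfolding vec_holomorphic_on_def
proof
  fix z assume "z \<in> U"
  then obtain r0 where "r0 > 0" and r0: "cball z r0 \<subseteq> U"
    using \<open>open U\<close> open_contains_cball by blast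
  define r where "r = r0 / 2"
  have r: "r > 0" "cball z (2 * r) \<subseteq> U"
    using \<open>r0 > 0\<close> r0 by (simp_all add: r_def)
  have "compact (f ` cball z (2 * r))"
    using vec_holomorphic_imp_continuous_on [OF assms(2)] r
    by (intro compact_continuous_image) (auto intro: continuous_on_subset)
  then obtain B where B: "\<And>w. w \<in> cball z (2 * r) \<Longrightarrow> norm (f w) \<le> B"
    using compact_imp_bounded bounded_iff by (metis imageI)
  define C where "C = 6 * B / r ^ 3"
  have "B \<ge> 0"
    using B [of z] r norm_ge_zero [of "f z"] by (smt (verit) centre_in_cball)
  then have "C \<ge> 0"
    using r by (simp add: C_def)
  define q where "q h = inverse h *\<^sub>C (complex_deriv f (z + h) - complex_deriv f z)" for h
  have q: "norm (q h - q k) \<le> C * (cmod h + cmod k)"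
    if "h \<noteq> 0" "cmod h \<le> r" "k \<noteq> 0" "cmod k \<le> r" for h k
  proof -
    \<comment> \<open>This \<open>L\<close> depends on \<open>h\<close> and \<open>k\<close>; the
      constant \<open>C\<close> does not.\<close>
    obtain L where L: "contractive_functional L" "cmod (L (q h - q k)) = norm (q h - q k)"
      by (rule norming_functional)
    define g where "g = (\<lambda>w. L (f w))"
    have g: "g holomorphic_on U"
      unfolding g_def using L assms by (intro functional_holomorphic)
    have deriv_g: "deriv g w = L (complex_deriv f w)" if "w \<in> U" for w
      unfolding g_def using has_complex_deriv_functional [OF L(1) vec_holomorphic_deriv [OF assms(2) that]]
      by (rule DERIV_imp_deriv)
    have gB: "cmod (g w) \<le> B" if "w \<in> cball z (2 * r)" for w
      unfolding g_def using functional_norm_le [OF L(1), of "f w"] B [OF that] by linarith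
    have Lq: "cmod (L (q t) - deriv (deriv g) z) \<le> C * cmod t" if t: "t \<noteq> 0" "cmod t \<le> r" for t
    proof -
      have "z + t \<in> cball z (2 * r)"
        using t r by (simp add: dist_norm)
      then have "L (q t) = inverse t * (deriv g (z + t) - deriv g z)"
        using L r \<open>z \<in> U\<close> deriv_g [of z] deriv_g [of "z + t"]
        by (auto simp: q_def functional_scaleC functional_diff)
      then have "t * (L (q t) - deriv (deriv g) z) = deriv g (z + t) - deriv g z - t * deriv (deriv g) z"
        using t by (simp add: field_simps)
      then have "cmod t * cmod (L (q t) - deriv (deriv g) z) \<le> C * (cmod t)\<^sup>2"
        using deriv_remainder_bound [OF assms(1) g r gB t(2)] by (simp add: C_def flip: norm_mult)
      then have "cmod t * cmod (L (q t) - deriv (deriv g) z) \<le> cmod t * (C * cmod t)"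
        by (simp add: power2_eq_square mult_ac)
      then show ?thesis
        using t by simp
    qed
    have "cmod (L (q h - q k)) = cmod ((L (q h) - deriv (deriv g) z) - (L (q k) - deriv (deriv g) z))"
      using L by (simp add: functional_diff)
    also have "\<dots> \<le> C * cmod h + C * cmod k"
      using Lq [OF that(1,2)] Lq [OF that(3,4)] norm_triangle_ineq4 by (meson add_mono order_trans)
    finally show ?thesis
      using L by (simp add: algebra_simps)
  qed
  \<comment> \<open>One null sequence produces the candidate \<open>d\<close>; the estimate between
    \<open>q h\<close> and \<open>q (s n)\<close> then passes to the limit for every
    \<open>h\<close>.\<close>
  define s where "s n = complex_of_real (r * inverse (real (Suc n)))" for n
  have s: "s n \<noteq> 0" "cmod (s n) \<le> r" for n
  proof -
    show "s n \<noteq> 0"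
      using r by (simp add: s_def del: of_nat_Suc)
    have "inverse (real (Suc n)) \<le> 1" "0 \<le> inverse (real (Suc n))"
      by (simp_all add: field_simps)
    then have "\<bar>r * inverse (real (Suc n))\<bar> \<le> r"
      using r by (simp add: abs_mult mult_left_le)
    then show "cmod (s n) \<le> r"
      unfolding s_def norm_of_real .
  qed
  have "(\<lambda>n. r * inverse (real (Suc n))) \<longlonglongrightarrow> r * 0"
    by (intro tendsto_intros LIMSEQ_inverse_real_of_nat)
  then have s0: "s \<longlonglongrightarrow> 0"
    unfolding s_def by (metis mult_zero_right of_real_0 tendsto_of_real)
  have "Cauchy (\<lambda>n. q (s n))"
  proof (rule CauchyI)
    fix e :: real assume "e > 0"
    have "(\<lambda>n. C * cmod (s n)) \<longlonglongrightarrow> C * 0"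
      using tendsto_norm [OF s0] by (intro tendsto_intros) simp
    then have "\<forall>\<^sub>F n in sequentially. C * cmod (s n) < e / 2"
      using \<open>e > 0\<close> by (intro order_tendstoD) auto
    then obtain M where M: "\<And>n. n \<ge> M \<Longrightarrow> C * cmod (s n) < e / 2"
      by (auto simp: eventually_sequentially)
    have "norm (q (s m) - q (s n)) < e" if "m \<ge> M" "n \<ge> M" for m n
      using q [of "s m" "s n"] s M [OF that(1)] M [OF that(2)] by (simp add: distrib_left)
    then show "\<exists>M. \<forall>m\<ge>M. \<forall>n\<ge>M. norm (q (s m) - q (s n)) < e"
      by blast
  qed
  then obtain d where d: "(\<lambda>n. q (s n)) \<longlonglongrightarrow> d"
    using Cauchy_convergent_iff convergent_def by blast
  have qd: "norm (q h - d) \<le> C * cmod h" if "h \<noteq> 0" "cmod h \<le> r" for h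
  proof (rule LIMSEQ_le)
    show "(\<lambda>n. norm (q h - q (s n))) \<longlonglongrightarrow> norm (q h - d)"
      by (intro tendsto_intros d)
    have "(\<lambda>n. C * (cmod h + cmod (s n))) \<longlonglongrightarrow> C * (cmod h + cmod 0)"
      by (intro tendsto_intros s0)
    then show "(\<lambda>n. C * (cmod h + cmod (s n))) \<longlonglongrightarrow> C * cmod h"
      by simp
    show "\<exists>N. \<forall>n\<ge>N. norm (q h - q (s n)) \<le> C * (cmod h + cmod (s n))"
      using q that s by blast
  qed
  have "((\<lambda>h. norm (complex_deriv f (z + h) - complex_deriv f z - h *\<^sub>C d) / norm h) \<longlongrightarrow> 0) (at 0)"
  proof (rule Lim_null_comparison)
    have "((\<lambda>h. C * cmod h) \<longlongrightarrow> C * cmod 0) (at 0)"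
      by (intro tendsto_intros)
    then show "((\<lambda>h. C * cmod h) \<longlongrightarrow> 0) (at 0)"
      by simp
    have "\<forall>\<^sub>F h in at 0. h \<noteq> 0 \<and> cmod h < r"
      unfolding eventually_at using r by (intro exI [where x = r]) simp
    then show "\<forall>\<^sub>F h in at 0.
      norm (norm (complex_deriv f (z + h) - complex_deriv f z - h *\<^sub>C d) / norm h) \<le> C * cmod h"
    proof eventually_elim
      case (elim h)
      then have "complex_deriv f (z + h) - complex_deriv f z - h *\<^sub>C d = h *\<^sub>C (q h - d)"
        by (simp add: q_def scaleC_diff_right scaleC_scaleC)
      then show ?case
        using qd [of h] elim by (simp add: norm_scaleC)
    qed
  qed
  then have "has_complex_deriv (complex_deriv f) d z"
    unfolding has_complex_deriv_def has_derivative_at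
    by (simp add: bounded_bilinear.bounded_linear_left [OF bounded_bilinear_scaleC])
  then show "\<exists>d. has_complex_deriv (complex_deriv f) d z" ..
qed

lemma vec_holomorphic_higher_deriv:
  "open U \<Longrightarrow> f vec_holomorphic_on U \<Longrightarrow> (complex_deriv ^^ k) f vec_holomorphic_on U"
  by (induction k) (simp_all add: vec_holomorphic_complex_deriv)

lemma functional_higher_deriv:
  assumes "contractive_functional L" "open U" "f vec_holomorphic_on U" "z \<in> U"
  shows "(deriv ^^ k) (\<lambda>w. L (f w)) z = L ((complex_deriv ^^ k) f z)"
  using \<open>z \<in> U\<close>
proof (induction k arbitrary: z)
  case (Suc k)
  have "has_complex_deriv ((complex_deriv ^^ k) f) ((complex_deriv ^^ Suc k) f z) z"
    using vec_holomorphic_deriv [OF vec_holomorphic_higher_deriv [OF assms(2,3)]] Suc.prems by simp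
  then have "((\<lambda>w. L ((complex_deriv ^^ k) f w)) has_field_derivative L ((complex_deriv ^^ Suc k) f z)) (at z)"
    by (rule has_complex_deriv_functional [OF assms(1)])
  then have "((deriv ^^ k) (\<lambda>w. L (f w)) has_field_derivative L ((complex_deriv ^^ Suc k) f z)) (at z)"
    by (rule has_field_derivative_transform_within_open [OF _ assms(2) Suc.prems]) (simp add: Suc.IH)
  then show ?case
    by (simp add: DERIV_imp_deriv)
qed simp

section \<open>Taylor coefficients\<close>

text \<open>Division by the factorial turns the Leibniz rule into a Cauchy product without binomial
  coefficients.\<close>

definition coeff_at :: "nat \<Rightarrow> (complex \<Rightarrow> complex) \<Rightarrow> complex \<Rightarrow> complex"
  where "coeff_at k a z = (deriv ^^ k) a z / fact k"

definition vec_coeff_at :: "nat \<Rightarrow> (complex \<Rightarrow> 'a::complex_banach) \<Rightarrow> complex \<Rightarrow> 'a"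
  where "vec_coeff_at k f z = (1 / fact k) *\<^sub>R (complex_deriv ^^ k) f z"

lemma vec_coeff_at_0 [simp]: "vec_coeff_at 0 f z = f z"
  by (simp add: vec_coeff_at_def)

lemma coeff_at_0 [simp]: "coeff_at 0 f z = f z"
  by (simp add: coeff_at_def)

lemma coeff_at_mult:
  assumes "a holomorphic_on U" "b holomorphic_on U" "open U" "z \<in> U"
  shows "coeff_at k (\<lambda>w. a w * b w) z = (\<Sum>i\<le>k. coeff_at i a z * coeff_at (k - i) b z)"
  unfolding coeff_at_def higher_deriv_mult [OF assms] atLeast0AtMost sum_divide_distrib
  by (rule sum.cong) (simp_all add: binomial_fact)

lemma functional_vec_coeff_at:
  assumes "contractive_functional L" "open U" "f vec_holomorphic_on U" "z \<in> U"
  shows "L (vec_coeff_at k f z) = coeff_at k (\<lambda>w. L (f w)) z"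
  using functional_higher_deriv [OF assms, of k]
  by (simp add: vec_coeff_at_def coeff_at_def functional_scaleR [OF assms(1)])

lemma vec_coeff_at_scaleC:
  assumes "a holomorphic_on U" "open U" "f vec_holomorphic_on U" "z \<in> U"
  shows "vec_coeff_at k (\<lambda>w. a w *\<^sub>C f w) z = (\<Sum>i\<le>k. coeff_at i a z *\<^sub>C vec_coeff_at (k - i) f z)"
proof (rule functionals_separate)
  fix L :: "'a \<Rightarrow> complex" assume L: "contractive_functional L"
  have "L (vec_coeff_at k (\<lambda>w. a w *\<^sub>C f w) z) = coeff_at k (\<lambda>w. L (a w *\<^sub>C f w)) z"
    using assms by (intro functional_vec_coeff_at [OF L] vec_holomorphic_scaleC)
  also have "\<dots> = (\<Sum>i\<le>k. coeff_at i a z * coeff_at (k - i) (\<lambda>w. L (f w)) z)"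
    unfolding functional_scaleC [OF L] using assms functional_holomorphic [OF L]
    by (intro coeff_at_mult)
  also have "\<dots> = L (\<Sum>i\<le>k. coeff_at i a z *\<^sub>C vec_coeff_at (k - i) f z)"
    using assms by (simp add: functional_sum [OF L] functional_scaleC [OF L] functional_vec_coeff_at [OF L])
  finally show "L (vec_coeff_at k (\<lambda>w. a w *\<^sub>C f w) z) = \<dots>" .
qed

lemma vec_coeff_at_add:
  assumes "open U" "f vec_holomorphic_on U" "g vec_holomorphic_on U" "z \<in> U"
  shows "vec_coeff_at k (\<lambda>w. f w + g w) z = vec_coeff_at k f z + vec_coeff_at k g z"
proof (rule functionals_separate)
  fix L :: "'a \<Rightarrow> complex" assume L: "contractive_functional L"
  have "L (vec_coeff_at k (\<lambda>w. f w + g w) z) = coeff_at k (\<lambda>w. L (f w + g w)) z"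
    using assms by (intro functional_vec_coeff_at [OF L] vec_holomorphic_add)
  also have "\<dots> = coeff_at k (\<lambda>w. L (f w)) z + coeff_at k (\<lambda>w. L (g w)) z"
    unfolding functional_add [OF L] coeff_at_def
    using higher_deriv_add [OF functional_holomorphic [OF L assms(2)] functional_holomorphic [OF L assms(3)]] assms
    by (simp add: add_divide_distrib)
  also have "\<dots> = L (vec_coeff_at k f z + vec_coeff_at k g z)"
    using assms by (simp add: functional_add [OF L] functional_vec_coeff_at [OF L])
  finally show "L (vec_coeff_at k (\<lambda>w. f w + g w) z) = \<dots>" .
qed

lemma coeff_at_const: "coeff_at k (\<lambda>w. c) z = (if k = 0 then c else 0)"
  by (simp add: coeff_at_def)

lemma vec_coeff_at_const_scaleC:
  assumes "open U" "f vec_holomorphic_on U" "z \<in> U"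
  shows "vec_coeff_at k (\<lambda>w. c *\<^sub>C f w) z = c *\<^sub>C vec_coeff_at k f z"
proof -
  have "vec_coeff_at k (\<lambda>w. c *\<^sub>C f w) z = (\<Sum>i\<le>k. coeff_at i (\<lambda>w. c) z *\<^sub>C vec_coeff_at (k - i) f z)"
    using assms by (intro vec_coeff_at_scaleC) auto
  also have "\<dots> = (\<Sum>i\<in>{0}. coeff_at i (\<lambda>w. c) z *\<^sub>C vec_coeff_at (k - i) f z)"
    by (rule sum.mono_neutral_right) (auto simp: coeff_at_const)
  finally show ?thesis by simp
qed

lemma vec_coeff_at_zero [simp]: "vec_coeff_at k (\<lambda>w. 0) z = 0"
  using vec_coeff_at_const_scaleC [OF open_UNIV vec_holomorphic_zero UNIV_I, of k 0 z] by simp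

lemma vec_coeff_at_diff:
  assumes "open U" "f vec_holomorphic_on U" "g vec_holomorphic_on U" "z \<in> U"
  shows "vec_coeff_at k (\<lambda>w. f w - g w) z = vec_coeff_at k f z - vec_coeff_at k g z"
  using vec_coeff_at_add [OF assms(1,2) vec_holomorphic_const_scaleC [OF assms(3)] assms(4), of k "- 1"]
    vec_coeff_at_const_scaleC [OF assms(1,3,4), of k "- 1"]
  by (simp add: scaleC_minus1)

lemma vec_coeff_at_sum:
  assumes "open U" "\<And>i. i \<in> I \<Longrightarrow> f i vec_holomorphic_on U" "z \<in> U"
  shows "vec_coeff_at k (\<lambda>w. \<Sum>i\<in>I. f i w) z = (\<Sum>i\<in>I. vec_coeff_at k (f i) z)"
  using assms(2)
proof (induction I rule: infinite_finite_induct)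
  case (insert i I)
  then show ?case
    using vec_coeff_at_add [OF assms(1) _ vec_holomorphic_sum assms(3), of "f i" I f] by simp
qed simp_all

lemma vec_holomorphic_vec_coeff_at:
  assumes "open U" "f vec_holomorphic_on U"
  shows "vec_coeff_at k f vec_holomorphic_on U"
proof -
  have "(\<lambda>z. of_real (1 / fact k) *\<^sub>C (complex_deriv ^^ k) f z) vec_holomorphic_on U"
    using assms by (intro vec_holomorphic_const_scaleC vec_holomorphic_higher_deriv)
  then show ?thesis
    unfolding vec_coeff_at_def scaleR_scaleC .
qed

lemma vec_coeff_at_bound:
  assumes "open U" "f vec_holomorphic_on U" "0 < r" "cball z r \<subseteq> U"
    and B: "\<And>w. w \<in> cball z r \<Longrightarrow> norm (f w) \<le> B"
  shows "norm (vec_coeff_at k f z) \<le> B / r ^ k"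
proof -
  obtain L where L: "contractive_functional L"
      "cmod (L (vec_coeff_at k f z)) = norm (vec_coeff_at k f z)"
    by (rule norming_functional)
  have hol: "(\<lambda>w. L (f w)) holomorphic_on cball z r"
    using functional_holomorphic [OF L(1) assms(2)] assms(4) by (rule holomorphic_on_subset)
  have "cmod ((deriv ^^ k) (\<lambda>w. L (f w)) z) \<le> fact k * B / r ^ k"
  proof (rule Cauchy_inequality)
    show "cmod (L (f w)) \<le> B" if "cmod (z - w) = r" for w
      using functional_norm_le [OF L(1), of "f w"] B [of w] that by (simp add: dist_norm)
    show "(\<lambda>w. L (f w)) holomorphic_on ball z r"
      using hol by (rule holomorphic_on_subset) auto
    show "continuous_on (cball z r) (\<lambda>w. L (f w))"
      using hol by (rule holomorphic_on_imp_continuous_on)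
  qed (use assms in auto)
  moreover have "L (vec_coeff_at k f z) = (deriv ^^ k) (\<lambda>w. L (f w)) z / fact k"
    using functional_vec_coeff_at [OF L(1) assms(1,2), of z k] assms(3,4)
    by (simp add: coeff_at_def subset_iff)
  ultimately have "cmod (L (vec_coeff_at k f z)) \<le> (fact k * B / r ^ k) / fact k"
    unfolding norm_divide norm_fact by (metis divide_right_mono fact_ge_zero norm_divide norm_fact)
  then show ?thesis
    using L(2) by simp
qed

section \<open>Holomorphic tuples\<close>

lemma entry_scaleC [simp]: "entry (c *\<^sub>C x) i = c *\<^sub>C entry x i"
  by (simp add: scaleC_tuple_def)

lemma bounded_linear_entry: "bounded_linear (\<lambda>x :: ('a::real_normed_vector, 'n::finite) tuple. entry x i)"
  by (rule bounded_linear_intro [where K = 1]) (simp_all add: norm_entry_le)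

definition single_tuple :: "'n \<Rightarrow> 'a::real_normed_vector \<Rightarrow> ('a, 'n::finite) tuple"
  where "single_tuple i x = Tuple (\<lambda>j. if j = i then x else 0)"

lemma entry_single_tuple: "entry (single_tuple i x) j = (if j = i then x else 0)"
  by (simp add: single_tuple_def)

lemma entry_sum: "entry (\<Sum>i\<in>I. x i) j = (\<Sum>i\<in>I. entry (x i) j)"
  by (induction I rule: infinite_finite_induct) simp_all

lemma tuple_eq_sum_single: "x = (\<Sum>i\<in>UNIV. single_tuple i (entry x i))"
  by (simp add: tuple_eq_iff entry_sum entry_single_tuple)

lemma bounded_linear_single_tuple: "bounded_linear (single_tuple i)"
  by (rule bounded_linear_intro [where K = 1])
    (auto simp: tuple_eq_iff entry_single_tuple norm_tuple_def if_distrib [of norm] cong: if_cong)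

text \<open>For the converse, a tuple is the sum of its entries under the coordinate embeddings, and
  these are bounded linear.\<close>

lemma vec_holomorphic_tuple_iff:
  fixes G :: "complex \<Rightarrow> ('a::complex_banach, 'n::finite) tuple"
  shows "G vec_holomorphic_on U \<longleftrightarrow> (\<forall>i. (\<lambda>z. entry (G z) i) vec_holomorphic_on U)"
proof safe
  fix i assume G: "G vec_holomorphic_on U"
  have "has_complex_deriv (\<lambda>z. entry (G z) i) (entry (complex_deriv G z) i) z" if "z \<in> U" for z
    using bounded_linear.has_derivative [OF bounded_linear_entry [of i]
        vec_holomorphic_deriv [OF G that, unfolded has_complex_deriv_def]]
    by (simp add: has_complex_deriv_def)
  then show "(\<lambda>z. entry (G z) i) vec_holomorphic_on U"
    unfolding vec_holomorphic_on_def by blast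
next
  assume *: "\<forall>i. (\<lambda>z. entry (G z) i) vec_holomorphic_on U"
  show "G vec_holomorphic_on U"
    unfolding vec_holomorphic_on_def
  proof
    fix z assume "z \<in> U"
    define d where "d i = complex_deriv (\<lambda>z. entry (G z) i) z" for i
    have d: "has_complex_deriv (\<lambda>z. entry (G z) i) (d i) z" for i
      unfolding d_def using * \<open>z \<in> U\<close> by (intro vec_holomorphic_deriv [where U = U]) auto
    have "((\<lambda>z. \<Sum>i\<in>UNIV. single_tuple i (entry (G z) i)) has_derivative
        (\<lambda>h. \<Sum>i\<in>UNIV. single_tuple i (h *\<^sub>C d i))) (at z)"
      using d unfolding has_complex_deriv_def
      by (intro has_derivative_sum bounded_linear.has_derivative [OF bounded_linear_single_tuple])
    moreover have "(\<lambda>h. \<Sum>i\<in>UNIV. single_tuple i (h *\<^sub>C d i)) = (\<lambda>h. h *\<^sub>C Tuple d)"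
      by (simp add: fun_eq_iff tuple_eq_iff entry_sum entry_single_tuple)
    ultimately have "has_complex_deriv G (Tuple d) z"
      unfolding has_complex_deriv_def by (simp flip: tuple_eq_sum_single)
    then show "\<exists>d. has_complex_deriv G d z" ..
  qed
qed

lemma analytic_funs_tuple_iff:
  fixes G :: "complex \<Rightarrow> ('a::complex_banach, 'n::finite) tuple"
  shows "G \<in> analytic_funs U \<longleftrightarrow> (\<forall>i. (\<lambda>z. entry (G z) i) \<in> analytic_funs U)"
  unfolding analytic_funs_iff vec_holomorphic_tuple_iff [of G] by (auto simp: tuple_eq_iff)

lemma holomorphic_on_DERIV:
  assumes "\<And>z. z \<in> U \<Longrightarrow> (f has_field_derivative f' z) (at z)"
  shows "f holomorphic_on U"
  unfolding holomorphic_on_def field_differentiable_def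
  using assms has_field_derivative_at_within by blast

section \<open>Jets of shifted functions\<close>

text \<open>Order of vanishing at least \<open>r\<close>. For \<open>r = 0\<close> this is no
  condition, so a factor about which nothing is known can enter the product rule for orders.\<close>

definition vanishes_to :: "nat \<Rightarrow> (complex \<Rightarrow> complex) \<Rightarrow> complex \<Rightarrow> bool"
  where "vanishes_to r h u \<longleftrightarrow> (\<forall>m<r. coeff_at m h u = 0)"

text \<open>In each term of the Cauchy product at least one of the two indices lies below the order
  of vanishing of its factor.\<close>

lemma vanishes_to_mult:
  assumes "a holomorphic_on U" "b holomorphic_on U" "open U" "u \<in> U"
    and "vanishes_to r a u" "vanishes_to s b u"
  shows "vanishes_to (r + s) (\<lambda>z. a z * b z) u"
  unfolding vanishes_to_def
proof safe
  fix m assume "m < r + s"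
  then have "coeff_at i a u * coeff_at (m - i) b u = 0" if "i \<le> m" for i
    using assms(5,6) that unfolding vanishes_to_def by (cases "i < r") auto
  then show "coeff_at m (\<lambda>z. a z * b z) u = 0"
    unfolding coeff_at_mult [OF assms(1-4)] by (intro sum.neutral) blast
qed

lemma vec_coeff_at_vanishes:
  assumes "a holomorphic_on U" "open U" "f vec_holomorphic_on U" "u \<in> U" "vanishes_to r a u" "k < r"
  shows "vec_coeff_at k (\<lambda>z. a z *\<^sub>C f z) u = 0"
  using assms(5,6) by (simp add: vec_coeff_at_scaleC [OF assms(1-4)] vanishes_to_def)

locale local_coordinate =
  fixes U :: "complex set" and \<psi> :: "complex \<Rightarrow> complex"
  assumes open_U: "open U" and holomorphic_\<psi>: "\<psi> holomorphic_on U"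
    and deriv_\<psi>_nonzero: "z \<in> U \<Longrightarrow> deriv \<psi> z \<noteq> 0"
begin

text \<open>The point \<open>u\<close> plays two roles, as the centre of expansion and as the base
  point of the power, so holomorphy in \<open>u\<close> is not immediate.\<close>

definition shifted_coeff :: "nat \<Rightarrow> nat \<Rightarrow> (complex \<Rightarrow> 'a::complex_banach) \<Rightarrow> complex \<Rightarrow> 'a"
  where "shifted_coeff k j f u = vec_coeff_at k (\<lambda>z. (\<psi> z - \<psi> u) ^ j *\<^sub>C f z) u"

lemma holomorphic_shift: "(\<lambda>z. (\<psi> z - c) ^ j) holomorphic_on U"
  by (intro holomorphic_intros holomorphic_\<psi>)

lemma vanishes_to_shift:
  assumes "u \<in> U"
  shows "vanishes_to j (\<lambda>z. (\<psi> z - \<psi> u) ^ j) u"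
proof (induction j)
  case 0
  show ?case by (simp add: vanishes_to_def)
next
  case (Suc j)
  have "vanishes_to 1 (\<lambda>z. \<psi> z - \<psi> u) u"
    by (simp add: vanishes_to_def)
  then have "vanishes_to (1 + j) (\<lambda>z. (\<psi> z - \<psi> u) * (\<psi> z - \<psi> u) ^ j) u"
    using Suc assms open_U holomorphic_shift [of "\<psi> u" 1]
    by (intro vanishes_to_mult [where U = U] holomorphic_shift) simp_all
  then show ?case by simp
qed

text \<open>Splitting off one factor, only the term of index \<open>1\<close> survives in the Cauchy
  product: the split factor vanishes at \<open>u\<close>, and from index \<open>2\<close> on the
  remaining power is taken at an order below its order of vanishing.\<close>

lemma coeff_at_shift:
  assumes u: "u \<in> U"
  shows "coeff_at j (\<lambda>z. (\<psi> z - \<psi> u) ^ j) u = deriv \<psi> u ^ j"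
proof (induction j)
  case (Suc j)
  have [simp]: "coeff_at (Suc 0) (\<lambda>z. \<psi> z - \<psi> u) u = deriv \<psi> u"
    unfolding coeff_at_def
    using holomorphic_\<psi> open_U u by (simp add: holomorphic_on_imp_differentiable_at)
  have "coeff_at (Suc j) (\<lambda>z. (\<psi> z - \<psi> u) * (\<psi> z - \<psi> u) ^ j) u
    = (\<Sum>i\<le>Suc j. coeff_at i (\<lambda>z. \<psi> z - \<psi> u) u * coeff_at (Suc j - i) (\<lambda>z. (\<psi> z - \<psi> u) ^ j) u)"
    using holomorphic_shift [of "\<psi> u" 1] by (intro coeff_at_mult [where U = U] holomorphic_shift open_U u) simp
  also have "\<dots> = (\<Sum>i\<in>{1}. coeff_at i (\<lambda>z. \<psi> z - \<psi> u) u * coeff_at (Suc j - i) (\<lambda>z. (\<psi> z - \<psi> u) ^ j) u)"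
  proof (rule sum.mono_neutral_right)
    show "\<forall>i\<in>{..Suc j} - {1}. coeff_at i (\<lambda>z. \<psi> z - \<psi> u) u * coeff_at (Suc j - i) (\<lambda>z. (\<psi> z - \<psi> u) ^ j) u = 0"
    proof
      fix i assume i: "i \<in> {..Suc j} - {1}"
      show "coeff_at i (\<lambda>z. \<psi> z - \<psi> u) u * coeff_at (Suc j - i) (\<lambda>z. (\<psi> z - \<psi> u) ^ j) u = 0"
      proof (cases "i = 0")
        case False
        with i have "Suc j - i < j" by auto
        then show ?thesis
          using vanishes_to_shift [OF u, of j] unfolding vanishes_to_def by (metis mult_zero_right)
      qed simp
    qed
  qed auto
  finally show ?case
    using Suc by simp
qed simp

lemma vec_holomorphic_shift:
  "f vec_holomorphic_on U \<Longrightarrow> (\<lambda>z. (\<psi> z - c) ^ j *\<^sub>C f z) vec_holomorphic_on U"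
  by (intro vec_holomorphic_scaleC holomorphic_shift open_U)

lemma shifted_coeff_less:
  "f vec_holomorphic_on U \<Longrightarrow> u \<in> U \<Longrightarrow> k < j \<Longrightarrow> shifted_coeff k j f u = 0"
  unfolding shifted_coeff_def
  by (rule vec_coeff_at_vanishes [OF holomorphic_shift open_U _ _ vanishes_to_shift])

lemma shifted_coeff_diag:
  assumes "f vec_holomorphic_on U" "u \<in> U"
  shows "shifted_coeff j j f u = deriv \<psi> u ^ j *\<^sub>C f u"
proof -
  have "shifted_coeff j j f u =
      (\<Sum>i\<le>j. coeff_at i (\<lambda>z. (\<psi> z - \<psi> u) ^ j) u *\<^sub>C vec_coeff_at (j - i) f u)"
    unfolding shifted_coeff_def by (intro vec_coeff_at_scaleC [where U = U] holomorphic_shift open_U assms)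
  also have "\<dots> = (\<Sum>i\<in>{j}. coeff_at i (\<lambda>z. (\<psi> z - \<psi> u) ^ j) u *\<^sub>C vec_coeff_at (j - i) f u)"
    using vanishes_to_shift [OF assms(2), of j] unfolding vanishes_to_def
    by (intro sum.mono_neutral_right) auto
  finally show ?thesis
    using coeff_at_shift [OF assms(2)] by simp
qed

lemma shifted_coeff_0: "shifted_coeff k 0 f u = vec_coeff_at k f u"
  by (simp add: shifted_coeff_def)

lemma shifted_coeff_add:
  assumes "f vec_holomorphic_on U" "g vec_holomorphic_on U" "u \<in> U"
  shows "shifted_coeff k j (\<lambda>z. f z + g z) u = shifted_coeff k j f u + shifted_coeff k j g u"
  unfolding shifted_coeff_def scaleC_add_right
  by (intro vec_coeff_at_add [where U = U] vec_holomorphic_shift open_U assms)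

lemma shifted_coeff_const_scaleC:
  assumes "f vec_holomorphic_on U" "u \<in> U"
  shows "shifted_coeff k j (\<lambda>z. c *\<^sub>C f z) u = c *\<^sub>C shifted_coeff k j f u"
proof -
  have "shifted_coeff k j (\<lambda>z. c *\<^sub>C f z) u
    = vec_coeff_at k (\<lambda>z. c *\<^sub>C (\<psi> z - \<psi> u) ^ j *\<^sub>C f z) u"
    by (simp add: shifted_coeff_def scaleC_scaleC mult.commute)
  then show ?thesis
    unfolding shifted_coeff_def
    by (simp add: vec_coeff_at_const_scaleC [OF open_U vec_holomorphic_shift assms(2)] assms(1))
qed

lemma shifted_coeff_zero [simp]: "shifted_coeff k j (\<lambda>z. 0) u = 0"
  by (simp add: shifted_coeff_def)

lemma shifted_coeff_sum:
  assumes "\<And>i. i \<in> I \<Longrightarrow> f i vec_holomorphic_on U" "u \<in> U"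
  shows "shifted_coeff k j (\<lambda>z. \<Sum>i\<in>I. f i z) u = (\<Sum>i\<in>I. shifted_coeff k j (f i) u)"
  unfolding shifted_coeff_def scaleC_sum_right
  by (intro vec_coeff_at_sum [where U = U] vec_holomorphic_shift open_U assms)

text \<open>The binomial expansion of the power separates the two roles of \<open>u\<close>: powers
  of \<open>\<psi> u\<close> come out as scalar factors, and what remains are Taylor coefficients of
  functions that do not depend on \<open>u\<close>.\<close>

lemma vec_holomorphic_shifted_coeff:
  assumes "f vec_holomorphic_on U"
  shows "shifted_coeff k j f vec_holomorphic_on U"
proof -
  define G where "G = (\<lambda>u. \<Sum>i\<le>j. (of_nat (j choose i) * (- \<psi> u) ^ (j - i)) *\<^sub>C
      vec_coeff_at k (\<lambda>z. \<psi> z ^ i *\<^sub>C f z) u)"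
  have power: "(\<lambda>z. \<psi> z ^ i *\<^sub>C f z) vec_holomorphic_on U" for i
    using vec_holomorphic_shift [OF assms, of 0] by simp
  have "shifted_coeff k j f u = G u" if "u \<in> U" for u
  proof -
    have "(\<psi> z - \<psi> u) ^ j *\<^sub>C f z =
      (\<Sum>i\<le>j. (of_nat (j choose i) * (- \<psi> u) ^ (j - i)) *\<^sub>C \<psi> z ^ i *\<^sub>C f z)" for z
      using binomial_ring [of "\<psi> z" "- \<psi> u" j]
      by (simp add: scaleC_sum_left scaleC_scaleC mult_ac)
    then show ?thesis
      unfolding shifted_coeff_def G_def
      by (simp add: vec_coeff_at_sum [OF open_U vec_holomorphic_const_scaleC [OF power] that]
          vec_coeff_at_const_scaleC [OF open_U power that])
  qed
  moreover have "G vec_holomorphic_on U"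
    unfolding G_def
    by (intro vec_holomorphic_sum vec_holomorphic_scaleC vec_holomorphic_vec_coeff_at power open_U
        holomorphic_intros holomorphic_\<psi>)
  ultimately show ?thesis
    using vec_holomorphic_cong [OF open_U, of "shifted_coeff k j f" G] by blast
qed

text \<open>The entry of order \<open>k\<close> of the array with coordinates \<open>g\<close>. The
  sum may stop at \<open>k\<close> because the powers of \<open>\<psi> - \<psi> u\<close> with
  larger exponent do not contribute to this coefficient.\<close>

definition array_coeff :: "nat \<Rightarrow> (nat \<Rightarrow> complex \<Rightarrow> 'a::complex_banach) \<Rightarrow> complex \<Rightarrow> 'a"
  where "array_coeff k g u = (\<Sum>j\<le>k. shifted_coeff k j (g j) u)"

lemma array_coeff_add:
  assumes "\<And>j. j \<le> k \<Longrightarrow> f j vec_holomorphic_on U" "\<And>j. j \<le> k \<Longrightarrow> g j vec_holomorphic_on U" "u \<in> U"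
  shows "array_coeff k (\<lambda>j z. f j z + g j z) u = array_coeff k f u + array_coeff k g u"
  using assms by (simp add: array_coeff_def shifted_coeff_add sum.distrib)

lemma array_coeff_const_scaleC:
  assumes "\<And>j. j \<le> k \<Longrightarrow> f j vec_holomorphic_on U" "u \<in> U"
  shows "array_coeff k (\<lambda>j z. c *\<^sub>C f j z) u = c *\<^sub>C array_coeff k f u"
  using assms by (simp add: array_coeff_def shifted_coeff_const_scaleC scaleC_sum_right)

lemma vec_holomorphic_array_coeff:
  "(\<And>j. j \<le> k \<Longrightarrow> g j vec_holomorphic_on U) \<Longrightarrow> array_coeff k g vec_holomorphic_on U"
  unfolding array_coeff_def [abs_def] by (intro vec_holomorphic_sum vec_holomorphic_shifted_coeff) auto

lemma array_coeff_split:
  assumes "g k vec_holomorphic_on U" "u \<in> U"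
  shows "array_coeff k g u = (\<Sum>j<k. shifted_coeff k j (g j) u) + deriv \<psi> u ^ k *\<^sub>C g k u"
  using assms by (simp add: array_coeff_def shifted_coeff_diag flip: lessThan_Suc_atMost)

text \<open>Forward substitution: the equation of index \<open>n\<close> contains the coordinate
  \<open>g n\<close> only through its diagonal term, and the equations of smaller index do not
  contain it at all.\<close>

lemma array_coeff_surj:
  assumes "\<And>k. k < n \<Longrightarrow> G k vec_holomorphic_on U"
  shows "\<exists>g. (\<forall>k. g k \<in> analytic_funs U) \<and>
    (\<forall>k<n. \<forall>u\<in>U. array_coeff k g u = G k u)"
  using assms
proof (induction n)
  case 0
  show ?case
    by (rule exI [where x = "\<lambda>k z. 0"]) (simp add: analytic_funs_iff)
next
  case (Suc n)
  then obtain g where g: "\<And>k. g k \<in> analytic_funs U"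
      "\<And>k u. k < n \<Longrightarrow> u \<in> U \<Longrightarrow> array_coeff k g u = G k u"
    by force
  \<comment> \<open>On \<open>U\<close> this is forced by the equation of index \<open>n\<close>.
    Outside \<open>U\<close> the quotient is meaningless, so it is cut off there.\<close>
  define h where "h = (\<lambda>u. inverse (deriv \<psi> u ^ n) *\<^sub>C (G n u - (\<Sum>j<n. shifted_coeff n j (g j) u)))"
  have "h vec_holomorphic_on U"
    unfolding h_def using g(1)
    by (intro vec_holomorphic_scaleC vec_holomorphic_diff vec_holomorphic_sum
        vec_holomorphic_shifted_coeff Suc.prems holomorphic_intros holomorphic_\<psi> open_U)
      (auto simp: deriv_\<psi>_nonzero analytic_funs_iff)
  then have h: "zero_ext U h \<in> analytic_funs U"
    using vec_holomorphic_cong [OF open_U, of h "zero_ext U h"]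
    by (simp add: analytic_funs_iff zero_ext_def)
  define g' where "g' = g(n := zero_ext U h)"
  have "array_coeff k g' u = G k u" if "k < Suc n" "u \<in> U" for k u
  proof (cases "k = n")
    case True
    have "array_coeff n g' u = (\<Sum>j<n. shifted_coeff n j (g j) u) + deriv \<psi> u ^ n *\<^sub>C h u"
      using h that array_coeff_split [of g' n u] by (simp add: g'_def analytic_funs_iff zero_ext_def)
    then show ?thesis
      using that True deriv_\<psi>_nonzero [of u] by (simp add: h_def scaleC_scaleC)
  next
    case False
    then have "array_coeff k g' u = array_coeff k g u"
      using that by (simp add: array_coeff_def g'_def)
    then show ?thesis
      using that False g by simp
  qed
  moreover have "\<forall>k. g' k \<in> analytic_funs U"
    using g h by (simp add: g'_def)
  ultimately show ?case
    by blast
qed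

lemma array_coeff_inj:
  assumes "\<And>k. k < n \<Longrightarrow> g k \<in> analytic_funs U"
    and "\<And>k u. k < n \<Longrightarrow> u \<in> U \<Longrightarrow> array_coeff k g u = 0"
  shows "k < n \<Longrightarrow> g k = (\<lambda>z. 0)"
proof (induction k rule: less_induct)
  case (less k)
  have "g k u = 0" for u
  proof (cases "u \<in> U")
    case True
    have "0 = (\<Sum>j<k. shifted_coeff k j (g j) u) + deriv \<psi> u ^ k *\<^sub>C g k u"
      using assms less.prems True array_coeff_split [of g k u] by (simp add: analytic_funs_iff)
    also have "(\<Sum>j<k. shifted_coeff k j (g j) u) = 0"
      using less by (intro sum.neutral) auto
    finally show ?thesis
      using deriv_\<psi>_nonzero [OF True] scaleC_cancel_left [of "deriv \<psi> u ^ k" "g k u" 0] by simp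
  next
    case False
    then show ?thesis
      using assms(1) [OF less.prems] by (simp add: analytic_funs_iff)
  qed
  then show ?case by blast
qed

text \<open>
  If \<open>a = b \<circ> \<psi>\<close> and \<open>A i = (b\<^sup>(\<^sup>i\<^sup>) \<circ> \<psi>) / i!\<close>, then \<open>a u\<close> is given by the Taylor expansion of \<open>b\<close> about
  \<open>\<psi> z\<close> in powers of \<open>\<psi> u - \<psi> z\<close>; the assumption on \<open>A\<close> below expresses this without mentioning \<open>b\<close>.
\<close>

lemma expansion_remainder_vanishes:
  assumes A: "\<And>i z. z \<in> U \<Longrightarrow> (A i has_field_derivative of_nat (Suc i) * deriv \<psi> z * A (Suc i) z) (at z)"
    and u: "u \<in> U"
  shows "vanishes_to (Suc r) (\<lambda>z. A 0 u - (\<Sum>i\<le>r. (- 1) ^ i * A i z * (\<psi> z - \<psi> u) ^ i)) u"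
proof -
  define R where "R r z = A 0 u - (\<Sum>i\<le>r. (- 1) ^ i * A i z * (\<psi> z - \<psi> u) ^ i)" for r z
  \<comment> \<open>Differentiating \<open>R r\<close> in \<open>z\<close> with \<open>u\<close>
    fixed gives a telescoping sum, of which only \<open>B r z * (\<psi> z - \<psi> u) ^ r\<close> is
    left.\<close>
  define B where "B r z = (- 1) ^ Suc r * of_nat (Suc r) * deriv \<psi> z * A (Suc r) z" for r z
  have der\<psi>: "(\<psi> has_field_derivative deriv \<psi> z) (at z)" if "z \<in> U" for z
    using holomorphic_\<psi> open_U that by (rule holomorphic_derivI)
  have R: "(R r has_field_derivative B r z * (\<psi> z - \<psi> u) ^ r) (at z)" if z: "z \<in> U" for r z
  proof (induction r)
    case 0
    show ?case
      unfolding R_def B_def using z by (auto intro!: derivative_eq_intros A)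
  next
    case (Suc r)
    have eq: "R (Suc r) = (\<lambda>z. R r z - (- 1) ^ Suc r * A (Suc r) z * (\<psi> z - \<psi> u) ^ Suc r)"
      by (simp add: R_def fun_eq_iff)
    have "((\<lambda>z. (- 1) ^ Suc r * A (Suc r) z * (\<psi> z - \<psi> u) ^ Suc r) has_field_derivative
        (- 1) ^ Suc r * (of_nat (Suc (Suc r)) * deriv \<psi> z * A (Suc (Suc r)) z) * (\<psi> z - \<psi> u) ^ Suc r
        + (- 1) ^ Suc r * A (Suc r) z * (of_nat (Suc r) * (\<psi> z - \<psi> u) ^ r * deriv \<psi> z)) (at z)"
      using der\<psi> [OF z] A [OF z, of "Suc r"]
      by (auto intro!: derivative_eq_intros simp del: of_nat_Suc power_Suc simp: algebra_simps)
    from DERIV_diff [OF Suc this] show ?case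
      unfolding eq by (rule DERIV_cong) (simp add: B_def algebra_simps)
  qed
  have holA: "A i holomorphic_on U" for i
    using A by (rule holomorphic_on_DERIV)
  have holR: "R r holomorphic_on U"
    using R by (rule holomorphic_on_DERIV)
  have holB: "B r holomorphic_on U"
    unfolding B_def by (intro holomorphic_intros holA holomorphic_deriv holomorphic_\<psi> open_U)
  have "vanishes_to (0 + r) (\<lambda>z. B r z * (\<psi> z - \<psi> u) ^ r) u"
    by (intro vanishes_to_mult [OF holB holomorphic_shift open_U u] vanishes_to_shift u)
      (simp add: vanishes_to_def)
  then have van: "(deriv ^^ m) (\<lambda>z. B r z * (\<psi> z - \<psi> u) ^ r) u = 0" if "m < r" for m
    using that by (simp add: vanishes_to_def coeff_at_def)
  have "coeff_at m (R r) u = 0" if "m < Suc r" for m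
  proof (cases m)
    case 0
    have "(\<Sum>i\<le>r. (- 1) ^ i * A i u * (\<psi> u - \<psi> u) ^ i) = (\<Sum>i\<in>{0}. (- 1) ^ i * A i u * (\<psi> u - \<psi> u) ^ i)"
      by (rule sum.mono_neutral_right) auto
    then show ?thesis
      using 0 by (simp add: R_def)
  next
    \<comment> \<open>The derivative of \<open>R r\<close> vanishes to order \<open>r\<close>
      because of the power in it; as \<open>R r\<close> itself is zero at \<open>u\<close>, its
      order is one higher.\<close>
    case (Suc m')
    have "(deriv ^^ m) (R r) u = (deriv ^^ m') (deriv (R r)) u"
      by (simp only: Suc funpow_Suc_right o_apply)
    also have "\<dots> = (deriv ^^ m') (\<lambda>z. B r z * (\<psi> z - \<psi> u) ^ r) u"
      using R DERIV_imp_deriv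
      by (intro higher_deriv_transform_within_open [OF _ _ open_U u] holomorphic_deriv holR open_U
          holomorphic_on_mult holB holomorphic_shift) blast
    finally show ?thesis
      using van [of m'] that Suc by (simp add: coeff_at_def)
  qed
  then show ?thesis
    unfolding vanishes_to_def R_def by blast
qed

text \<open>The number \<open>A 0 u\<close> is replaced by its expansion in \<open>z\<close> up to
  the exponent \<open>k - j\<close>. The error vanishes to order \<open>k - j + 1\<close>, hence
  after multiplication by \<open>(\<psi> - \<psi> u)^j\<close> to order \<open>k + 1\<close>, and
  the coefficient of order \<open>k\<close> does not see it.\<close>

lemma scaleC_shifted_coeff:
  assumes A: "\<And>i z. z \<in> U \<Longrightarrow> (A i has_field_derivative of_nat (Suc i) * deriv \<psi> z * A (Suc i) z) (at z)"
    and u: "u \<in> U" and f: "f vec_holomorphic_on U" and "j \<le> k"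
  shows "A 0 u *\<^sub>C shifted_coeff k j f u =
    (\<Sum>i\<le>k - j. shifted_coeff k (i + j) (\<lambda>z. (- 1) ^ i *\<^sub>C A i z *\<^sub>C f z) u)"
proof -
  define r where "r = k - j"
  define R where "R z = A 0 u - (\<Sum>i\<le>r. (- 1) ^ i * A i z * (\<psi> z - \<psi> u) ^ i)" for z
  have holA: "A i holomorphic_on U" for i
    using A by (rule holomorphic_on_DERIV)
  have holR: "R holomorphic_on U"
    unfolding R_def by (intro holomorphic_intros holA holomorphic_\<psi>)
  have Af: "(\<lambda>z. (- 1) ^ i *\<^sub>C A i z *\<^sub>C f z) vec_holomorphic_on U" for i
    by (intro vec_holomorphic_const_scaleC vec_holomorphic_scaleC holA open_U f)
  have "vanishes_to (Suc r + j) (\<lambda>z. R z * (\<psi> z - \<psi> u) ^ j) u"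
    unfolding R_def
    by (intro vanishes_to_mult [OF holR [unfolded R_def] holomorphic_shift open_U u]
        expansion_remainder_vanishes A vanishes_to_shift u)
  then have "vec_coeff_at k (\<lambda>z. (R z * (\<psi> z - \<psi> u) ^ j) *\<^sub>C f z) u = 0"
    by (rule vec_coeff_at_vanishes [OF holomorphic_on_mult [OF holR holomorphic_shift] open_U f u])
      (use \<open>j \<le> k\<close> in \<open>simp add: r_def\<close>)
  moreover have "(R z * (\<psi> z - \<psi> u) ^ j) *\<^sub>C f z = A 0 u *\<^sub>C (\<psi> z - \<psi> u) ^ j *\<^sub>C f z
      - (\<Sum>i\<le>r. (\<psi> z - \<psi> u) ^ (i + j) *\<^sub>C (- 1) ^ i *\<^sub>C A i z *\<^sub>C f z)" for z
    by (simp add: R_def scaleC_diff_left scaleC_scaleC left_diff_distrib right_diff_distrib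
        sum_distrib_left sum_distrib_right
        scaleC_sum_left power_add mult_ac)
  ultimately have "A 0 u *\<^sub>C vec_coeff_at k (\<lambda>z. (\<psi> z - \<psi> u) ^ j *\<^sub>C f z) u
      - (\<Sum>i\<le>r. vec_coeff_at k (\<lambda>z. (\<psi> z - \<psi> u) ^ (i + j) *\<^sub>C (- 1) ^ i *\<^sub>C A i z *\<^sub>C f z) u) = 0"
    by (simp add: vec_coeff_at_diff [OF open_U _ _ u] vec_coeff_at_sum [OF open_U _ u]
        vec_coeff_at_const_scaleC [OF open_U _ u] vec_holomorphic_sum vec_holomorphic_shift
        vec_holomorphic_const_scaleC Af f)
  then show ?thesis
    by (simp add: shifted_coeff_def r_def)
qed

text \<open>The term \<open>i\<close> in the expansion for the coordinate \<open>j\<close> carries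
  the power \<open>i + j\<close>; collecting equal powers \<open>l = i + j\<close> over the triangle
  \<open>i + j \<le> k\<close> gives the new coordinates.\<close>

lemma scaleC_array_coeff:
  assumes A: "\<And>i z. z \<in> U \<Longrightarrow> (A i has_field_derivative of_nat (Suc i) * deriv \<psi> z * A (Suc i) z) (at z)"
    and u: "u \<in> U" and g: "\<And>j. j \<le> k \<Longrightarrow> g j vec_holomorphic_on U"
  shows "A 0 u *\<^sub>C array_coeff k g u =
    array_coeff k (\<lambda>l z. \<Sum>i\<le>l. (- 1) ^ i *\<^sub>C A i z *\<^sub>C g (l - i) z) u"
proof -
  have holA: "A i holomorphic_on U" for i
    using A by (rule holomorphic_on_DERIV)
  have Ag: "(\<lambda>z. (- 1) ^ i *\<^sub>C A i z *\<^sub>C g j z) vec_holomorphic_on U" if "j \<le> k" for i j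
    by (intro vec_holomorphic_const_scaleC vec_holomorphic_scaleC holA open_U g that)
  define X where "X i j = shifted_coeff k (i + j) (\<lambda>z. (- 1) ^ i *\<^sub>C A i z *\<^sub>C g j z) u" for i j
  have "A 0 u *\<^sub>C array_coeff k g u = (\<Sum>j\<le>k. \<Sum>i\<le>k - j. X i j)"
    unfolding array_coeff_def scaleC_sum_right X_def
    by (intro sum.cong scaleC_shifted_coeff A u g) auto
  also have "\<dots> = (\<Sum>(j, i)\<in>{(j, i). j + i \<le> k}. X i j)"
    unfolding pairs_le_eq_Sigma by (simp add: sum.Sigma)
  also have "\<dots> = (\<Sum>l\<le>k. \<Sum>j\<le>l. X (l - j) j)"
    by (rule sum.triangle_reindex_eq)
  also have "\<dots> = (\<Sum>l\<le>k. \<Sum>i\<le>l. X i (l - i))"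
  proof (rule sum.cong [OF refl])
    fix l
    show "(\<Sum>j\<le>l. X (l - j) j) = (\<Sum>i\<le>l. X i (l - i))"
      by (rule sum.reindex_bij_witness [where i = "\<lambda>i. l - i" and j = "\<lambda>i. l - i"]) auto
  qed
  also have "\<dots> = array_coeff k (\<lambda>l z. \<Sum>i\<le>l. (- 1) ^ i *\<^sub>C A i z *\<^sub>C g (l - i) z) u"
    unfolding array_coeff_def X_def
    by (intro sum.cong refl, subst shifted_coeff_sum [OF Ag u]) auto
  finally show ?thesis .
qed

end

section \<open>Continuous operators on \<open>A\<^sup>\<infinity>\<close>\<close>

lemma taylor_coeff_zero_ext:
  assumes "f holomorphic_on unit_disc"
  shows "taylor_coeff (zero_ext unit_disc f) j = taylor_coeff f j"
proof -
  have "zero_ext unit_disc f holomorphic_on unit_disc"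
    using assms by (rule holomorphic_transform) (simp add: zero_ext_def)
  then show ?thesis
    unfolding taylor_coeff_def
    using higher_deriv_transform_within_open [of "zero_ext unit_disc f" unit_disc f 0 j] assms
    by (simp add: zero_ext_def)
qed

lemma taylor_coeff_add:
  assumes "f holomorphic_on unit_disc" "g holomorphic_on unit_disc"
  shows "taylor_coeff (\<lambda>z. f z + g z) j = taylor_coeff f j + taylor_coeff g j"
  unfolding taylor_coeff_def using higher_deriv_add [OF assms, of 0 j] by (simp add: add_divide_distrib)

lemma taylor_coeff_cmult:
  assumes "f holomorphic_on unit_disc"
  shows "taylor_coeff (\<lambda>z. c * f z) j = c * taylor_coeff f j"
  unfolding taylor_coeff_def using higher_deriv_cmult [OF assms, of 0 j c] by simp

lemma AinfI:
  assumes "f holomorphic_on unit_disc" "\<And>z. z \<notin> unit_disc \<Longrightarrow> f z = 0"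
    and "\<And>\<alpha> j. \<alpha> > 0 \<Longrightarrow> cmod (taylor_coeff f j) * (real j + 1) powr \<alpha> \<le> K \<alpha>"
  shows "f \<in> Ainf"
  unfolding Ainf_def using assms by (auto intro!: bdd_aboveI2)

lemma Ainf_holomorphic: "f \<in> Ainf \<Longrightarrow> f holomorphic_on unit_disc"
  and Ainf_outside: "f \<in> Ainf \<Longrightarrow> z \<notin> unit_disc \<Longrightarrow> f z = 0"
  by (simp_all add: Ainf_def)

lemma taylor_coeff_le_Ainf_norm:
  assumes "f \<in> Ainf" "\<alpha> > 0"
  shows "cmod (taylor_coeff f j) * (real j + 1) powr \<alpha> \<le> Ainf_norm \<alpha> f"
  unfolding Ainf_norm_def using assms by (intro cSUP_upper) (auto simp: Ainf_def)

lemma Ainf_norm_le: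
  "(\<And>j. cmod (taylor_coeff f j) * (real j + 1) powr \<alpha> \<le> K) \<Longrightarrow> Ainf_norm \<alpha> f \<le> K"
  unfolding Ainf_norm_def by (rule cSUP_least) auto

lemma Ainf_norm_nonneg: "f \<in> Ainf \<Longrightarrow> \<alpha> > 0 \<Longrightarrow> 0 \<le> Ainf_norm \<alpha> f"
  using taylor_coeff_le_Ainf_norm [of f \<alpha> 0] by (rule order_trans [rotated]) simp_all

lemma Ainf_add_bound:
  assumes "f \<in> Ainf" "g \<in> Ainf" "\<alpha> > 0"
  shows "cmod (taylor_coeff (\<lambda>z. f z + g z) j) * (real j + 1) powr \<alpha> \<le> Ainf_norm \<alpha> f + Ainf_norm \<alpha> g"
proof -
  have "cmod (taylor_coeff f j + taylor_coeff g j) * (real j + 1) powr \<alpha>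
    \<le> cmod (taylor_coeff f j) * (real j + 1) powr \<alpha> + cmod (taylor_coeff g j) * (real j + 1) powr \<alpha>"
    unfolding distrib_right [symmetric] by (intro mult_right_mono norm_triangle_ineq) simp
  then show ?thesis
    using taylor_coeff_le_Ainf_norm [OF assms(1,3), of j] taylor_coeff_le_Ainf_norm [OF assms(2,3), of j]
    by (simp add: taylor_coeff_add Ainf_holomorphic assms)
qed

lemma Ainf_add: "f \<in> Ainf \<Longrightarrow> g \<in> Ainf \<Longrightarrow> (\<lambda>z. f z + g z) \<in> Ainf"
  by (rule AinfI [where K = "\<lambda>\<alpha>. Ainf_norm \<alpha> f + Ainf_norm \<alpha> g"])
    (simp_all add: holomorphic_on_add Ainf_holomorphic Ainf_outside Ainf_add_bound)

lemma Ainf_norm_add_le: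
  "f \<in> Ainf \<Longrightarrow> g \<in> Ainf \<Longrightarrow> \<alpha> > 0 \<Longrightarrow> Ainf_norm \<alpha> (\<lambda>z. f z + g z) \<le> Ainf_norm \<alpha> f + Ainf_norm \<alpha> g"
  by (intro Ainf_norm_le Ainf_add_bound)

lemma Ainf_cmult_bound:
  assumes "f \<in> Ainf" "\<alpha> > 0"
  shows "cmod (taylor_coeff (\<lambda>z. c * f z) j) * (real j + 1) powr \<alpha> \<le> cmod c * Ainf_norm \<alpha> f"
  using mult_left_mono [OF taylor_coeff_le_Ainf_norm [OF assms, of j], of "cmod c"]
  by (simp add: taylor_coeff_cmult Ainf_holomorphic assms norm_mult mult.assoc)

lemma Ainf_cmult: "f \<in> Ainf \<Longrightarrow> (\<lambda>z. c * f z) \<in> Ainf"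
  by (rule AinfI [where K = "\<lambda>\<alpha>. cmod c * Ainf_norm \<alpha> f"])
    (simp_all add: holomorphic_on_mult Ainf_holomorphic Ainf_outside Ainf_cmult_bound)

lemma Ainf_diff: "f \<in> Ainf \<Longrightarrow> g \<in> Ainf \<Longrightarrow> (\<lambda>z. f z - g z) \<in> Ainf"
  using Ainf_add [OF _ Ainf_cmult [of g "- 1"], of f] by simp

text \<open>Continuity of an additive map between Frechet spaces, in terms of norms: every norm of
  the image is dominated by some norm of the argument, possibly of higher order. Additivity is
  stated for differences because continuity at a point compares the images of two functions.\<close>

definition Ainf_operator :: "((complex \<Rightarrow> complex) \<Rightarrow> complex \<Rightarrow> complex) \<Rightarrow> bool"
  where "Ainf_operator \<Lambda> \<longleftrightarrow> (\<forall>f\<in>Ainf. \<Lambda> f \<in> Ainf) \<and>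
    (\<forall>f\<in>Ainf. \<forall>g\<in>Ainf. \<Lambda> (\<lambda>z. f z - g z) = (\<lambda>z. \<Lambda> f z - \<Lambda> g z)) \<and>
    (\<forall>\<alpha>>0. \<exists>\<beta>>0. \<exists>C\<ge>0. \<forall>f\<in>Ainf. Ainf_norm \<alpha> (\<Lambda> f) \<le> C * Ainf_norm \<beta> f)"

lemma Ainf_operator_mem: "Ainf_operator \<Lambda> \<Longrightarrow> f \<in> Ainf \<Longrightarrow> \<Lambda> f \<in> Ainf"
  by (simp add: Ainf_operator_def)

lemma Ainf_operator_diff:
  "Ainf_operator \<Lambda> \<Longrightarrow> f \<in> Ainf \<Longrightarrow> g \<in> Ainf \<Longrightarrow> \<Lambda> (\<lambda>z. f z - g z) = (\<lambda>z. \<Lambda> f z - \<Lambda> g z)"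
  by (simp add: Ainf_operator_def)

lemma Ainf_operator_bound:
  assumes "Ainf_operator \<Lambda>" "\<alpha> > 0"
  obtains \<beta> C where "\<beta> > 0" "C \<ge> 0" "\<And>f. f \<in> Ainf \<Longrightarrow> Ainf_norm \<alpha> (\<Lambda> f) \<le> C * Ainf_norm \<beta> f"
  using assms unfolding Ainf_operator_def by metis

lemma Ainf_operatorI:
  assumes "\<And>f. f \<in> Ainf \<Longrightarrow> \<Lambda> f holomorphic_on unit_disc"
    and "\<And>f z. f \<in> Ainf \<Longrightarrow> z \<notin> unit_disc \<Longrightarrow> \<Lambda> f z = 0"
    and "\<And>f g. f \<in> Ainf \<Longrightarrow> g \<in> Ainf \<Longrightarrow> \<Lambda> (\<lambda>z. f z - g z) = (\<lambda>z. \<Lambda> f z - \<Lambda> g z)"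
    and \<beta>: "\<And>\<alpha>. \<alpha> > 0 \<Longrightarrow> \<beta> \<alpha> > 0" and C: "\<And>\<alpha>. \<alpha> > 0 \<Longrightarrow> C \<alpha> \<ge> 0"
    and bound: "\<And>f \<alpha> j. f \<in> Ainf \<Longrightarrow> \<alpha> > 0 \<Longrightarrow>
      cmod (taylor_coeff (\<Lambda> f) j) * (real j + 1) powr \<alpha> \<le> C \<alpha> * Ainf_norm (\<beta> \<alpha>) f"
  shows "Ainf_operator \<Lambda>"
  unfolding Ainf_operator_def
proof (intro conjI ballI allI impI)
  show "\<Lambda> f \<in> Ainf" if "f \<in> Ainf" for f
    using assms(1,2) [OF that] bound [OF that] by (rule AinfI)
  show "\<Lambda> (\<lambda>z. f z - g z) = (\<lambda>z. \<Lambda> f z - \<Lambda> g z)" if "f \<in> Ainf" "g \<in> Ainf" for f g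
    using that by (rule assms)
  show "\<exists>\<beta>>0. \<exists>C\<ge>0. \<forall>f\<in>Ainf. Ainf_norm \<alpha> (\<Lambda> f) \<le> C * Ainf_norm \<beta> f" if "\<alpha> > 0" for \<alpha> :: real
    using that \<beta> C bound by (metis Ainf_norm_le)
qed

lemma Ainf_operator_comp:
  assumes "Ainf_operator \<Lambda>" "Ainf_operator \<Lambda>'"
  shows "Ainf_operator (\<lambda>f. \<Lambda> (\<Lambda>' f))"
  unfolding Ainf_operator_def
proof (intro conjI ballI allI impI)
  show "\<Lambda> (\<Lambda>' f) \<in> Ainf" if "f \<in> Ainf" for f
    using that assms by (simp add: Ainf_operator_mem)
  show "\<Lambda> (\<Lambda>' (\<lambda>z. f z - g z)) = (\<lambda>z. \<Lambda> (\<Lambda>' f) z - \<Lambda> (\<Lambda>' g) z)" if "f \<in> Ainf" "g \<in> Ainf" for f g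
    using that assms by (simp add: Ainf_operator_mem Ainf_operator_diff)
  fix \<alpha> :: real assume "\<alpha> > 0"
  obtain \<beta> C where 1: "\<beta> > 0" "C \<ge> 0" "\<And>f. f \<in> Ainf \<Longrightarrow> Ainf_norm \<alpha> (\<Lambda> f) \<le> C * Ainf_norm \<beta> f"
    using Ainf_operator_bound [OF assms(1) \<open>\<alpha> > 0\<close>] by metis
  obtain \<beta>' C' where 2: "\<beta>' > 0" "C' \<ge> 0" "\<And>f. f \<in> Ainf \<Longrightarrow> Ainf_norm \<beta> (\<Lambda>' f) \<le> C' * Ainf_norm \<beta>' f"
    using Ainf_operator_bound [OF assms(2) 1(1)] by metis
  have "Ainf_norm \<alpha> (\<Lambda> (\<Lambda>' f)) \<le> (C * C') * Ainf_norm \<beta>' f" if "f \<in> Ainf" for f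
  proof -
    have "Ainf_norm \<alpha> (\<Lambda> (\<Lambda>' f)) \<le> C * Ainf_norm \<beta> (\<Lambda>' f)"
      using that assms by (simp add: 1 Ainf_operator_mem)
    also have "\<dots> \<le> C * (C' * Ainf_norm \<beta>' f)"
      using 1 2(3) [OF that] by (intro mult_left_mono)
    finally show ?thesis by (simp add: mult.assoc)
  qed
  then show "\<exists>\<beta>>0. \<exists>C\<ge>0. \<forall>f\<in>Ainf. Ainf_norm \<alpha> (\<Lambda> (\<Lambda>' f)) \<le> C * Ainf_norm \<beta> f"
    using 1 2 by (metis mult_nonneg_nonneg)
qed

lemma Ainf_operator_funpow:
  assumes "Ainf_operator \<Lambda>"
  shows "Ainf_operator (\<Lambda> ^^ i)"
proof (induction i)
  case 0
  have "Ainf_operator (\<lambda>f. f)"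
    by (rule Ainf_operatorI [where \<beta> = "\<lambda>\<alpha>. \<alpha>" and C = "\<lambda>_. 1"])
      (simp_all add: Ainf_holomorphic Ainf_outside taylor_coeff_le_Ainf_norm)
  then show ?case
    by (simp add: id_def)
next
  case (Suc i)
  then show ?case
    using Ainf_operator_comp [OF assms Suc] by (simp add: comp_def)
qed

lemma Ainf_operator_cmult: "Ainf_operator (\<lambda>f z. c * f z)"
  by (rule Ainf_operatorI [where \<beta> = "\<lambda>\<alpha>. \<alpha>" and C = "\<lambda>_. cmod c"])
    (simp_all add: holomorphic_on_mult Ainf_holomorphic Ainf_cmult_bound
      Ainf_outside fun_eq_iff right_diff_distrib)

text \<open>Coefficient \<open>j\<close> of the derivative is \<open>j + 1\<close> times coefficient
  \<open>j + 1\<close> of \<open>f\<close>; the factor raises the exponent of the norm by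
  one.\<close>

lemma Ainf_operator_deriv: "Ainf_operator (\<lambda>f. zero_ext unit_disc (deriv f))"
proof (rule Ainf_operatorI [where \<beta> = "\<lambda>\<alpha>. \<alpha> + 1" and C = "\<lambda>_. 1"])
  fix f :: "complex \<Rightarrow> complex" and \<alpha> :: real and j :: nat
  assume f: "f \<in> Ainf" and "\<alpha> > 0"
  have "taylor_coeff (zero_ext unit_disc (deriv f)) j = of_nat (Suc j) * taylor_coeff f (Suc j)"
    unfolding taylor_coeff_zero_ext [OF holomorphic_deriv [OF Ainf_holomorphic [OF f] open_ball]]
    by (simp add: taylor_coeff_def funpow_Suc_right del: funpow.simps of_nat_Suc)
  then have "cmod (taylor_coeff (zero_ext unit_disc (deriv f)) j) * (real j + 1) powr \<alpha>
    = cmod (taylor_coeff f (Suc j)) * (real j + 1) powr (\<alpha> + 1)"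
    by (simp add: norm_mult powr_add mult_ac del: of_nat_Suc)
  also have "\<dots> \<le> cmod (taylor_coeff f (Suc j)) * (real (Suc j) + 1) powr (\<alpha> + 1)"
    using \<open>\<alpha> > 0\<close> by (intro mult_left_mono powr_mono2) auto
  also have "\<dots> \<le> Ainf_norm (\<alpha> + 1) f"
    using f \<open>\<alpha> > 0\<close> by (intro taylor_coeff_le_Ainf_norm) auto
  finally show "cmod (taylor_coeff (zero_ext unit_disc (deriv f)) j) * (real j + 1) powr \<alpha>
    \<le> 1 * Ainf_norm (\<alpha> + 1) f" by simp
next
  fix f g :: "complex \<Rightarrow> complex" assume fg: "f \<in> Ainf" "g \<in> Ainf"
  show "zero_ext unit_disc (deriv (\<lambda>z. f z - g z)) =
    (\<lambda>z. zero_ext unit_disc (deriv f) z - zero_ext unit_disc (deriv g) z)"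
    using fg [THEN Ainf_holomorphic]
    by (auto simp: zero_ext_def fun_eq_iff intro!: deriv_diff holomorphic_on_imp_differentiable_at)
next
  fix f :: "complex \<Rightarrow> complex" assume "f \<in> Ainf"
  then have "deriv f holomorphic_on unit_disc"
    by (intro holomorphic_deriv Ainf_holomorphic) auto
  then show "zero_ext unit_disc (deriv f) holomorphic_on unit_disc"
    by (rule holomorphic_transform) (simp add: zero_ext_def)
qed (auto simp: zero_ext_def)

lemma taylor_coeff_affine_mult:
  assumes "f holomorphic_on unit_disc"
  shows "taylor_coeff (\<lambda>z. (1 + c * z) * f z) j =
    taylor_coeff f j + (if j = 0 then 0 else c * taylor_coeff f (j - 1))"
proof -
  have d1: "deriv (\<lambda>z. 1 + c * z) = (\<lambda>z. c)"
    by (intro ext DERIV_imp_deriv) (auto intro!: derivative_eq_intros)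
  have c0: "coeff_at 0 (\<lambda>z. 1 + c * z) 0 = 1"
    and c1: "coeff_at (Suc 0) (\<lambda>z. 1 + c * z) 0 = c"
    and c2: "coeff_at (Suc (Suc i)) (\<lambda>z. 1 + c * z) 0 = 0" for i
    by (simp_all add: coeff_at_def d1 funpow_Suc_right del: funpow.simps)
  have "taylor_coeff (\<lambda>z. (1 + c * z) * f z) j =
      (\<Sum>i\<le>j. coeff_at i (\<lambda>z. 1 + c * z) 0 * coeff_at (j - i) f 0)"
    unfolding taylor_coeff_def coeff_at_def [symmetric]
    by (rule coeff_at_mult [OF _ assms]) (auto intro!: holomorphic_intros)
  also have "\<dots> = (\<Sum>i\<in>{0, 1} \<inter> {..j}. coeff_at i (\<lambda>z. 1 + c * z) 0 * coeff_at (j - i) f 0)"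
  proof (rule sum.mono_neutral_right)
    show "\<forall>i\<in>{..j} - {0, 1} \<inter> {..j}. coeff_at i (\<lambda>z. 1 + c * z) 0 * coeff_at (j - i) f 0 = 0"
    proof
      fix i assume "i \<in> {..j} - {0, 1} \<inter> {..j}"
      then obtain i' where "i = Suc (Suc i')"
        by (cases i; cases "i - 1") auto
      then show "coeff_at i (\<lambda>z. 1 + c * z) 0 * coeff_at (j - i) f 0 = 0"
        by (simp add: c2)
    qed
  qed auto
  also have "\<dots> = coeff_at j f 0 + (if j = 0 then 0 else c * coeff_at (j - 1) f 0)"
    using c0 c1 by (cases j) (auto simp: Int_insert_left)
  finally show ?thesis
    by (simp add: taylor_coeff_def coeff_at_def)
qed

lemma Ainf_operator_affine_mult: "Ainf_operator (\<lambda>f z. (1 + c * z) * f z)"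
proof (rule Ainf_operatorI [where \<beta> = "\<lambda>\<alpha>. \<alpha>" and C = "\<lambda>\<alpha>. 1 + cmod c * 2 powr \<alpha>"])
  fix f :: "complex \<Rightarrow> complex" and \<alpha> :: real and j :: nat
  assume f: "f \<in> Ainf" and "\<alpha> > 0"
  have "cmod (if j = 0 then 0 else c * taylor_coeff f (j - 1)) * (real j + 1) powr \<alpha>
    \<le> cmod c * 2 powr \<alpha> * Ainf_norm \<alpha> f"
  proof (cases j)
    case 0
    then show ?thesis
      using Ainf_norm_nonneg [OF f \<open>\<alpha> > 0\<close>] by simp
  next
    case (Suc i)
    \<comment> \<open>With \<open>j = i + 1\<close> one has \<open>j + 1 \<le> 2 * (i + 1)\<close>;
      this is the source of the constant \<open>2 powr \<alpha>\<close>.\<close>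
    have "(real j + 1) powr \<alpha> \<le> (2 * (real i + 1)) powr \<alpha>"
      using \<open>\<alpha> > 0\<close> Suc by (intro powr_mono2) auto
    also have "\<dots> = 2 powr \<alpha> * (real i + 1) powr \<alpha>"
      by (simp only: powr_mult)
    finally have "cmod (taylor_coeff f i) * (real j + 1) powr \<alpha>
        \<le> cmod (taylor_coeff f i) * (2 powr \<alpha> * (real i + 1) powr \<alpha>)"
      by (rule mult_left_mono) simp
    also have "\<dots> = 2 powr \<alpha> * (cmod (taylor_coeff f i) * (real i + 1) powr \<alpha>)"
      by simp
    also have "\<dots> \<le> 2 powr \<alpha> * Ainf_norm \<alpha> f"
      using f \<open>\<alpha> > 0\<close> by (intro mult_left_mono taylor_coeff_le_Ainf_norm) auto
    finally have "cmod c * (cmod (taylor_coeff f i) * (real j + 1) powr \<alpha>) \<le> cmod c * (2 powr \<alpha> * Ainf_norm \<alpha> f)"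
      by (rule mult_left_mono) simp
    then show ?thesis
      using Suc by (simp add: norm_mult mult.assoc)
  qed
  moreover have "cmod (taylor_coeff (\<lambda>z. (1 + c * z) * f z) j) * (real j + 1) powr \<alpha>
    \<le> cmod (taylor_coeff f j) * (real j + 1) powr \<alpha>
      + cmod (if j = 0 then 0 else c * taylor_coeff f (j - 1)) * (real j + 1) powr \<alpha>"
    unfolding taylor_coeff_affine_mult [OF Ainf_holomorphic [OF f]] distrib_right [symmetric]
    by (intro mult_right_mono norm_triangle_ineq) simp
  moreover have "cmod (taylor_coeff f j) * (real j + 1) powr \<alpha> \<le> Ainf_norm \<alpha> f"
    using f \<open>\<alpha> > 0\<close> by (rule taylor_coeff_le_Ainf_norm)
  ultimately show "cmod (taylor_coeff (\<lambda>z. (1 + c * z) * f z) j) * (real j + 1) powr \<alpha>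
    \<le> (1 + cmod c * 2 powr \<alpha>) * Ainf_norm \<alpha> f"
    by (simp add: distrib_right)
qed (simp_all add: holomorphic_on_mult holomorphic_on_add Ainf_holomorphic Ainf_outside algebra_simps)

text \<open>If \<open>\<theta>' = p (1 + c \<theta>)^2 \<psi>'\<close>, this is the derivation
  \<open>(1 / \<psi>') d/dz\<close> as seen on the disc through the coordinate
  \<open>\<theta>\<close>.\<close>

definition quadratic_derivation :: "complex \<Rightarrow> complex \<Rightarrow> (complex \<Rightarrow> complex) \<Rightarrow> complex \<Rightarrow> complex"
  where "quadratic_derivation p c f =
    (\<lambda>z. p * ((1 + c * z) * ((1 + c * z) * zero_ext unit_disc (deriv f) z)))"

lemma Ainf_operator_quadratic_derivation: "Ainf_operator (quadratic_derivation p c)"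
  unfolding quadratic_derivation_def [abs_def]
  using Ainf_operator_comp [OF Ainf_operator_cmult
      Ainf_operator_comp [OF Ainf_operator_affine_mult
        Ainf_operator_comp [OF Ainf_operator_affine_mult Ainf_operator_deriv]]]
  by simp

section \<open>The topology of \<open>Ainf\<close>\<close>

lemma topspace_Ainf_topology: "topspace Ainf_topology = Ainf"
proof -
  have "\<exists>V. f \<in> V \<and> V \<in> {{g \<in> Ainf. Ainf_norm \<alpha> (\<lambda>z. g z - f z) < \<epsilon>} | f \<alpha> \<epsilon>. f \<in> Ainf \<and> \<alpha> > 0 \<and> \<epsilon> > 0}"
    if "f \<in> Ainf" for f
  proof -
    have "Ainf_norm 1 (\<lambda>z. f z - f z) \<le> 0"
      using taylor_coeff_cmult [OF Ainf_holomorphic [OF that], of 0] by (intro Ainf_norm_le) simp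
    with that show ?thesis
      by (intro exI [where x = "{g \<in> Ainf. Ainf_norm 1 (\<lambda>z. g z - f z) < 1}"]) force
  qed
  then have "Ainf \<subseteq> topspace Ainf_topology"
    unfolding Ainf_topology_def topology_generated_by_topspace by (meson Union_iff subsetI)
  moreover have "topspace Ainf_topology \<subseteq> Ainf"
    unfolding Ainf_topology_def topology_generated_by_topspace by auto
  ultimately show ?thesis
    by (rule subset_antisym [rotated])
qed

lemma continuous_map_Ainf_operator:
  assumes \<Lambda>: "Ainf_operator \<Lambda>"
  shows "continuous_map Ainf_topology Ainf_topology \<Lambda>"
proof -
  let ?B = "{{g \<in> Ainf. Ainf_norm \<alpha> (\<lambda>z. g z - f z) < \<epsilon>} | f \<alpha> \<epsilon>. f \<in> Ainf \<and> \<alpha> > 0 \<and> \<epsilon> > 0}"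
  have "openin Ainf_topology (\<Lambda> -` V \<inter> Ainf)" if V: "V \<in> ?B" for V
  proof -
    obtain f and \<alpha> \<epsilon> :: real where f: "f \<in> Ainf" "\<alpha> > 0" "\<epsilon> > 0"
      and V_eq: "V = {g \<in> Ainf. Ainf_norm \<alpha> (\<lambda>z. g z - f z) < \<epsilon>}"
      using V by blast
    obtain \<beta> C where \<beta>: "\<beta> > 0" "C \<ge> 0" "\<And>f. f \<in> Ainf \<Longrightarrow> Ainf_norm \<alpha> (\<Lambda> f) \<le> C * Ainf_norm \<beta> f"
      using Ainf_operator_bound [OF \<Lambda> \<open>\<alpha> > 0\<close>] by metis
    have "\<exists>W. openin Ainf_topology W \<and> g \<in> W \<and> W \<subseteq> \<Lambda> -` V \<inter> Ainf" if g: "g \<in> \<Lambda> -` V \<inter> Ainf" for g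
    proof (intro exI conjI)
      \<comment> \<open>The distance left from \<open>\<Lambda> g\<close> to the boundary of
        \<open>V\<close>. Dividing by \<open>C + 1\<close> covers \<open>C = 0\<close> and makes the
        final inequality strict.\<close>
      define \<delta> where "\<delta> = (\<epsilon> - Ainf_norm \<alpha> (\<lambda>z. \<Lambda> g z - f z)) / (C + 1)"
      have "\<delta> > 0"
        using g \<open>C \<ge> 0\<close> by (simp add: \<delta>_def V_eq)
      let ?W = "{h \<in> Ainf. Ainf_norm \<beta> (\<lambda>z. h z - g z) < \<delta>}"
      show "openin Ainf_topology ?W"
        unfolding Ainf_topology_def using g \<beta> \<open>\<delta> > 0\<close> by (intro topology_generated_by_Basis) blast
      have "Ainf_norm \<beta> (\<lambda>z. g z - g z) \<le> 0"
        using taylor_coeff_cmult [OF Ainf_holomorphic, of g 0] g by (intro Ainf_norm_le) simp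
      then show "g \<in> ?W"
        using g \<open>\<delta> > 0\<close> by simp
      show "?W \<subseteq> \<Lambda> -` V \<inter> Ainf"
      proof
        fix h assume h: "h \<in> ?W"
        have mem: "(\<lambda>z. h z - g z) \<in> Ainf" "\<Lambda> g \<in> Ainf" "\<Lambda> h \<in> Ainf"
          using g h by (auto intro!: Ainf_diff Ainf_operator_mem [OF \<Lambda>])
        have "Ainf_norm \<alpha> (\<lambda>z. \<Lambda> h z - \<Lambda> g z) \<le> C * Ainf_norm \<beta> (\<lambda>z. h z - g z)"
          using \<beta>(3) [OF mem(1)] Ainf_operator_diff [OF \<Lambda>, of h g] g h by simp
        also have "\<dots> \<le> C * \<delta>"
          using h \<open>C \<ge> 0\<close> by (intro mult_left_mono) auto
        also have "\<dots> < (C + 1) * \<delta>"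
          using \<open>\<delta> > 0\<close> by simp
        also have "\<dots> = \<epsilon> - Ainf_norm \<alpha> (\<lambda>z. \<Lambda> g z - f z)"
          using \<open>C \<ge> 0\<close> by (simp add: \<delta>_def)
        finally have "Ainf_norm \<alpha> (\<lambda>z. (\<Lambda> h z - \<Lambda> g z) + (\<Lambda> g z - f z)) < \<epsilon>"
          using Ainf_norm_add_le [OF Ainf_diff [OF mem(3,2)] Ainf_diff [OF mem(2) f(1)] f(2)] by simp
        then show "h \<in> \<Lambda> -` V \<inter> Ainf"
          using h mem by (simp add: V_eq)
      qed
    qed
    then show ?thesis
      by (subst openin_subopen) blast
  qed
  moreover have "\<Lambda> ` Ainf \<subseteq> \<Union>?B"
    using Ainf_operator_mem [OF \<Lambda>] topspace_Ainf_topology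
    unfolding Ainf_topology_def topology_generated_by_topspace by blast
  ultimately have "continuous_map Ainf_topology (topology_generated_by ?B) \<Lambda>"
    by (intro continuous_on_generated_topo) (simp_all only: topspace_Ainf_topology)
  then show ?thesis
    by (simp only: Ainf_topology_def)
qed

text \<open>Composed with a conformal equivalence this gives the equivalence itself, so
  multiplication by conformal equivalences is part of the module action.\<close>

definition disc_coordinate :: "complex \<Rightarrow> complex"
  where "disc_coordinate = zero_ext unit_disc (\<lambda>z. z)"

lemma disc_coordinate_in_Ainf: "disc_coordinate \<in> Ainf"
proof (rule AinfI [where K = "\<lambda>\<alpha>. 2 powr \<alpha>"])
  show "disc_coordinate holomorphic_on unit_disc"
    by (rule holomorphic_transform [OF holomorphic_on_ident]) (simp add: disc_coordinate_def zero_ext_def)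
  have "taylor_coeff disc_coordinate j = (if j = 1 then 1 else 0)" for j
  proof -
    have d1: "deriv (\<lambda>z. z) = (\<lambda>z :: complex. 1)"
      by simp
    have "(deriv ^^ j) (\<lambda>z. z) 0 = (if j = 1 then 1 else 0 :: complex)"
    proof (cases j)
      case (Suc i)
      then show ?thesis
        by (cases i) (simp_all add: funpow_Suc_right d1 del: funpow.simps(2))
    qed simp
    then show ?thesis
      unfolding disc_coordinate_def taylor_coeff_zero_ext [OF holomorphic_on_ident]
      unfolding taylor_coeff_def
      by simp
  qed
  then show "cmod (taylor_coeff disc_coordinate j) * (real j + 1) powr \<alpha> \<le> 2 powr \<alpha>" for \<alpha> j
    by simp
qed (simp add: disc_coordinate_def zero_ext_def)

section \<open>Transport to a conformally equivalent set\<close>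

lemma conformal_equivD:
  assumes "conformal_equiv \<psi> U unit_disc"
  shows "\<psi> holomorphic_on U" "inj_on \<psi> U" "\<psi> ` U = unit_disc"
    "z \<in> U \<Longrightarrow> \<psi> z \<in> unit_disc"
  using assms by (auto simp: conformal_equiv_def bij_betw_def)

text \<open>The inverse of \<open>b \<mapsto> zero_ext U (b \<circ> \<psi>)\<close>, that is, the
  map along which the topology of the algebra on \<open>U\<close> is pulled back.\<close>

definition Ainf_pull :: "complex set \<Rightarrow> (complex \<Rightarrow> complex) \<Rightarrow> (complex \<Rightarrow> complex) \<Rightarrow> complex \<Rightarrow> complex"
  where "Ainf_pull U \<psi> a = zero_ext unit_disc (a \<circ> inv_into U \<psi>)"

lemma Ainf_pull_zero_ext:
  assumes "conformal_equiv \<psi> U unit_disc" "b \<in> Ainf"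
  shows "Ainf_pull U \<psi> (zero_ext U (b \<circ> \<psi>)) = b"
proof
  fix w
  show "Ainf_pull U \<psi> (zero_ext U (b \<circ> \<psi>)) w = b w"
  proof (cases "w \<in> unit_disc")
    case True
    then have "w \<in> \<psi> ` U"
      using conformal_equivD [OF assms(1)] by simp
    then have "inv_into U \<psi> w \<in> U" "\<psi> (inv_into U \<psi> w) = w"
      by (simp_all add: inv_into_into f_inv_into_f)
    with True show ?thesis
      by (simp add: Ainf_pull_def zero_ext_def)
  next
    case False
    then show ?thesis
      using Ainf_outside [OF assms(2)] by (simp add: Ainf_pull_def zero_ext_def)
  qed
qed

lemma Ainf_pull_mem:
  assumes "conformal_equiv \<psi> U unit_disc" "a \<in> Ainf_on U \<psi>"
  shows "Ainf_pull U \<psi> a \<in> Ainf" "a = zero_ext U (Ainf_pull U \<psi> a \<circ> \<psi>)"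
  using assms Ainf_pull_zero_ext [OF assms(1)] unfolding Ainf_on_def by force+

lemma Ainf_on_topology_eq:
  "Ainf_on_topology U \<psi> = pullback_topology (Ainf_on U \<psi>) (Ainf_pull U \<psi>) Ainf_topology"
  by (simp add: Ainf_on_topology_def Ainf_pull_def [abs_def])

lemma topspace_Ainf_on_topology:
  assumes "conformal_equiv \<psi> U unit_disc"
  shows "topspace (Ainf_on_topology U \<psi>) = Ainf_on U \<psi>"
  using Ainf_pull_mem [OF assms]
  by (auto simp: Ainf_on_topology_eq topspace_pullback_topology topspace_Ainf_topology)

definition Ainf_lift ::
    "complex set \<Rightarrow> (complex \<Rightarrow> complex) \<Rightarrow> ((complex \<Rightarrow> complex) \<Rightarrow> complex \<Rightarrow> complex) \<Rightarrow>
      (complex \<Rightarrow> complex) \<Rightarrow> complex \<Rightarrow> complex"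
  where "Ainf_lift U \<psi> \<Lambda> a = zero_ext U (\<Lambda> (Ainf_pull U \<psi> a) \<circ> \<psi>)"

lemma Ainf_lift_mem:
  assumes "conformal_equiv \<psi> U unit_disc" "Ainf_operator \<Lambda>" "a \<in> Ainf_on U \<psi>"
  shows "Ainf_lift U \<psi> \<Lambda> a \<in> Ainf_on U \<psi>"
  unfolding Ainf_lift_def Ainf_on_def
  using Ainf_operator_mem [OF assms(2) Ainf_pull_mem(1) [OF assms(1,3)]] by blast

lemma continuous_map_Ainf_lift:
  assumes "conformal_equiv \<psi> U unit_disc" "Ainf_operator \<Lambda>"
  shows "continuous_map (Ainf_on_topology U \<psi>) (Ainf_on_topology U \<psi>) (Ainf_lift U \<psi> \<Lambda>)"
proof -
  have "continuous_map (Ainf_on_topology U \<psi>) Ainf_topology (\<Lambda> \<circ> Ainf_pull U \<psi>)"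
    unfolding Ainf_on_topology_eq
    by (intro continuous_map_pullback continuous_map_Ainf_operator assms)
  then have "continuous_map (Ainf_on_topology U \<psi>) Ainf_topology (Ainf_pull U \<psi> \<circ> Ainf_lift U \<psi> \<Lambda>)"
    by (rule continuous_map_eq)
      (simp add: topspace_Ainf_on_topology assms Ainf_lift_def Ainf_pull_zero_ext Ainf_pull_mem
        Ainf_operator_mem)
  then show ?thesis
    using Ainf_lift_mem [OF assms] topspace_Ainf_on_topology [OF assms(1)]
    unfolding Ainf_on_topology_eq by (intro continuous_map_pullback') auto
qed

text \<open>
  Conformal equivalences \<open>\<psi>, \<theta>\<close> of \<open>U\<close> with the disc differ by a disc automorphism. Since the derivative
  of a Moebius map is a quadratic polynomial in that map, the change of coordinates is governed by
  an operator on \<open>A\<^sup>\<infinity>\<close>, and the invariance of \<open>A\<^sup>\<infinity>\<close> under automorphisms is not needed.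
\<close>

lemma conformal_equiv_deriv_quadratic:
  assumes "open U" and \<psi>: "conformal_equiv \<psi> U unit_disc" and \<theta>: "conformal_equiv \<theta> U unit_disc"
  obtains p c where "\<And>z. z \<in> U \<Longrightarrow> deriv \<theta> z = p * (1 + c * \<theta> z)\<^sup>2 * deriv \<psi> z"
proof -
  note \<psi>D = conformal_equivD [OF \<psi>] and \<theta>D = conformal_equivD [OF \<theta>]
  have "0 \<in> \<theta> ` U"
    using \<theta>D by simp
  then obtain z0 where z0: "z0 \<in> U" "\<theta> z0 = 0"
    by auto
  define q where "q = \<psi> z0"
  have q: "cmod q < 1"
    using \<psi>D(4) [OF z0(1)] by (simp add: q_def)
  \<comment> \<open>The equivalence \<open>\<psi>\<close>, followed by a disc automorphism so that
    it has the same zero \<open>z0\<close> as \<open>\<theta>\<close>.\<close>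
  define \<eta> where "\<eta> = (\<lambda>z. Moebius_function 0 q (\<psi> z))"
  have holo_\<eta>: "\<eta> holomorphic_on U"
    unfolding \<eta>_def using \<psi>D Moebius_function_holomorphic [OF q]
    by (intro holomorphic_on_compose_gen [OF \<psi>D(1), unfolded o_def]) auto
  have \<eta>_lt: "\<eta> z \<in> unit_disc" if "z \<in> U" for z
    unfolding \<eta>_def using Moebius_function_norm_lt_1 [OF q] \<psi>D(4) [OF that] by simp
  have inv: "Moebius_function 0 (- q) (\<eta> z) = \<psi> z" if "z \<in> U" for z
    unfolding \<eta>_def using q \<psi>D(4) [OF that] by (intro Moebius_function_compose) auto
  have inj_\<eta>: "inj_on \<eta> U"
    using inv \<psi>D(2) by (metis inj_on_def)
  have \<eta>_surj: "\<eta> ` U = unit_disc"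
  proof
    show "\<eta> ` U \<subseteq> unit_disc"
      using \<eta>_lt by blast
    show "unit_disc \<subseteq> \<eta> ` U"
    proof
      fix w :: complex assume w: "w \<in> unit_disc"
      have "Moebius_function 0 (- q) w \<in> \<psi> ` U"
        using \<psi>D(3) Moebius_function_norm_lt_1 [of "- q" w] q w by simp
      then obtain z where "z \<in> U" "\<psi> z = Moebius_function 0 (- q) w"
        by auto
      then have "\<eta> z = w"
        unfolding \<eta>_def using q w Moebius_function_compose [of q "- q" w] by simp
      then show "w \<in> \<eta> ` U"
        using \<open>z \<in> U\<close> by blast
    qed
  qed
  obtain g where g: "g holomorphic_on unit_disc" "\<And>z. z \<in> U \<Longrightarrow> g (\<eta> z) = z"
    using holomorphic_has_inverse [OF holo_\<eta> \<open>open U\<close> inj_\<eta>] \<eta>_surj by metis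
  obtain k where k: "k holomorphic_on unit_disc" "\<And>z. z \<in> U \<Longrightarrow> k (\<theta> z) = z"
    using holomorphic_has_inverse [OF \<theta>D(1) \<open>open U\<close> \<theta>D(2)] \<theta>D(3) by metis
  have gU: "g ` unit_disc \<subseteq> U"
    unfolding \<eta>_surj [symmetric] using g(2) by auto
  have kU: "k ` unit_disc \<subseteq> U"
    unfolding \<theta>D(3) [symmetric] using k(2) by auto
  have "\<eta> z0 = 0"
    by (simp add: \<eta>_def q_def Moebius_function_eq_zero)
  have holo1: "(\<lambda>w. \<theta> (g w)) holomorphic_on unit_disc"
    using holomorphic_on_compose_gen [OF g(1) \<theta>D(1) gU] by (simp add: o_def)
  have holo2: "(\<lambda>w. \<eta> (k w)) holomorphic_on unit_disc"
    using holomorphic_on_compose_gen [OF k(1) holo_\<eta> kU] by (simp add: o_def)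
  have zero1: "\<theta> (g 0) = 0" and zero2: "\<eta> (k 0) = 0"
    using g(2) [OF z0(1)] k(2) [OF z0(1)] z0(2) \<open>\<eta> z0 = 0\<close> by auto
  have lt1: "cmod (\<theta> (g w)) < 1" and lt2: "cmod (\<eta> (k w)) < 1" if "cmod w < 1" for w
  proof -
    have "g w \<in> U" "k w \<in> U"
      using that gU kU by auto
    from \<theta>D(4) [OF this(1)] \<eta>_lt [OF this(2)] show "cmod (\<theta> (g w)) < 1" "cmod (\<eta> (k w)) < 1"
      by simp_all
  qed
  \<comment> \<open>The Schwarz lemma for both transition maps gives equal moduli of
    \<open>\<eta>\<close> and \<open>\<theta>\<close>. Equality at one point other than the zero
    already makes the transition map a rotation; the value \<open>1 / 2\<close> below is an
    arbitrary such point.\<close>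
  note S1 = Schwarz_Lemma' [OF holo1 zero1 lt1] and S2 = Schwarz_Lemma' [OF holo2 zero2 lt2]
  obtain z1 where z1: "z1 \<in> U" "\<eta> z1 = 1 / 2"
  proof -
    have "1 / 2 \<in> \<eta> ` U"
      unfolding \<eta>_surj by simp
    then show ?thesis
      using that by auto
  qed
  have "cmod (\<theta> z1) \<le> cmod (\<eta> z1)"
    using S1 \<eta>_lt [OF z1(1)] g(2) [OF z1(1)] by (metis mem_ball_0)
  moreover have "cmod (\<eta> z1) \<le> cmod (\<theta> z1)"
    using S2 \<theta>D(4) [OF z1(1)] k(2) [OF z1(1)] by (metis mem_ball_0)
  ultimately have "cmod (\<theta> (g (1 / 2))) = cmod (1 / 2)"
    using g(2) [OF z1(1)] z1(2) by simp
  moreover have "cmod (1 / 2) < 1" "1 / 2 \<noteq> (0 :: complex)"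
    by simp_all
  ultimately obtain \<alpha> where \<alpha>: "\<And>w. cmod w < 1 \<Longrightarrow> \<theta> (g w) = \<alpha> * w" "cmod \<alpha> = 1"
    using S1 by metis
  have \<theta>\<eta>: "\<theta> z = \<alpha> * \<eta> z" if "z \<in> U" for z
    using \<alpha>(1) [of "\<eta> z"] \<eta>_lt [OF that] g(2) [OF that] by simp
  have "\<alpha> \<noteq> 0"
    using \<alpha>(2) by auto
  define s where "s = 1 - cnj q * q"
  have "s \<noteq> 0"
  proof
    assume "s = 0"
    then have "cmod (cnj q * q) = 1"
      by (simp add: s_def)
    then have "cmod q * cmod q = 1"
      by (simp add: norm_mult)
    then show False
      using norm_mult_less [of q 1 q 1] q by (simp add: norm_mult)
  qed
  \<comment> \<open>With \<open>D = 1 - cnj q * \<psi>\<close> one has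
    \<open>\<theta> = \<alpha> (\<psi> - q) / D\<close>, hence
    \<open>\<theta>' = \<alpha> s \<psi>' / D^2\<close>. The choice
    \<open>c = cnj q / \<alpha>\<close> gives \<open>1 + c \<theta> = s / D\<close>, so
    \<open>p = \<alpha> / s\<close>.\<close>
  show thesis
  proof
    fix z assume z: "z \<in> U"
    define D where "D = 1 - cnj q * \<psi> z"
    have "D \<noteq> 0"
    proof
      assume "D = 0"
      then have "cmod (cnj q * \<psi> z) = 1"
        by (simp add: D_def)
      moreover have "cmod (cnj q * \<psi> z) < 1"
        using norm_mult_less [of "cnj q" 1 "\<psi> z" 1] q \<psi>D(4) [OF z] by simp
      ultimately show False by simp
    qed
    have \<psi>': "(\<psi> has_field_derivative deriv \<psi> z) (at z)"
      using \<psi>D(1) \<open>open U\<close> z by (rule holomorphic_derivI)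
    have "((\<lambda>z. \<alpha> * ((\<psi> z - q) / (1 - cnj q * \<psi> z))) has_field_derivative
        \<alpha> * ((deriv \<psi> z * D - (\<psi> z - q) * (- (cnj q * deriv \<psi> z))) / (D * D))) (at z)"
      unfolding D_def
      by (rule derivative_eq_intros \<psi>' refl \<open>D \<noteq> 0\<close> [unfolded D_def] | simp)+
    moreover have "\<alpha> * ((\<psi> w - q) / (1 - cnj q * \<psi> w)) = \<theta> w" if "w \<in> U" for w
      using \<theta>\<eta> [OF that] by (simp add: \<eta>_def Moebius_function_simple)
    ultimately have "(\<theta> has_field_derivative
        \<alpha> * ((deriv \<psi> z * D - (\<psi> z - q) * (- (cnj q * deriv \<psi> z))) / (D * D))) (at z)"
      using \<open>open U\<close> z by (metis (no_types, lifting) has_field_derivative_transform_within_open)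
    then have "deriv \<theta> z = \<alpha> * ((deriv \<psi> z * D - (\<psi> z - q) * (- (cnj q * deriv \<psi> z))) / (D * D))"
      by (rule DERIV_imp_deriv)
    also have "deriv \<psi> z * D - (\<psi> z - q) * (- (cnj q * deriv \<psi> z)) = deriv \<psi> z * s"
      by (simp add: D_def s_def algebra_simps)
    finally have 1: "deriv \<theta> z = \<alpha> * (deriv \<psi> z * s / (D * D))" .
    have "\<theta> z = \<alpha> * ((\<psi> z - q) / D)"
      using \<theta>\<eta> [OF z] by (simp add: \<eta>_def Moebius_function_simple D_def)
    then have "1 + cnj q / \<alpha> * \<theta> z = 1 + cnj q * ((\<psi> z - q) / D)"
      using \<open>\<alpha> \<noteq> 0\<close> by simp
    also have "\<dots> = (D + cnj q * (\<psi> z - q)) / D"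
      using \<open>D \<noteq> 0\<close> by (simp add: field_simps)
    also have "D + cnj q * (\<psi> z - q) = s"
      by (simp add: D_def s_def algebra_simps)
    finally have 2: "1 + cnj q / \<alpha> * \<theta> z = s / D" .
    show "deriv \<theta> z = \<alpha> / s * (1 + cnj q / \<alpha> * \<theta> z)\<^sup>2 * deriv \<psi> z"
      unfolding 1 2 using \<open>s \<noteq> 0\<close> by (simp add: power2_eq_square field_simps)
  qed
qed

section \<open>Normed spaces of functions\<close>

text \<open>Analyticity and completeness are left out, so that the locale can be interpreted for the
  space of arrays before its completeness is known and then be used in proving it.\<close>

locale normed_function_space =
  fixes F :: "(complex \<Rightarrow> 'a::complex_banach) set"
    and N :: "(complex \<Rightarrow> 'a) \<Rightarrow> real"
  assumes zero_mem: "(\<lambda>z. 0) \<in> F"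
    and add_mem: "\<lbrakk>f \<in> F; g \<in> F\<rbrakk> \<Longrightarrow> (\<lambda>z. f z + g z) \<in> F"
    and scale_mem: "f \<in> F \<Longrightarrow> (\<lambda>z. c *\<^sub>C f z) \<in> F"
    and N_nonneg: "f \<in> F \<Longrightarrow> N f \<ge> 0"
    and N_eq_0_iff: "f \<in> F \<Longrightarrow> N f = 0 \<longleftrightarrow> f = (\<lambda>z. 0)"
    and N_add_le: "\<lbrakk>f \<in> F; g \<in> F\<rbrakk> \<Longrightarrow> N (\<lambda>z. f z + g z) \<le> N f + N g"
    and N_scale: "f \<in> F \<Longrightarrow> N (\<lambda>z. c *\<^sub>C f z) = cmod c * N f"
begin

lemma diff_mem: "f \<in> F \<Longrightarrow> g \<in> F \<Longrightarrow> (\<lambda>z. f z - g z) \<in> F"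
  using add_mem [OF _ scale_mem [of g "- 1"], of f] by (simp add: scaleC_minus1)

lemma N_zero: "N (\<lambda>z. 0) = 0"
  using N_eq_0_iff [OF zero_mem] by simp

lemma N_diff_commute: "f \<in> F \<Longrightarrow> g \<in> F \<Longrightarrow> N (\<lambda>z. f z - g z) = N (\<lambda>z. g z - f z)"
  using N_scale [OF diff_mem, of g f "- 1"] by (simp add: scaleC_minus1)

lemma N_diff_le: "f \<in> F \<Longrightarrow> g \<in> F \<Longrightarrow> N (\<lambda>z. f z - g z) \<le> N f + N g"
  using N_add_le [OF _ scale_mem [of g "- 1"], of f] N_scale [of g "- 1"] by (simp add: scaleC_minus1)

lemma sum_mem: "(\<And>i. i \<in> I \<Longrightarrow> f i \<in> F) \<Longrightarrow> (\<lambda>z. \<Sum>i\<in>I. f i z) \<in> F"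
  by (induction I rule: infinite_finite_induct) (simp_all add: zero_mem add_mem)

lemma N_sum_le: "(\<And>i. i \<in> I \<Longrightarrow> f i \<in> F) \<Longrightarrow> N (\<lambda>z. \<Sum>i\<in>I. f i z) \<le> (\<Sum>i\<in>I. N (f i))"
proof (induction I rule: infinite_finite_induct)
  case (insert i I)
  then have "N (\<lambda>z. \<Sum>i\<in>insert i I. f i z) \<le> N (f i) + N (\<lambda>z. \<Sum>i\<in>I. f i z)"
    by (simp add: N_add_le sum_mem)
  also have "\<dots> \<le> N (f i) + (\<Sum>i\<in>I. N (f i))"
    using insert by simp
  finally show ?case
    using insert by simp
qed (simp_all add: N_zero)

lemma Metric_space_norm_dist: "Metric_space F (norm_dist F N)"
proof
  fix f g h
  show "0 \<le> norm_dist F N f g"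
    by (simp add: norm_dist_def diff_mem N_nonneg)
  show "norm_dist F N f g = norm_dist F N g f"
    using N_diff_commute [of f g] by (auto simp: norm_dist_def)
  assume fg: "f \<in> F" "g \<in> F"
  then show "norm_dist F N f g = 0 \<longleftrightarrow> f = g"
    by (simp add: norm_dist_def N_eq_0_iff diff_mem fun_eq_iff)
  assume "h \<in> F"
  with fg have "N (\<lambda>z. (f z - g z) + (g z - h z)) \<le> N (\<lambda>z. f z - g z) + N (\<lambda>z. g z - h z)"
    by (intro N_add_le diff_mem)
  with fg \<open>h \<in> F\<close> show "norm_dist F N f h \<le> norm_dist F N f g + norm_dist F N g h"
    by (simp add: norm_dist_def)
qed

lemma norm_dist_swap: "f \<in> F \<Longrightarrow> g \<in> F \<Longrightarrow> norm_dist F N f g = N (\<lambda>z. g z - f z)"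
  using N_diff_commute [of f g] by (simp add: norm_dist_def)

lemma topspace_norm_topology [simp]: "topspace (norm_topology F N) = F"
  unfolding norm_topology_def using Metric_space.topspace_mtopology [OF Metric_space_norm_dist] .

section \<open>The norm topology expressed by the norm of differences\<close>

lemma continuous_map_into_norm_topology:
  "continuous_map X (norm_topology F N) h \<longleftrightarrow> h \<in> topspace X \<rightarrow> F \<and>
    (\<forall>x\<in>topspace X. \<forall>e>0. \<exists>V. openin X V \<and> x \<in> V \<and> (\<forall>y\<in>V. N (\<lambda>z. h y z - h x z) < e))"
proof -
  interpret m: Metric_space F "norm_dist F N"
    by (rule Metric_space_norm_dist)
  show ?thesis (is "?L = ?R")
  proof
    assume L: ?L
    then have h: "h \<in> topspace X \<rightarrow> F"
      using continuous_map_funspace by fastforce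
    have c: "\<And>x e. x \<in> topspace X \<Longrightarrow> e > 0 \<Longrightarrow> \<exists>V. openin X V \<and> x \<in> V \<and> (\<forall>y\<in>V. h y \<in> m.mball (h x) e)"
      using L unfolding norm_topology_def m.continuous_map_to_metric by blast
    have "\<exists>V. openin X V \<and> x \<in> V \<and> (\<forall>y\<in>V. N (\<lambda>z. h y z - h x z) < e)"
      if x: "x \<in> topspace X" and "e > 0" for x e
    proof -
      obtain V where V: "openin X V" "x \<in> V" "\<And>y. y \<in> V \<Longrightarrow> h y \<in> m.mball (h x) e"
        using c [OF x \<open>e > 0\<close>] by blast
      have "N (\<lambda>z. h y z - h x z) < e" if "y \<in> V" for y
        using V(3) [OF that] by (auto simp: norm_dist_swap)
      with V show ?thesis by blast
    qed
    with h show ?R by blast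
  next
    assume R: ?R
    have "\<exists>V. openin X V \<and> x \<in> V \<and> (\<forall>y\<in>V. h y \<in> m.mball (h x) e)"
      if x: "x \<in> topspace X" and "e > 0" for x e
    proof -
      obtain V where V: "openin X V" "x \<in> V" "\<And>y. y \<in> V \<Longrightarrow> N (\<lambda>z. h y z - h x z) < e"
        using conjunct2 [OF R, rule_format, OF x \<open>e > 0\<close>] by blast
      have "h y \<in> m.mball (h x) e" if "y \<in> V" for y
      proof -
        have "h x \<in> F" "h y \<in> F"
          using R x that openin_subset [OF V(1)] by auto
        then show ?thesis
          using V(3) [OF that] by (simp add: norm_dist_swap)
      qed
      with V show ?thesis by blast
    qed
    then show ?L
      unfolding norm_topology_def m.continuous_map_to_metric by blast
  qed
qed

lemma openin_norm_ball:
  assumes "f \<in> F"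
  shows "openin (norm_topology F N) {g \<in> F. N (\<lambda>z. g z - f z) < e}"
proof -
  interpret m: Metric_space F "norm_dist F N"
    by (rule Metric_space_norm_dist)
  have "{g \<in> F. N (\<lambda>z. g z - f z) < e} = m.mball f e"
    using assms by (auto simp: norm_dist_swap)
  then show ?thesis
    unfolding norm_topology_def by simp
qed

lemma openin_norm_topologyD:
  assumes "openin (norm_topology F N) V" "f \<in> V"
  obtains e where "e > 0" "\<And>g. g \<in> F \<Longrightarrow> N (\<lambda>z. g z - f z) < e \<Longrightarrow> g \<in> V"
proof -
  interpret m: Metric_space F "norm_dist F N"
    by (rule Metric_space_norm_dist)
  obtain e where e: "e > 0" "m.mball f e \<subseteq> V"
    using assms unfolding norm_topology_def m.openin_mtopology by blast
  have "f \<in> F"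
    using assms openin_subset by fastforce
  then have "g \<in> V" if "g \<in> F" "N (\<lambda>z. g z - f z) < e" for g
    using e(2) that by (auto simp: norm_dist_swap subset_iff)
  with e(1) show thesis
    by (rule that)
qed

lemma continuous_map_norm_add:
  assumes "continuous_map X (norm_topology F N) h" "continuous_map X (norm_topology F N) k"
  shows "continuous_map X (norm_topology F N) (\<lambda>x z. h x z + k x z)"
  unfolding continuous_map_into_norm_topology
proof (intro conjI ballI allI impI)
  have h: "h \<in> topspace X \<rightarrow> F" and k: "k \<in> topspace X \<rightarrow> F"
    using assms by (auto simp: continuous_map_into_norm_topology)
  then show "(\<lambda>x z. h x z + k x z) \<in> topspace X \<rightarrow> F"
    by (auto intro: add_mem)
  fix x and e :: real assume x: "x \<in> topspace X" and "e > 0"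
  then obtain V W where V: "openin X V" "x \<in> V" "\<And>y. y \<in> V \<Longrightarrow> N (\<lambda>z. h y z - h x z) < e / 2"
    and W: "openin X W" "x \<in> W" "\<And>y. y \<in> W \<Longrightarrow> N (\<lambda>z. k y z - k x z) < e / 2"
    using assms unfolding continuous_map_into_norm_topology by (meson half_gt_zero)
  have "N (\<lambda>z. h y z + k y z - (h x z + k x z)) < e" if "y \<in> V \<inter> W" for y
  proof -
    have "y \<in> topspace X"
      using that V(1) openin_subset by auto
    then have "N (\<lambda>z. (h y z - h x z) + (k y z - k x z)) \<le> N (\<lambda>z. h y z - h x z) + N (\<lambda>z. k y z - k x z)"
      using h k x by (intro N_add_le diff_mem) auto
    also have "\<dots> < e"
      using V(3) [of y] W(3) [of y] that by simp
    finally show ?thesis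
      by (simp add: algebra_simps)
  qed
  then show "\<exists>V. openin X V \<and> x \<in> V \<and> (\<forall>y\<in>V. N (\<lambda>z. h y z + k y z - (h x z + k x z)) < e)"
    using V W by (intro exI [where x = "V \<inter> W"]) auto
qed

lemma continuous_map_norm_scale:
  assumes "continuous_map X (norm_topology F N) h"
  shows "continuous_map X (norm_topology F N) (\<lambda>x z. c *\<^sub>C h x z)"
  unfolding continuous_map_into_norm_topology
proof (intro conjI ballI allI impI)
  have h: "h \<in> topspace X \<rightarrow> F"
    using assms by (auto simp: continuous_map_into_norm_topology)
  then show "(\<lambda>x z. c *\<^sub>C h x z) \<in> topspace X \<rightarrow> F"
    by (auto intro: scale_mem)
  fix x and e :: real assume x: "x \<in> topspace X" and "e > 0"
  then have "e / (cmod c + 1) > 0"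
    by (simp add: add_nonneg_pos)
  then obtain V where V: "openin X V" "x \<in> V" "\<And>y. y \<in> V \<Longrightarrow> N (\<lambda>z. h y z - h x z) < e / (cmod c + 1)"
    using assms x unfolding continuous_map_into_norm_topology by meson
  have "N (\<lambda>z. c *\<^sub>C h y z - c *\<^sub>C h x z) < e" if "y \<in> V" for y
  proof -
    have "y \<in> topspace X"
      using that V(1) openin_subset by auto
    then have d: "(\<lambda>z. h y z - h x z) \<in> F"
      using h x by (intro diff_mem) auto
    have "N (\<lambda>z. c *\<^sub>C h y z - c *\<^sub>C h x z) = cmod c * N (\<lambda>z. h y z - h x z)"
      using N_scale [OF d, of c] by (simp add: scaleC_diff_right)
    also have "\<dots> \<le> (cmod c + 1) * N (\<lambda>z. h y z - h x z)"
      using N_nonneg [OF d] by (simp add: distrib_right)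
    also have "\<dots> < e"
      using V(3) [OF that] norm_ge_zero [of c] by (simp add: pos_less_divide_eq mult.commute add_nonneg_pos)
    finally show ?thesis .
  qed
  then show "\<exists>V. openin X V \<and> x \<in> V \<and> (\<forall>y\<in>V. N (\<lambda>z. c *\<^sub>C h y z - c *\<^sub>C h x z) < e)"
    using V by blast
qed

lemma continuous_map_norm_sum:
  "(\<And>i. i \<in> I \<Longrightarrow> continuous_map X (norm_topology F N) (h i)) \<Longrightarrow>
    continuous_map X (norm_topology F N) (\<lambda>x z. \<Sum>i\<in>I. h i x z)"
  by (induction I rule: infinite_finite_induct) (simp_all add: zero_mem continuous_map_norm_add)

text \<open>A function of norm \<open>N f > 0\<close> is rescaled to norm
  \<open>\<delta> / 2\<close>, inside the open ball on which the bound \<open>B\<close> is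
  available.\<close>

lemma homogeneous_bound:
  assumes scale: "\<And>c f. f \<in> F \<Longrightarrow> p (\<lambda>z. c *\<^sub>C f z) = cmod c * p f"
    and bound: "\<And>f. f \<in> F \<Longrightarrow> N f < \<delta> \<Longrightarrow> p f \<le> B" and "\<delta> > 0" and f: "f \<in> F"
  shows "p f \<le> (2 * B / \<delta>) * N f"
proof (cases "N f = 0")
  case True
  then have "f = (\<lambda>z. 0)"
    using N_eq_0_iff [OF f] by simp
  then have "p f = 0"
    using scale [OF f, of 0] by simp
  with True show ?thesis by simp
next
  case False
  then have pos: "N f > 0"
    using N_nonneg [OF f] by simp
  define t where "t = \<delta> / (2 * N f)"
  have t: "t > 0"
    using pos \<open>\<delta> > 0\<close> by (simp add: t_def)
  have "N (\<lambda>z. of_real t *\<^sub>C f z) = \<delta> / 2"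
    unfolding N_scale [OF f] norm_of_real abs_of_pos [OF t] using pos by (simp add: t_def)
  then have "p (\<lambda>z. of_real t *\<^sub>C f z) \<le> B"
    using \<open>\<delta> > 0\<close> by (intro bound scale_mem f) simp
  then have "t * p f \<le> B"
    using scale [OF f, of "of_real t"] t by simp
  then show ?thesis
    using pos \<open>\<delta> > 0\<close> by (simp add: t_def field_simps)
qed

lemma continuous_map_euclidean_bounded:
  assumes "\<And>f g. f \<in> F \<Longrightarrow> g \<in> F \<Longrightarrow> \<Lambda> (\<lambda>z. f z - g z) = \<Lambda> f - \<Lambda> g"
    and bound: "\<And>f. f \<in> F \<Longrightarrow> norm (\<Lambda> f :: 'b::real_normed_vector) \<le> C * N f"
  shows "continuous_map (norm_topology F N) euclidean \<Lambda>"
proof -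
  interpret m: Metric_space F "norm_dist F N"
    by (rule Metric_space_norm_dist)
  show ?thesis
    unfolding norm_topology_def m.continuous_map_from_metric
  proof (intro conjI ballI allI impI)
    fix f and V :: "'b set" assume f: "f \<in> F" and "openin euclidean V \<and> \<Lambda> f \<in> V"
    then obtain e where e: "e > 0" "ball (\<Lambda> f) e \<subseteq> V"
      by (auto simp: open_contains_ball)
    have "\<Lambda> g \<in> V" if g: "g \<in> F" "norm_dist F N f g < e / (\<bar>C\<bar> + 1)" for g
    proof -
      have d: "(\<lambda>z. f z - g z) \<in> F"
        using f g by (intro diff_mem)
      have "norm (\<Lambda> f - \<Lambda> g) \<le> C * N (\<lambda>z. f z - g z)"
        using bound [OF d] assms(1) f g by simp
      also have "\<dots> \<le> (\<bar>C\<bar> + 1) * N (\<lambda>z. f z - g z)"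
        using N_nonneg [OF d] by (intro mult_right_mono) auto
      also have "\<dots> < e"
        using f g by (simp add: norm_dist_def pos_less_divide_eq mult.commute add_nonneg_pos)
      finally show ?thesis
        using e(2) by (auto simp: dist_norm subset_iff)
    qed
    then show "\<exists>r>0. \<forall>g. g \<in> F \<and> norm_dist F N f g < r \<longrightarrow> \<Lambda> g \<in> V"
      using e(1) by (intro exI [where x = "e / (\<bar>C\<bar> + 1)"]) (auto simp: add_nonneg_pos)
  qed simp
qed

lemma mcomplete_iff:
  "Metric_space.mcomplete F (norm_dist F N) \<longleftrightarrow>
    (\<forall>s :: nat \<Rightarrow> complex \<Rightarrow> 'a. (\<forall>n. s n \<in> F) \<and> (\<forall>e>0. \<exists>K. \<forall>m\<ge>K. \<forall>n\<ge>K. N (\<lambda>z. s m z - s n z) < e) \<longrightarrow>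
      (\<exists>f\<in>F. \<forall>e>0. \<exists>K. \<forall>n\<ge>K. N (\<lambda>z. s n z - f z) < e))"
proof -
  interpret m: Metric_space F "norm_dist F N"
    by (rule Metric_space_norm_dist)
  have 1: "m.MCauchy s \<longleftrightarrow> (\<forall>n. s n \<in> F) \<and> (\<forall>e>0. \<exists>K. \<forall>m\<ge>K. \<forall>n\<ge>K. N (\<lambda>z. s m z - s n z) < e)" for s
    unfolding m.MCauchy_def by (auto simp: norm_dist_def image_subset_iff)
  have 2: "limitin m.mtopology s f sequentially \<longleftrightarrow>
      f \<in> F \<and> (\<forall>e>0. \<exists>K. \<forall>n\<ge>K. N (\<lambda>z. s n z - f z) < e)" if "\<forall>n. s n \<in> F" for s f
    using that unfolding m.limitin_metric eventually_sequentially by (auto simp: norm_dist_def)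
  have "((\<forall>n. s n \<in> F) \<and> (\<forall>e>0. \<exists>K. \<forall>m\<ge>K. \<forall>n\<ge>K. N (\<lambda>z. s m z - s n z) < e) \<longrightarrow>
      (\<exists>f. limitin m.mtopology s f sequentially)) \<longleftrightarrow>
    ((\<forall>n. s n \<in> F) \<and> (\<forall>e>0. \<exists>K. \<forall>m\<ge>K. \<forall>n\<ge>K. N (\<lambda>z. s m z - s n z) < e) \<longrightarrow>
      (\<exists>f\<in>F. \<forall>e>0. \<exists>K. \<forall>n\<ge>K. N (\<lambda>z. s n z - f z) < e))" for s :: "nat \<Rightarrow> complex \<Rightarrow> 'a"
    using 2 [of s] by blast
  then show ?thesis
    unfolding m.mcomplete_def 1 by presburger
qed

end

sublocale banach_space_of_analytic_functions \<subseteq> normed_function_space F N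
  by unfold_locales (rule zero_mem add_mem scale_mem N_nonneg N_eq_0_iff N_add_le N_scale; assumption)+

section \<open>Boundedness of evaluations and multipliers\<close>

context acceptable_space
begin

lemma mem_analytic: "f \<in> F \<Longrightarrow> f \<in> analytic_funs U"
  using analytic by blast

lemma mem_vec_holomorphic: "f \<in> F \<Longrightarrow> f vec_holomorphic_on U"
  using mem_analytic by (simp add: analytic_funs_iff)

text \<open>Uniform boundedness: the evaluations at the points of a compact set are pointwise bounded on \<open>F\<close>.\<close>

lemma evaluation_bound_compact:
  assumes "compact K" "K \<subseteq> U" "K \<noteq> {}"
  obtains C where "\<And>f z. f \<in> F \<Longrightarrow> z \<in> K \<Longrightarrow> norm (f z) \<le> C * N f"
proof -
  interpret m: Metric_space F "norm_dist F N"
    by (rule Metric_space_norm_dist)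
  define S where "S = (\<lambda>k :: nat. {f \<in> F. \<forall>z\<in>K. norm (f z) \<le> real k})"
  have closed: "closedin m.mtopology (S k)" for k
  proof -
    have "closedin m.mtopology {f \<in> F. norm (f z) \<le> real k}" if "z \<in> K" for z
    proof -
      have "continuous_map m.mtopology euclidean (\<lambda>f. f z)"
        using eval_continuous [of z] that assms unfolding norm_topology_def by blast
      from closedin_continuous_map_preimage [OF this, of "cball 0 (real k)"] show ?thesis
        by simp
    qed
    then have "closedin m.mtopology (\<Inter>z\<in>K. {f \<in> F. norm (f z) \<le> real k})"
      using assms by (intro closedin_INT) auto
    also have "(\<Inter>z\<in>K. {f \<in> F. norm (f z) \<le> real k}) = S k"
      using assms by (auto simp: S_def)
    finally show ?thesis .
  qed
  have "\<Union>(range S) = F"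
  proof
    show "F \<subseteq> \<Union>(range S)"
    proof
      fix f assume f: "f \<in> F"
      have "compact (f ` K)"
        using vec_holomorphic_imp_continuous_on [OF mem_vec_holomorphic [OF f]] assms
        by (intro compact_continuous_image) (auto intro: continuous_on_subset)
      then obtain B where B: "\<And>z. z \<in> K \<Longrightarrow> norm (f z) \<le> B"
        using compact_imp_bounded bounded_iff by (metis imageI)
      then have "f \<in> S (nat \<lceil>B\<rceil>)"
        using f by (auto simp: S_def intro: order_trans [OF _ real_nat_ceiling_ge])
      then show "f \<in> \<Union>(range S)" by blast
    qed
  qed (auto simp: S_def)
  \<comment> \<open>The closed sets \<open>S k\<close> exhaust a complete space, so by Baire's
    theorem one of them has an interior point.\<close>
  then have "m.mtopology interior_of \<Union>(range S) \<noteq> {}"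
    using zero_mem interior_of_topspace [of m.mtopology] by auto
  then obtain k where "m.mtopology interior_of (S k) \<noteq> {}"
    using m.metric_Baire_category_alt [OF complete countable_image [OF countableI_type], of S UNIV] closed
    by blast
  then obtain f0 where "f0 \<in> m.mtopology interior_of (S k)"
    by blast
  then obtain \<delta> where "\<delta> > 0" "m.mball f0 \<delta> \<subseteq> m.mtopology interior_of (S k)"
    using openin_interior_of [of m.mtopology "S k"] unfolding m.openin_mtopology by blast
  then have \<delta>: "\<delta> > 0" "m.mball f0 \<delta> \<subseteq> S k"
    using interior_of_subset [of m.mtopology "S k"] by auto
  have f0: "f0 \<in> S k"
    using \<open>f0 \<in> m.mtopology interior_of (S k)\<close> interior_of_subset by fastforce
  then have "f0 \<in> F"
    by (simp add: S_def)
  \<comment> \<open>Subtracting the centre \<open>f0\<close> moves the ball to the origin and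
    doubles the bound.\<close>
  have small: "norm (f z) \<le> 2 * real k" if "f \<in> F" "N f < \<delta>" "z \<in> K" for f z
  proof -
    have mem: "(\<lambda>z. f0 z + f z) \<in> F"
      using \<open>f0 \<in> F\<close> that by (intro add_mem)
    have "norm_dist F N f0 (\<lambda>z. f0 z + f z) = N f"
      using \<open>f0 \<in> F\<close> mem that N_diff_commute [OF zero_mem that(1)] by (simp add: norm_dist_def)
    then have "(\<lambda>z. f0 z + f z) \<in> S k"
      using \<delta>(2) \<open>f0 \<in> F\<close> mem that by (auto simp: subset_iff)
    then have "norm (f0 z + f z) \<le> real k" "norm (f0 z) \<le> real k"
      using f0 that by (auto simp: S_def)
    then show ?thesis
      using norm_triangle_ineq4 [of "f0 z + f z" "f0 z"] by simp
  qed
  show thesis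
  proof
    fix f z assume "f \<in> F" "z \<in> K"
    then show "norm (f z) \<le> (2 * (2 * real k) / \<delta>) * N f"
      using small \<delta>(1) by (intro homogeneous_bound [where p = "\<lambda>f. norm (f z)"]) (auto simp: norm_scaleC)
  qed
qed

lemma vec_coeff_at_bounded:
  assumes "open U" "u \<in> U"
  obtains C where "C \<ge> 0" "\<And>f. f \<in> F \<Longrightarrow> norm (vec_coeff_at k f u) \<le> C * N f"
proof -
  obtain r where r: "r > 0" "cball u r \<subseteq> U"
    using assms open_contains_cball by blast
  moreover have "cball u r \<noteq> {}"
    using r by simp
  ultimately obtain C where C: "\<And>f z. f \<in> F \<Longrightarrow> z \<in> cball u r \<Longrightarrow> norm (f z) \<le> C * N f"
    using evaluation_bound_compact [OF compact_cball] by blast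
  show thesis
  proof
    show "0 \<le> \<bar>C\<bar> / r ^ k"
      using r by simp
    fix f assume f: "f \<in> F"
    have "norm (f z) \<le> \<bar>C\<bar> * N f" if "z \<in> cball u r" for z
      using C [OF f that] N_nonneg [OF f] by (meson abs_ge_self mult_right_mono order_trans)
    then have "norm (vec_coeff_at k f u) \<le> \<bar>C\<bar> * N f / r ^ k"
      using r assms(1) by (intro vec_coeff_at_bound [where U = U] mem_vec_holomorphic [OF f])
    then show "norm (vec_coeff_at k f u) \<le> \<bar>C\<bar> / r ^ k * N f"
      by simp
  qed
qed

text \<open>For fixed \<open>a\<close>, joint continuity makes multiplication by \<open>a\<close>
  continuous at the zero function, and homogeneity turns this into a bound.\<close>

lemma module_bounded:
  assumes \<psi>: "conformal_equiv \<psi> U unit_disc" and a: "a \<in> Ainf_on U \<psi>"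
  obtains C where "C \<ge> 0" "\<And>f. f \<in> F \<Longrightarrow> N (\<lambda>z. a z *\<^sub>C f z) \<le> C * N f"
proof -
  have "continuous_map (norm_topology F N) (prod_topology (Ainf_on_topology U \<psi>) (norm_topology F N)) (\<lambda>f. (a, f))"
    using a topspace_Ainf_on_topology [OF \<psi>] by (simp add: continuous_map_paired)
  from continuous_map_compose [OF this module_continuous [OF \<psi>]]
  have "continuous_map (norm_topology F N) (norm_topology F N) (\<lambda>f z. a z *\<^sub>C f z)"
    by (simp add: o_def)
  then have "\<forall>e>0. \<exists>V. openin (norm_topology F N) V \<and> (\<lambda>z. 0) \<in> V \<and>
      (\<forall>f\<in>V. N (\<lambda>z. a z *\<^sub>C f z - a z *\<^sub>C 0) < e)"
    unfolding continuous_map_into_norm_topology topspace_norm_topology using zero_mem by blast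
  then obtain V where V: "openin (norm_topology F N) V" "(\<lambda>z. 0) \<in> V"
      "\<And>f. f \<in> V \<Longrightarrow> N (\<lambda>z. a z *\<^sub>C f z - a z *\<^sub>C 0) < 1"
    by (meson zero_less_one)
  obtain \<delta> where "\<delta> > 0" "\<And>f. f \<in> F \<Longrightarrow> N (\<lambda>z. f z - 0) < \<delta> \<Longrightarrow> f \<in> V"
    using openin_norm_topologyD [OF V(1,2)] by blast
  then have \<delta>: "\<delta> > 0" "\<And>f. f \<in> F \<Longrightarrow> N f < \<delta> \<Longrightarrow> f \<in> V"
    by simp_all
  have scale: "N (\<lambda>z. a z *\<^sub>C c *\<^sub>C f z) = cmod c * N (\<lambda>z. a z *\<^sub>C f z)" if "f \<in> F" for f c
    using N_scale [OF module_closed [OF \<psi> a that], of c] by (simp add: scaleC_scaleC mult.commute)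
  show thesis
  proof
    show "0 \<le> 2 * 1 / \<delta>"
      using \<delta> by simp
    show "N (\<lambda>z. a z *\<^sub>C f z) \<le> (2 * 1 / \<delta>) * N f" if "f \<in> F" for f
      using \<delta> V(3) that scale
      by (intro homogeneous_bound [where p = "\<lambda>f. N (\<lambda>z. a z *\<^sub>C f z)"]) (auto intro: less_imp_le)
  qed
qed

end

section \<open>Coordinates of an array\<close>

text \<open>The order of the derivative stored at \<open>i\<close>. Arrays list the highest
  derivative first, so the positions count from the end.\<close>

definition tuple_pos :: "'n::{finite,linorder} \<Rightarrow> nat"
  where "tuple_pos i = card {i<..}"

lemma bij_betw_tuple_pos: "bij_betw tuple_pos (UNIV :: 'n::{finite,linorder} set) {..<CARD('n)}"
proof -
  have less: "tuple_pos j < tuple_pos i" if "i < j" for i j :: 'n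
    unfolding tuple_pos_def using that by (intro psubset_card_mono) auto
  have inj: "inj (tuple_pos :: 'n \<Rightarrow> nat)"
    by (rule injI) (metis less less_irrefl neqE)
  have "range (tuple_pos :: 'n \<Rightarrow> nat) \<subseteq> {..<CARD('n)}"
    unfolding tuple_pos_def by (auto intro!: psubset_card_mono)
  moreover have "card (range (tuple_pos :: 'n \<Rightarrow> nat)) = CARD('n)"
    using inj by (rule card_image)
  ultimately have "range (tuple_pos :: 'n \<Rightarrow> nat) = {..<CARD('n)}"
    by (intro card_subset_eq) auto
  with inj show ?thesis
    by (simp add: bij_betw_def)
qed

lemma tuple_pos_less: "tuple_pos (i :: 'n::{finite,linorder}) < CARD('n)"
  using bij_betw_tuple_pos [where 'n = 'n] by (auto simp: bij_betw_def)

lemma tuple_pos_surj: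
  assumes "k < CARD('n)"
  obtains i :: "'n::{finite,linorder}" where "tuple_pos i = k"
  using assms bij_betw_tuple_pos [where 'n = 'n] unfolding bij_betw_def by (metis imageE lessThan_iff)

lemma jet_eq: "jet f z = Tuple (\<lambda>i. vec_coeff_at (tuple_pos i) f z)"
  by (simp add: jet_def vec_coeff_at_def tuple_pos_def Let_def)

lemma analytic_funs_zero: "(\<lambda>z. 0) \<in> analytic_funs U"
  by (simp add: analytic_funs_iff)

lemma analytic_funs_add:
  "f \<in> analytic_funs U \<Longrightarrow> g \<in> analytic_funs U \<Longrightarrow> (\<lambda>z. f z + g z) \<in> analytic_funs U"
  by (simp add: analytic_funs_iff vec_holomorphic_add)

lemma analytic_funs_const_scaleC:
  "f \<in> analytic_funs U \<Longrightarrow> (\<lambda>z. c *\<^sub>C f z) \<in> analytic_funs U"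
  by (simp add: analytic_funs_iff vec_holomorphic_const_scaleC)

lemma analytic_funs_scaleC:
  "a holomorphic_on U \<Longrightarrow> open U \<Longrightarrow> f \<in> analytic_funs U \<Longrightarrow> (\<lambda>z. a z *\<^sub>C f z) \<in> analytic_funs U"
  by (simp add: analytic_funs_iff vec_holomorphic_scaleC)

lemma analytic_funs_sum:
  "(\<And>i. i \<in> I \<Longrightarrow> f i \<in> analytic_funs U) \<Longrightarrow> (\<lambda>z. \<Sum>i\<in>I. f i z) \<in> analytic_funs U"
  by (simp add: analytic_funs_iff vec_holomorphic_sum)

context local_coordinate
begin

definition assemble ::
    "(nat \<Rightarrow> complex \<Rightarrow> 'a::complex_banach) \<Rightarrow> complex \<Rightarrow> ('a, 'n::{finite,linorder}) tuple"
  where "assemble g = zero_ext U (\<lambda>u. Tuple (\<lambda>i. array_coeff (tuple_pos i) g u))"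

text \<open>Coordinates are indexed by all natural numbers. The choice determines them for
  \<open>k < CARD('n)\<close> when \<open>G\<close> is analytic, whereas from
  \<open>CARD('n)\<close> on they are arbitrary analytic functions, which do not enter the
  array.\<close>

definition coords ::
    "(complex \<Rightarrow> ('a::complex_banach, 'n::{finite,linorder}) tuple) \<Rightarrow> nat \<Rightarrow> complex \<Rightarrow> 'a"
  where "coords G = (SOME g. (\<forall>k. g k \<in> analytic_funs U) \<and> assemble g = G)"

lemma entry_assemble:
  "entry (assemble g u) i = (if u \<in> U then array_coeff (tuple_pos i) g u else 0)"
  by (simp add: assemble_def zero_ext_def)

lemma assemble_analytic:
  fixes g :: "nat \<Rightarrow> complex \<Rightarrow> 'a::complex_banach"
  assumes "\<And>k. k < CARD('n::{finite,linorder}) \<Longrightarrow> g k \<in> analytic_funs U"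
  shows "(assemble g :: complex \<Rightarrow> ('a, 'n) tuple) \<in> analytic_funs U"
  unfolding analytic_funs_tuple_iff entry_assemble
proof
  fix i :: 'n
  have "array_coeff (tuple_pos i) g vec_holomorphic_on U"
    using assms le_less_trans [OF _ tuple_pos_less]
    by (intro vec_holomorphic_array_coeff) (auto simp: analytic_funs_iff)
  then show "(\<lambda>z. if z \<in> U then array_coeff (tuple_pos i) g z else 0) \<in> analytic_funs U"
    using vec_holomorphic_cong [OF open_U, of "array_coeff (tuple_pos i) g"
        "\<lambda>z. if z \<in> U then array_coeff (tuple_pos i) g z else 0"]
    by (simp add: analytic_funs_iff)
qed

lemma assemble_surj:
  fixes G :: "complex \<Rightarrow> ('a::complex_banach, 'n::{finite,linorder}) tuple"
  assumes G: "G \<in> analytic_funs U"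
  shows "\<exists>g. (\<forall>k. g k \<in> analytic_funs U) \<and> assemble g = G"
proof -
  define H where "H k = (\<lambda>z. entry (G z) (inv tuple_pos k))" for k
  have "H k vec_holomorphic_on U" for k
    using G unfolding H_def analytic_funs_tuple_iff analytic_funs_iff by blast
  then obtain g where g: "\<And>k. g k \<in> analytic_funs U"
      "\<And>k u. k < CARD('n) \<Longrightarrow> u \<in> U \<Longrightarrow> array_coeff k g u = H k u"
    using array_coeff_surj [of "CARD('n)" H] by metis
  have inv: "inv tuple_pos (tuple_pos i) = i" for i :: 'n
    using bij_betw_tuple_pos [where 'n = 'n] by (auto simp: bij_betw_def)
  have "assemble g = G"
    using g(2) G by (auto simp: fun_eq_iff tuple_eq_iff entry_assemble tuple_pos_less H_def inv analytic_funs_iff)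
  with g show ?thesis by blast
qed

lemma coords_analytic:
  fixes G :: "complex \<Rightarrow> ('a::complex_banach, 'n::{finite,linorder}) tuple"
  assumes "G \<in> analytic_funs U"
  shows "coords G k \<in> analytic_funs U" and "assemble (coords G) = G"
  using someI_ex [OF assemble_surj [OF assms]] by (simp_all add: coords_def)

lemma assemble_add:
  fixes f g :: "nat \<Rightarrow> complex \<Rightarrow> 'a::complex_banach"
  assumes f: "\<And>k. k < CARD('n::{finite,linorder}) \<Longrightarrow> f k \<in> analytic_funs U"
    and g: "\<And>k. k < CARD('n) \<Longrightarrow> g k \<in> analytic_funs U"
  shows "(assemble (\<lambda>k z. f k z + g k z) :: complex \<Rightarrow> ('a, 'n) tuple) = (\<lambda>z. assemble f z + assemble g z)"
  using assms le_less_trans [OF _ tuple_pos_less [where 'n = 'n]]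
  by (auto simp: fun_eq_iff tuple_eq_iff entry_assemble analytic_funs_iff intro!: array_coeff_add)

lemma assemble_const_scaleC:
  fixes f :: "nat \<Rightarrow> complex \<Rightarrow> 'a::complex_banach"
  assumes f: "\<And>k. k < CARD('n::{finite,linorder}) \<Longrightarrow> f k \<in> analytic_funs U"
  shows "(assemble (\<lambda>k z. c *\<^sub>C f k z) :: complex \<Rightarrow> ('a, 'n) tuple) = (\<lambda>z. c *\<^sub>C assemble f z)"
  using assms le_less_trans [OF _ tuple_pos_less [where 'n = 'n]]
  by (auto simp: fun_eq_iff tuple_eq_iff entry_assemble analytic_funs_iff intro!: array_coeff_const_scaleC)

lemma coords_assemble:
  fixes g :: "nat \<Rightarrow> complex \<Rightarrow> 'a::complex_banach"
  assumes g: "\<And>k. k < CARD('n::{finite,linorder}) \<Longrightarrow> g k \<in> analytic_funs U" and "k < CARD('n)"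
  shows "coords (assemble g :: complex \<Rightarrow> ('a, 'n) tuple) k = g k"
proof -
  let ?G = "assemble g :: complex \<Rightarrow> ('a, 'n) tuple"
  define h where "h = coords ?G"
  have "?G \<in> analytic_funs U"
    using g by (rule assemble_analytic)
  then have h: "h j \<in> analytic_funs U" "assemble h = ?G" for j
    unfolding h_def by (simp_all add: coords_analytic)
  \<comment> \<open>Two families with the same array differ by a family whose array is zero; the
    triangular equations force it to vanish below \<open>CARD('n)\<close>.\<close>
  define d where "d j = (\<lambda>z. h j z + (- 1) *\<^sub>C g j z)" for j
  have "array_coeff j d u = 0" if "j < CARD('n)" "u \<in> U" for j u
  proof -
    obtain i :: 'n where i: "tuple_pos i = j"
      using tuple_pos_surj \<open>j < CARD('n)\<close> by blast
    have g': "g l vec_holomorphic_on U" if "l \<le> j" for l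
      using g [of l] that \<open>j < CARD('n)\<close> by (simp add: analytic_funs_iff)
    have "array_coeff j d u = array_coeff j h u + (- 1) *\<^sub>C array_coeff j g u"
      unfolding d_def using h that g'
      by (subst array_coeff_add, simp_all add: analytic_funs_iff vec_holomorphic_const_scaleC
          array_coeff_const_scaleC)
    also have "array_coeff j h u = array_coeff j g u"
      using entry_assemble [of h u i] entry_assemble [of g u i] h(2) i that by simp
    finally show ?thesis
      by (simp add: scaleC_minus1)
  qed
  moreover have "d j \<in> analytic_funs U" if "j < CARD('n)" for j
    unfolding d_def using h g that by (intro analytic_funs_add analytic_funs_const_scaleC)
  ultimately have "d k = (\<lambda>z. 0)"
    using assms by (intro array_coeff_inj [where n = "CARD('n)"])
  then show ?thesis
    by (simp add: d_def h_def fun_eq_iff scaleC_minus1)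
qed

lemma coords_add:
  fixes G H :: "complex \<Rightarrow> ('a::complex_banach, 'n::{finite,linorder}) tuple"
  assumes "G \<in> analytic_funs U" "H \<in> analytic_funs U" "k < CARD('n)"
  shows "coords (\<lambda>z. G z + H z) k = (\<lambda>z. coords G k z + coords H k z)"
proof -
  have "coords (assemble (\<lambda>k z. coords G k z + coords H k z) :: complex \<Rightarrow> ('a, 'n) tuple) k
      = (\<lambda>z. coords G k z + coords H k z)"
    by (rule coords_assemble) (simp_all add: analytic_funs_add coords_analytic assms)
  then show ?thesis
    by (simp add: assemble_add coords_analytic assms)
qed

lemma coords_const_scaleC:
  fixes G :: "complex \<Rightarrow> ('a::complex_banach, 'n::{finite,linorder}) tuple"
  assumes "G \<in> analytic_funs U" "k < CARD('n)"
  shows "coords (\<lambda>z. c *\<^sub>C G z) k = (\<lambda>z. c *\<^sub>C coords G k z)"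
proof -
  have "coords (assemble (\<lambda>k z. c *\<^sub>C coords G k z) :: complex \<Rightarrow> ('a, 'n) tuple) k
      = (\<lambda>z. c *\<^sub>C coords G k z)"
    by (rule coords_assemble) (simp_all add: analytic_funs_const_scaleC coords_analytic assms)
  then show ?thesis
    by (simp add: assemble_const_scaleC coords_analytic assms)
qed

lemma coords_diff:
  fixes G H :: "complex \<Rightarrow> ('a::complex_banach, 'n::{finite,linorder}) tuple"
  assumes "G \<in> analytic_funs U" "H \<in> analytic_funs U" "k < CARD('n)"
  shows "coords (\<lambda>z. G z - H z) k = (\<lambda>z. coords G k z - coords H k z)"
  using coords_add [OF assms(1) analytic_funs_const_scaleC [OF assms(2), of "- 1"] assms(3)]
    coords_const_scaleC [OF assms(2,3), of "- 1"]
  by (simp add: scaleC_minus1)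

lemma coords_zero:
  assumes "k < CARD('n::{finite,linorder})"
  shows "coords (\<lambda>z. 0 :: ('a::complex_banach, 'n) tuple) k = (\<lambda>z. 0)"
  using coords_const_scaleC [OF analytic_funs_zero assms, of 0] by simp

lemma coords_eq_zero:
  fixes G :: "complex \<Rightarrow> ('a::complex_banach, 'n::{finite,linorder}) tuple"
  assumes G: "G \<in> analytic_funs U" and 0: "\<And>k. k < CARD('n) \<Longrightarrow> coords G k = (\<lambda>z. 0)"
  shows "G = (\<lambda>z. 0)"
proof
  fix u
  have "array_coeff (tuple_pos i) (coords G) u = 0" for i :: 'n
    using 0 le_less_trans [OF _ tuple_pos_less [of i]] by (simp add: array_coeff_def)
  then have "assemble (coords G) u = (0 :: ('a, 'n) tuple)"
    by (simp add: tuple_eq_iff entry_assemble)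
  then show "G u = 0"
    using coords_analytic(2) [OF G] by simp
qed

text \<open>The family on the right assembles to the product of \<open>A 0\<close> and
  \<open>G\<close>, so by uniqueness of coordinates it is the family of that product.\<close>

lemma coords_scaleC:
  fixes G :: "complex \<Rightarrow> ('a::complex_banach, 'n::{finite,linorder}) tuple"
  assumes A: "\<And>i z. z \<in> U \<Longrightarrow> (A i has_field_derivative of_nat (Suc i) * deriv \<psi> z * A (Suc i) z) (at z)"
    and G: "G \<in> analytic_funs U" and "k < CARD('n)"
  shows "coords (\<lambda>z. A 0 z *\<^sub>C G z) k = (\<lambda>z. \<Sum>i\<le>k. (- 1) ^ i *\<^sub>C A i z *\<^sub>C coords G (k - i) z)"
proof -
  define h where "h l = (\<lambda>z. \<Sum>i\<le>l. (- 1) ^ i *\<^sub>C A i z *\<^sub>C coords G (l - i) z)" for l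
  have holA: "A i holomorphic_on U" for i
    using A by (rule holomorphic_on_DERIV)
  have h: "h l \<in> analytic_funs U" for l
    unfolding h_def using coords_analytic(1) [OF G] holA open_U
    by (intro analytic_funs_sum analytic_funs_const_scaleC analytic_funs_scaleC)
  have "assemble h = (\<lambda>z. A 0 z *\<^sub>C G z)"
  proof
    fix u
    show "assemble h u = A 0 u *\<^sub>C G u"
    proof (cases "u \<in> U")
      case True
      have "array_coeff m h u = A 0 u *\<^sub>C array_coeff m (coords G) u" for m
        unfolding h_def using coords_analytic(1) [OF G] True
        by (intro scaleC_array_coeff [OF A, symmetric]) (auto simp: analytic_funs_iff)
      then have "assemble h u = A 0 u *\<^sub>C (assemble (coords G) u :: ('a, 'n) tuple)"
        by (simp add: tuple_eq_iff entry_assemble True)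
      then show ?thesis
        using coords_analytic(2) [OF G] by simp
    next
      case False
      then show ?thesis
        using G by (simp add: assemble_def zero_ext_def analytic_funs_iff)
    qed
  qed
  then show ?thesis
    using coords_assemble [where 'n = 'n and g = h, OF h \<open>k < CARD('n)\<close>] by (simp add: h_def)
qed

text \<open>The function whose jet is taken depends on \<open>u\<close>. At each single point the
  value of an array is thus the jet of one combination of its coordinates, although no fixed
  function need work at all points.\<close>

lemma assemble_eq_jet:
  fixes g :: "nat \<Rightarrow> complex \<Rightarrow> 'a::complex_banach"
  assumes g: "\<And>k. k < CARD('n::{finite,linorder}) \<Longrightarrow> g k \<in> analytic_funs U" and u: "u \<in> U"
  shows "(assemble g u :: ('a, 'n) tuple) = jet (\<lambda>z. \<Sum>j<CARD('n). (\<psi> z - \<psi> u) ^ j *\<^sub>C g j z) u"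
  unfolding tuple_eq_iff
proof
  fix i :: 'n
  define k where "k = tuple_pos i"
  have k: "k < CARD('n)"
    by (simp add: k_def tuple_pos_less)
  have "vec_coeff_at k (\<lambda>z. \<Sum>j<CARD('n). (\<psi> z - \<psi> u) ^ j *\<^sub>C g j z) u
      = (\<Sum>j<CARD('n). shifted_coeff k j (g j) u)"
    unfolding shifted_coeff_def using g u
    by (intro vec_coeff_at_sum [OF open_U] vec_holomorphic_shift) (auto simp: analytic_funs_iff)
  also have "\<dots> = array_coeff k g u"
    unfolding array_coeff_def using g u k
    by (intro sum.mono_neutral_right) (auto simp: analytic_funs_iff intro!: shifted_coeff_less)
  finally show "entry (assemble g u) i = entry (jet (\<lambda>z. \<Sum>j<CARD('n). (\<psi> z - \<psi> u) ^ j *\<^sub>C g j z) u) i"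
    using u by (simp add: entry_assemble jet_eq k_def)
qed

lemma assemble_single:
  fixes f :: "complex \<Rightarrow> 'a::complex_banach"
  assumes f: "f \<in> analytic_funs U"
  shows "(assemble (\<lambda>k. if k = 0 then f else (\<lambda>z. 0)) :: complex \<Rightarrow> ('a, 'n::{finite,linorder}) tuple)
    = zero_ext U (jet f)"
proof -
  have "array_coeff k (\<lambda>k. if k = 0 then f else (\<lambda>z. 0)) u = vec_coeff_at k f u" for k u
  proof -
    have "array_coeff k (\<lambda>k. if k = 0 then f else (\<lambda>z. 0)) u
        = (\<Sum>j\<in>{0}. shifted_coeff k j (if j = 0 then f else (\<lambda>z. 0)) u)"
      unfolding array_coeff_def by (rule sum.mono_neutral_right) auto
    then show ?thesis
      by (simp add: shifted_coeff_0)
  qed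
  then show ?thesis
    by (simp add: assemble_def zero_ext_def jet_eq fun_eq_iff)
qed

end

section \<open>The space of arrays\<close>

text \<open>Only the construction uses this particular \<open>\<psi>\<close>; the axioms to be
  verified still range over every conformal equivalence, called \<open>\<theta>\<close>
  below.\<close>

locale coordinate_acceptable_space = acceptable_space U F N
  for U and F :: "(complex \<Rightarrow> 'a::complex_banach) set" and N +
  fixes \<psi> :: "complex \<Rightarrow> complex"
  assumes open_domain: "open U" and conformal_\<psi>: "conformal_equiv \<psi> U unit_disc"

sublocale coordinate_acceptable_space \<subseteq> local_coordinate U \<psi>
proof
  show "open U"
    by (rule open_domain)
  show "\<psi> holomorphic_on U"
    by (rule conformal_equivD [OF conformal_\<psi>])
  show "deriv \<psi> z \<noteq> 0" if "z \<in> U" for z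
    using conformal_equivD(1,2) [OF conformal_\<psi>] open_domain that
    by (intro holomorphic_injective_imp_regular)
qed

context coordinate_acceptable_space
begin

text \<open>The coordinate map identifies this with the \<open>CARD('n)\<close>-fold product of
  \<open>F\<close>.\<close>

definition arrays :: "(complex \<Rightarrow> ('a, 'n::{finite,linorder}) tuple) set"
  where "arrays = {G \<in> analytic_funs U. \<forall>k<CARD('n). coords G k \<in> F}"

definition array_norm :: "(complex \<Rightarrow> ('a, 'n::{finite,linorder}) tuple) \<Rightarrow> real"
  where "array_norm G = (\<Sum>k<CARD('n). N (coords G k))"

lemma arraysD:
  fixes G :: "complex \<Rightarrow> ('a, 'n::{finite,linorder}) tuple"
  assumes "G \<in> arrays"
  shows "G \<in> analytic_funs U" "\<And>k. k < CARD('n) \<Longrightarrow> coords G k \<in> F"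
  using assms by (simp_all add: arrays_def)

lemma N_coords_le:
  fixes G :: "complex \<Rightarrow> ('a, 'n::{finite,linorder}) tuple"
  assumes "G \<in> arrays" "k < CARD('n)"
  shows "N (coords G k) \<le> array_norm G"
  unfolding array_norm_def using assms by (intro member_le_sum) (auto intro: N_nonneg arraysD)

lemma array_norm_nonneg:
  fixes G :: "complex \<Rightarrow> ('a, 'n::{finite,linorder}) tuple"
  shows "G \<in> arrays \<Longrightarrow> 0 \<le> array_norm G"
  unfolding array_norm_def by (intro sum_nonneg N_nonneg arraysD) auto

lemma assemble_mem_arrays:
  fixes g :: "nat \<Rightarrow> complex \<Rightarrow> 'a"
  assumes "\<And>k. k < CARD('n::{finite,linorder}) \<Longrightarrow> g k \<in> F"
  shows "(assemble g :: complex \<Rightarrow> ('a, 'n) tuple) \<in> arrays"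
  using assms by (simp add: arrays_def assemble_analytic coords_assemble mem_analytic)

lemma normed_function_space_arrays:
  "normed_function_space (arrays :: (complex \<Rightarrow> ('a, 'n::{finite,linorder}) tuple) set) array_norm"
proof
  fix f g :: "complex \<Rightarrow> ('a, 'n) tuple" and c :: complex
  show "(\<lambda>z. 0 :: ('a, 'n) tuple) \<in> arrays"
    by (simp add: arrays_def analytic_funs_zero coords_zero zero_mem)
  assume f: "f \<in> arrays"
  show "(\<lambda>z. c *\<^sub>C f z) \<in> arrays"
    using arraysD [OF f] by (simp add: arrays_def analytic_funs_const_scaleC coords_const_scaleC scale_mem)
  show "0 \<le> array_norm f"
    using f by (rule array_norm_nonneg)
  show "array_norm f = 0 \<longleftrightarrow> f = (\<lambda>z. 0)"
  proof
    assume "array_norm f = 0"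
    then have "N (coords f k) = 0" if "k < CARD('n)" for k
      using N_coords_le [OF f that] N_nonneg [OF arraysD(2) [OF f that]] by simp
    then have "coords f k = (\<lambda>z. 0)" if "k < CARD('n)" for k
      using N_eq_0_iff [OF arraysD(2) [OF f that]] that by blast
    then show "f = (\<lambda>z. 0)"
      by (rule coords_eq_zero [OF arraysD(1) [OF f]])
  qed (simp add: array_norm_def coords_zero N_zero)
  show "array_norm (\<lambda>z. c *\<^sub>C f z) = cmod c * array_norm f"
    using arraysD [OF f] by (simp add: array_norm_def coords_const_scaleC N_scale sum_distrib_left)
  assume g: "g \<in> arrays"
  show "(\<lambda>z. f z + g z) \<in> arrays"
    using arraysD [OF f] arraysD [OF g] by (simp add: arrays_def analytic_funs_add coords_add add_mem)
  show "array_norm (\<lambda>z. f z + g z) \<le> array_norm f + array_norm g"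
    unfolding array_norm_def sum.distrib [symmetric] using arraysD [OF f] arraysD [OF g]
    by (intro sum_mono) (simp add: coords_add N_add_le)
qed

lemma array_norm_diff:
  fixes G H :: "complex \<Rightarrow> ('a, 'n::{finite,linorder}) tuple"
  assumes "G \<in> arrays" "H \<in> arrays"
  shows "array_norm (\<lambda>z. G z - H z) = (\<Sum>k<CARD('n). N (\<lambda>z. coords G k z - coords H k z))"
  using assms by (simp add: array_norm_def coords_diff arraysD)

lemma mcomplete_arrays:
  "Metric_space.mcomplete arrays
    (norm_dist (arrays :: (complex \<Rightarrow> ('a, 'n::{finite,linorder}) tuple) set) array_norm)"
proof -
  interpret T: normed_function_space "arrays :: (complex \<Rightarrow> ('a, 'n) tuple) set" array_norm
    by (rule normed_function_space_arrays)
  have F_complete: "\<exists>f\<in>F. \<forall>e>0. \<exists>K. \<forall>n\<ge>K. N (\<lambda>z. s n z - f z) < e"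
    if "\<And>n. s n \<in> F" "\<And>e. e > 0 \<Longrightarrow> \<exists>K. \<forall>m\<ge>K. \<forall>n\<ge>K. N (\<lambda>z. s m z - s n z) < e"
    for s :: "nat \<Rightarrow> complex \<Rightarrow> 'a"
    using complete [unfolded mcomplete_iff, rule_format, of s] that by blast
  show ?thesis
    unfolding T.mcomplete_iff
  proof (intro allI impI, elim conjE)
    fix s :: "nat \<Rightarrow> complex \<Rightarrow> ('a, 'n) tuple"
    assume s: "\<forall>n. s n \<in> arrays"
      and cauchy: "\<forall>e>0. \<exists>K. \<forall>m\<ge>K. \<forall>n\<ge>K. array_norm (\<lambda>z. s m z - s n z) < e"
    have "\<exists>f\<in>F. \<forall>e>0. \<exists>K. \<forall>n\<ge>K. N (\<lambda>z. coords (s n) k z - f z) < e" if k: "k < CARD('n)" for k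
    proof (rule F_complete)
      show "coords (s n) k \<in> F" for n
        using s k by (simp add: arraysD)
      fix e :: real assume "e > 0"
      then obtain K where K: "\<forall>m\<ge>K. \<forall>n\<ge>K. array_norm (\<lambda>z. s m z - s n z) < e"
        using cauchy by blast
      have "N (\<lambda>z. coords (s m) k z - coords (s n) k z) < e" if "m \<ge> K" "n \<ge> K" for m n
      proof -
        have sm: "s m \<in> arrays" and sn: "s n \<in> arrays"
          using s by auto
        have "N (\<lambda>z. coords (s m) k z - coords (s n) k z) \<le> array_norm (\<lambda>z. s m z - s n z)"
          using N_coords_le [OF T.diff_mem [OF sm sn] k]
          by (simp only: coords_diff [OF arraysD(1) [OF sm] arraysD(1) [OF sn] k])
        also have "\<dots> < e"
          using K that by blast
        finally show ?thesis .
      qed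
      then show "\<exists>K. \<forall>m\<ge>K. \<forall>n\<ge>K. N (\<lambda>z. coords (s m) k z - coords (s n) k z) < e"
        by blast
    qed
    then obtain f where f: "\<And>k. k < CARD('n) \<Longrightarrow> f k \<in> F"
      "\<And>k e. k < CARD('n) \<Longrightarrow> e > 0 \<Longrightarrow> \<exists>K. \<forall>n\<ge>K. N (\<lambda>z. coords (s n) k z - f k z) < e"
      by metis
    define G where "G = (assemble f :: complex \<Rightarrow> ('a, 'n) tuple)"
    have G: "G \<in> arrays"
      unfolding G_def using f by (intro assemble_mem_arrays)
    have coords_G: "coords G k = f k" if "k < CARD('n)" for k
      unfolding G_def using f that by (intro coords_assemble) (auto intro: mem_analytic)
    have "\<exists>K. \<forall>n\<ge>K. array_norm (\<lambda>z. s n z - G z) < e" if "e > 0" for e :: real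
    proof -
      have "e / CARD('n) > 0"
        using that by simp
      then have "\<forall>\<^sub>F n in sequentially. \<forall>k\<in>{..<CARD('n)}. N (\<lambda>z. coords (s n) k z - f k z) < e / CARD('n)"
        using f(2) by (intro eventually_ball_finite) (auto simp: eventually_sequentially)
      then obtain K where K: "\<And>n k. n \<ge> K \<Longrightarrow> k < CARD('n) \<Longrightarrow> N (\<lambda>z. coords (s n) k z - f k z) < e / CARD('n)"
        by (auto simp: eventually_sequentially)
      have "array_norm (\<lambda>z. s n z - G z) < e" if "n \<ge> K" for n
      proof -
        have "array_norm (\<lambda>z. s n z - G z) = (\<Sum>k<CARD('n). N (\<lambda>z. coords (s n) k z - f k z))"
          using s G by (simp add: array_norm_diff coords_G)
        also have "\<dots> < of_nat (card {..<CARD('n)}) * (e / CARD('n))"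
          using K that by (intro sum_bounded_above_strict) auto
        finally show ?thesis by simp
      qed
      then show ?thesis by blast
    qed
    with G show "\<exists>f\<in>arrays. \<forall>e>0. \<exists>K. \<forall>n\<ge>K. array_norm (\<lambda>z. s n z - f z) < e"
      by blast
  qed
qed

lemma continuous_map_coords:
  assumes "k < CARD('n::{finite,linorder})"
  shows "continuous_map (norm_topology (arrays :: (complex \<Rightarrow> ('a, 'n) tuple) set) array_norm)
    (norm_topology F N) (\<lambda>G. coords G k)"
proof -
  interpret T: normed_function_space "arrays :: (complex \<Rightarrow> ('a, 'n) tuple) set" array_norm
    by (rule normed_function_space_arrays)
  show ?thesis
    unfolding continuous_map_into_norm_topology T.topspace_norm_topology
  proof (intro conjI ballI allI impI)
    show "(\<lambda>G. coords G k) \<in> (arrays :: (complex \<Rightarrow> ('a, 'n) tuple) set) \<rightarrow> F"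
      using assms arraysD by blast
    fix G :: "complex \<Rightarrow> ('a, 'n) tuple" and e :: real
    assume G: "G \<in> arrays" and "e > 0"
    let ?V = "{H \<in> arrays. array_norm (\<lambda>z. H z - G z) < e}"
    have "N (\<lambda>z. coords H k z - coords G k z) < e" if "H \<in> ?V" for H
      using N_coords_le [OF T.diff_mem, of H G k] assms that G by (simp add: coords_diff arraysD)
    moreover have "G \<in> ?V"
      using G \<open>e > 0\<close> T.N_zero by simp
    ultimately show "\<exists>V. openin (norm_topology arrays array_norm) V \<and> G \<in> V \<and>
        (\<forall>H\<in>V. N (\<lambda>z. coords H k z - coords G k z) < e)"
      using T.openin_norm_ball [OF G, of e] by blast
  qed
qed

lemma continuous_map_into_arrays:
  assumes h: "h \<in> topspace X \<rightarrow> (arrays :: (complex \<Rightarrow> ('a, 'n::{finite,linorder}) tuple) set)"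
    and cont: "\<And>k. k < CARD('n) \<Longrightarrow> continuous_map X (norm_topology F N) (\<lambda>x. coords (h x) k)"
  shows "continuous_map X (norm_topology arrays array_norm) h"
proof -
  interpret T: normed_function_space "arrays :: (complex \<Rightarrow> ('a, 'n) tuple) set" array_norm
    by (rule normed_function_space_arrays)
  show ?thesis
    unfolding T.continuous_map_into_norm_topology
  proof (intro conjI ballI allI impI)
    show "h \<in> topspace X \<rightarrow> arrays"
      by (rule h)
    fix x and e :: real assume x: "x \<in> topspace X" and "e > 0"
    then have "e / CARD('n) > 0"
      by simp
    then have "\<exists>V. openin X V \<and> x \<in> V \<and> (\<forall>y\<in>V. N (\<lambda>z. coords (h y) k z - coords (h x) k z) < e / CARD('n))"
      if "k < CARD('n)" for k
      using cont [OF that, unfolded continuous_map_into_norm_topology, THEN conjunct2] x by blast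
    then obtain V where V: "\<And>k. k < CARD('n) \<Longrightarrow> openin X (V k)" "\<And>k. k < CARD('n) \<Longrightarrow> x \<in> V k"
      "\<And>k y. k < CARD('n) \<Longrightarrow> y \<in> V k \<Longrightarrow> N (\<lambda>z. coords (h y) k z - coords (h x) k z) < e / CARD('n)"
      by metis
    let ?W = "(\<Inter>k\<in>{..<CARD('n)}. V k) \<inter> topspace X"
    have "array_norm (\<lambda>z. h y z - h x z) < e" if y: "y \<in> ?W" for y
    proof -
      have "array_norm (\<lambda>z. h y z - h x z) = (\<Sum>k<CARD('n). N (\<lambda>z. coords (h y) k z - coords (h x) k z))"
        using h x y by (intro array_norm_diff) auto
      also have "\<dots> < of_nat (card {..<CARD('n)}) * (e / CARD('n))"
        using V(3) y by (intro sum_bounded_above_strict) auto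
      finally show ?thesis by simp
    qed
    moreover have "openin X ?W"
      using V(1) by (intro openin_INT) auto
    moreover have "x \<in> ?W"
      using V(2) x by auto
    ultimately show "\<exists>V. openin X V \<and> x \<in> V \<and> (\<forall>y\<in>V. array_norm (\<lambda>z. h y z - h x z) < e)"
      by blast
  qed
qed

section \<open>The module structure\<close>

text \<open>\<open>B i a\<close> is the \<open>i\<close>-th iterate of
  \<open>(1 / \<psi>') d/dz\<close> on \<open>a\<close>. Dividing by \<open>\<psi>'\<close> is not
  visibly an operation of the algebra transported by \<open>\<theta>\<close>; expressing the
  derivation through \<open>\<theta>\<close> makes it one, namely the lift of a quadratic
  derivation.\<close>

lemma iterated_derivatives:
  assumes \<theta>: "conformal_equiv \<theta> U unit_disc"
  obtains B where "\<And>i. continuous_map (Ainf_on_topology U \<theta>) (Ainf_on_topology U \<theta>) (B i)"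
    "\<And>i a. a \<in> Ainf_on U \<theta> \<Longrightarrow> B i a \<in> Ainf_on U \<theta>"
    "\<And>a. a \<in> Ainf_on U \<theta> \<Longrightarrow> B 0 a = a"
    "\<And>i a z. a \<in> Ainf_on U \<theta> \<Longrightarrow> z \<in> U \<Longrightarrow>
      (B i a has_field_derivative deriv \<psi> z * B (Suc i) a z) (at z)"
proof -
  obtain p c where pc: "\<And>z. z \<in> U \<Longrightarrow> deriv \<theta> z = p * (1 + c * \<theta> z)\<^sup>2 * deriv \<psi> z"
    using conformal_equiv_deriv_quadratic [OF open_U conformal_\<psi> \<theta>] by metis
  define L where "L = quadratic_derivation p c"
  have L: "Ainf_operator (L ^^ i)" for i
    unfolding L_def by (intro Ainf_operator_funpow Ainf_operator_quadratic_derivation)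
  define B where "B i = Ainf_lift U \<theta> (L ^^ i)" for i
  show thesis
  proof
    show "continuous_map (Ainf_on_topology U \<theta>) (Ainf_on_topology U \<theta>) (B i)" for i
      unfolding B_def by (rule continuous_map_Ainf_lift [OF \<theta> L])
    show "B i a \<in> Ainf_on U \<theta>" if "a \<in> Ainf_on U \<theta>" for i a
      unfolding B_def by (rule Ainf_lift_mem [OF \<theta> L that])
    show "B 0 a = a" if "a \<in> Ainf_on U \<theta>" for a
      using Ainf_pull_mem(2) [OF \<theta> that] by (simp add: B_def Ainf_lift_def)
    fix i a z assume a: "a \<in> Ainf_on U \<theta>" and z: "z \<in> U"
    define b where "b = (L ^^ i) (Ainf_pull U \<theta> a)"
    have "b \<in> Ainf"
      unfolding b_def by (intro Ainf_operator_mem [OF L] Ainf_pull_mem(1) [OF \<theta> a])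
    then have "(b has_field_derivative deriv b (\<theta> z)) (at (\<theta> z))"
      using Ainf_holomorphic conformal_equivD(4) [OF \<theta> z] by (intro holomorphic_derivI) auto
    moreover have "(\<theta> has_field_derivative deriv \<theta> z) (at z)"
      using conformal_equivD(1) [OF \<theta>] open_U z by (rule holomorphic_derivI)
    ultimately have "((\<lambda>z. b (\<theta> z)) has_field_derivative deriv b (\<theta> z) * deriv \<theta> z) (at z)"
      by (rule DERIV_chain2)
    then have "(B i a has_field_derivative deriv b (\<theta> z) * deriv \<theta> z) (at z)"
      by (rule has_field_derivative_transform_within_open [OF _ open_U z])
        (simp add: B_def Ainf_lift_def zero_ext_def b_def)
    moreover have "B (Suc i) a z = p * (1 + c * \<theta> z)\<^sup>2 * deriv b (\<theta> z)"
      using z conformal_equivD(4) [OF \<theta> z]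
      by (simp add: B_def Ainf_lift_def zero_ext_def L_def quadratic_derivation_def b_def
          power2_eq_square mult_ac)
    then have "deriv b (\<theta> z) * deriv \<theta> z = deriv \<psi> z * B (Suc i) a z"
      by (simp add: pc [OF z] mult_ac)
    ultimately show "(B i a has_field_derivative deriv \<psi> z * B (Suc i) a z) (at z)"
      by simp
  qed
qed

text \<open>Division by \<open>i!\<close> converts the recursion for iterated derivatives into the
  one for Taylor coefficients that \<open>coords_scaleC\<close> expects.\<close>

lemma coords_module:
  fixes G :: "complex \<Rightarrow> ('a, 'n::{finite,linorder}) tuple"
  assumes B: "\<And>i z. z \<in> U \<Longrightarrow> (B i has_field_derivative deriv \<psi> z * B (Suc i) z) (at z)"
    and G: "G \<in> analytic_funs U" and k: "k < CARD('n)"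
  shows "coords (\<lambda>z. B 0 z *\<^sub>C G z) k
    = (\<lambda>z. \<Sum>i\<le>k. ((- 1) ^ i / fact i) *\<^sub>C B i z *\<^sub>C coords G (k - i) z)"
proof -
  define A where "A i z = B i z / fact i" for i z
  have "(A i has_field_derivative of_nat (Suc i) * deriv \<psi> z * A (Suc i) z) (at z)" if "z \<in> U" for i z
  proof -
    have "((\<lambda>z. B i z / fact i) has_field_derivative deriv \<psi> z * B (Suc i) z / fact i) (at z)"
      using B [OF that] by (rule DERIV_cdivide)
    then show ?thesis
      unfolding A_def by (rule DERIV_cong) (simp del: of_nat_Suc)
  qed
  from coords_scaleC [of A, OF this G k] show ?thesis
    by (simp add: A_def scaleC_scaleC)
qed

lemma arrays_module:
  fixes G :: "complex \<Rightarrow> ('a, 'n::{finite,linorder}) tuple"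
  assumes \<theta>: "conformal_equiv \<theta> U unit_disc" and a: "a \<in> Ainf_on U \<theta>" and G: "G \<in> arrays"
  shows "(\<lambda>z. a z *\<^sub>C G z) \<in> arrays"
proof -
  obtain B where B: "\<And>i a. a \<in> Ainf_on U \<theta> \<Longrightarrow> B i a \<in> Ainf_on U \<theta>"
    "\<And>a. a \<in> Ainf_on U \<theta> \<Longrightarrow> B 0 a = a"
    "\<And>i a z. a \<in> Ainf_on U \<theta> \<Longrightarrow> z \<in> U \<Longrightarrow>
      (B i a has_field_derivative deriv \<psi> z * B (Suc i) a z) (at z)"
    using iterated_derivatives [OF \<theta>] by metis
  note B = B [OF a]
  have "coords (\<lambda>z. a z *\<^sub>C G z) k \<in> F" if "k < CARD('n)" for k
    using coords_module [of "\<lambda>i. B i a", OF B(3) arraysD(1) [OF G] that] B(2) that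
    by (simp add: sum_mem scale_mem module_closed [OF \<theta> B(1)] arraysD(2) [OF G])
  moreover have "a holomorphic_on U"
    using B(3) [of _ 0] unfolding B(2) by (rule holomorphic_on_DERIV)
  then have "(\<lambda>z. a z *\<^sub>C G z) \<in> analytic_funs U"
    using open_U arraysD(1) [OF G] by (rule analytic_funs_scaleC)
  ultimately show ?thesis
    by (simp add: arrays_def)
qed

text \<open>Every coordinate of the product is a finite combination of products in \<open>F\<close>,
  whose factors depend continuously on \<open>a\<close> through \<open>B i\<close> and on
  \<open>G\<close> through its coordinates.\<close>

lemma arrays_module_continuous:
  assumes \<theta>: "conformal_equiv \<theta> U unit_disc"
  shows "continuous_map (prod_topology (Ainf_on_topology U \<theta>)
      (norm_topology (arrays :: (complex \<Rightarrow> ('a, 'n::{finite,linorder}) tuple) set) array_norm))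
    (norm_topology arrays array_norm) (\<lambda>(a, G). \<lambda>z. a z *\<^sub>C G z)"
    (is "continuous_map ?X _ _")
proof -
  interpret T: normed_function_space "arrays :: (complex \<Rightarrow> ('a, 'n) tuple) set" array_norm
    by (rule normed_function_space_arrays)
  obtain B where B_cont: "\<And>i. continuous_map (Ainf_on_topology U \<theta>) (Ainf_on_topology U \<theta>) (B i)"
    and B: "\<And>a. a \<in> Ainf_on U \<theta> \<Longrightarrow> B 0 a = a"
      "\<And>i a z. a \<in> Ainf_on U \<theta> \<Longrightarrow> z \<in> U \<Longrightarrow>
        (B i a has_field_derivative deriv \<psi> z * B (Suc i) a z) (at z)"
    using iterated_derivatives [OF \<theta>] by metis
  have top: "topspace ?X = Ainf_on U \<theta> \<times> arrays"
    by (simp add: topspace_Ainf_on_topology [OF \<theta>])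
  show ?thesis
  proof (rule continuous_map_into_arrays)
    show "(\<lambda>(a, G). \<lambda>z. a z *\<^sub>C G z) \<in> topspace ?X \<rightarrow> arrays"
      unfolding top by (auto intro: arrays_module [OF \<theta>])
    fix k assume k: "k < CARD('n)"
    have "continuous_map ?X (norm_topology F N) (\<lambda>x z. B i (fst x) z *\<^sub>C coords (snd x) (k - i) z)" for i
    proof -
      have "continuous_map ?X (Ainf_on_topology U \<theta>) (\<lambda>x. B i (fst x))"
        using continuous_map_compose [OF continuous_map_fst B_cont] by (simp add: o_def)
      moreover have "k - i < CARD('n)"
        using k by simp
      then have "continuous_map ?X (norm_topology F N) (\<lambda>x. coords (snd x) (k - i))"
        using continuous_map_compose [OF continuous_map_snd continuous_map_coords] by (simp add: o_def)
      ultimately have "continuous_map ?X (prod_topology (Ainf_on_topology U \<theta>) (norm_topology F N))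
          (\<lambda>x. (B i (fst x), coords (snd x) (k - i)))"
        by (rule continuous_map_pairedI)
      from continuous_map_compose [OF this module_continuous [OF \<theta>]] show ?thesis
        by (simp add: o_def)
    qed
    then have "continuous_map ?X (norm_topology F N)
        (\<lambda>x z. \<Sum>i\<le>k. ((- 1) ^ i / fact i) *\<^sub>C B i (fst x) z *\<^sub>C coords (snd x) (k - i) z)"
      by (intro continuous_map_norm_sum continuous_map_norm_scale)
    then show "continuous_map ?X (norm_topology F N) (\<lambda>x. coords ((\<lambda>(a, G). \<lambda>z. a z *\<^sub>C G z) x) k)"
    proof (rule continuous_map_eq)
      fix x assume "x \<in> topspace ?X"
      then obtain a G where x: "x = (a, G)" "a \<in> Ainf_on U \<theta>" "G \<in> arrays"
        unfolding top by blast
      from coords_module [of "\<lambda>i. B i a", OF B(2) [OF x(2)] arraysD(1) [OF x(3)] k]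
      show "(\<lambda>z. \<Sum>i\<le>k. ((- 1) ^ i / fact i) *\<^sub>C B i (fst x) z *\<^sub>C coords (snd x) (k - i) z)
          = coords ((\<lambda>(a, G). \<lambda>z. a z *\<^sub>C G z) x) k"
        by (simp add: x(1) B(1) [OF x(2)])
    qed
  qed
qed

section \<open>Multiplication by a conformal equivalence\<close>

lemma conformal_mem_Ainf_on: "zero_ext U \<theta> \<in> Ainf_on U \<theta>" if "conformal_equiv \<theta> U unit_disc" for \<theta>
proof -
  have "zero_ext U \<theta> = zero_ext U (disc_coordinate \<circ> \<theta>)"
    using conformal_equivD(4) [OF that] by (auto simp: zero_ext_def disc_coordinate_def fun_eq_iff)
  then show ?thesis
    unfolding Ainf_on_def using disc_coordinate_in_Ainf by blast
qed

text \<open>The equivalence \<open>\<theta>\<close> may have any values off \<open>U\<close>, while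
  members of the algebra vanish there. The two multiplications agree because \<open>f\<close>
  vanishes off \<open>U\<close>.\<close>

lemma zero_ext_scaleC_analytic:
  "f \<in> analytic_funs U \<Longrightarrow> (\<lambda>z. zero_ext U \<theta> z *\<^sub>C f z) = (\<lambda>z. \<theta> z *\<^sub>C f z)"
  by (auto simp: fun_eq_iff zero_ext_def analytic_funs_iff)

text \<open>
  Multiplication by \<open>\<theta>\<close> is a triangular operator on the coordinates whose diagonal entries are
  multiplication by \<open>\<theta>\<close> on \<open>F\<close>, which is invertible onto the functions divisible by \<open>\<theta>\<close>.
\<close>

lemma arrays_conformal_mult:
  assumes \<theta>: "conformal_equiv \<theta> U unit_disc"
  shows "\<exists>K>0. \<forall>G\<in>analytic_funs U :: (complex \<Rightarrow> ('a, 'n::{finite,linorder}) tuple) set.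
    ((\<lambda>z. \<theta> z *\<^sub>C G z) \<in> arrays \<longleftrightarrow> G \<in> arrays) \<and>
    (G \<in> arrays \<longrightarrow> inverse K * array_norm (\<lambda>z. \<theta> z *\<^sub>C G z) \<le> array_norm G \<and>
      array_norm G \<le> K * array_norm (\<lambda>z. \<theta> z *\<^sub>C G z))"
proof -
  let ?a = "zero_ext U \<theta>"
  have a: "?a \<in> Ainf_on U \<theta>"
    using \<theta> by (rule conformal_mem_Ainf_on)
  obtain B' where B': "\<And>i a. a \<in> Ainf_on U \<theta> \<Longrightarrow> B' i a \<in> Ainf_on U \<theta>"
    "\<And>a. a \<in> Ainf_on U \<theta> \<Longrightarrow> B' 0 a = a"
    "\<And>i a z. a \<in> Ainf_on U \<theta> \<Longrightarrow> z \<in> U \<Longrightarrow>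
      (B' i a has_field_derivative deriv \<psi> z * B' (Suc i) a z) (at z)"
    using iterated_derivatives [OF \<theta>] by metis
  define B where "B i = B' i ?a" for i
  have B: "\<And>i. B i \<in> Ainf_on U \<theta>" "B 0 = ?a"
    "\<And>i z. z \<in> U \<Longrightarrow> (B i has_field_derivative deriv \<psi> z * B (Suc i) z) (at z)"
    unfolding B_def by (fact B' [OF a])+
  define c :: "nat \<Rightarrow> complex" where "c i = (- 1) ^ i / fact i" for i
  have coords_mult: "coords (\<lambda>z. \<theta> z *\<^sub>C G z) k = (\<lambda>z. \<Sum>i\<le>k. c i *\<^sub>C B i z *\<^sub>C coords G (k - i) z)"
    if "G \<in> analytic_funs U" "k < CARD('n)" for G :: "complex \<Rightarrow> ('a, 'n) tuple" and k
    using coords_module [of B, OF B(3) that] unfolding B(2) c_def zero_ext_scaleC_analytic [OF that(1)] .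
  have split: "(\<Sum>i\<le>k. c i *\<^sub>C B i z *\<^sub>C coords G (k - i) z)
      = \<theta> z *\<^sub>C coords G k z + (\<Sum>i\<in>{1..k}. c i *\<^sub>C B i z *\<^sub>C coords G (k - i) z)"
    if "G \<in> analytic_funs U" for G :: "complex \<Rightarrow> ('a, 'n) tuple" and k z
  proof -
    have "{..k} = insert 0 {1..k}"
      by auto
    moreover have "?a z *\<^sub>C coords G k z = \<theta> z *\<^sub>C coords G k z"
      using zero_ext_scaleC_analytic [OF coords_analytic(1) [OF that]] by meson
    ultimately show ?thesis
      by (simp add: c_def B(2))
  qed
  have "\<exists>C\<ge>0. \<forall>f\<in>F. N (\<lambda>z. B i z *\<^sub>C f z) \<le> C * N f" for i
    by (rule module_bounded [OF \<theta> B(1) [of i]]) blast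
  then obtain C where C: "\<And>i. C i \<ge> 0" "\<And>i f. f \<in> F \<Longrightarrow> N (\<lambda>z. B i z *\<^sub>C f z) \<le> C i * N f"
    by metis
  have term_mem: "(\<lambda>z. c i *\<^sub>C B i z *\<^sub>C f z) \<in> F" if "f \<in> F" for i f
    using that by (intro scale_mem module_closed [OF \<theta> B(1)])
  have term_le: "N (\<lambda>z. c i *\<^sub>C B i z *\<^sub>C f z) \<le> cmod (c i) * C i * N f" if "f \<in> F" for i f
    using mult_left_mono [OF C(2) [OF that, of i], of "cmod (c i)"]
    by (simp add: N_scale module_closed [OF \<theta> B(1) that] mult.assoc)
  obtain K where K: "K > 0" "\<And>f. f \<in> analytic_funs U \<Longrightarrow> (\<lambda>z. \<theta> z *\<^sub>C f z) \<in> F \<longleftrightarrow> f \<in> F"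
    "\<And>f. f \<in> F \<Longrightarrow> N f \<le> K * N (\<lambda>z. \<theta> z *\<^sub>C f z)"
    using conformal_mult [OF \<theta>] mem_analytic by blast
  have closed: "(\<lambda>z. \<theta> z *\<^sub>C G z) \<in> arrays" if "G \<in> arrays" for G :: "complex \<Rightarrow> ('a, 'n) tuple"
    using arrays_module [OF \<theta> a that] zero_ext_scaleC_analytic [OF arraysD(1) [OF that]] by simp
  \<comment> \<open>The coordinate formula, solved for its diagonal term: apart from the coordinate
    of the product, only coordinates of \<open>G\<close> with index below \<open>k\<close>
    remain.\<close>
  have diag: "(\<lambda>z. \<theta> z *\<^sub>C coords G k z)
      = (\<lambda>z. coords (\<lambda>z. \<theta> z *\<^sub>C G z) k z - (\<Sum>i\<in>{1..k}. c i *\<^sub>C B i z *\<^sub>C coords G (k - i) z))"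
    if "G \<in> analytic_funs U" "k < CARD('n)" for G :: "complex \<Rightarrow> ('a, 'n) tuple" and k
    by (simp add: coords_mult [OF that] split [OF that(1)])
  have mem: "G \<in> arrays" if G: "G \<in> analytic_funs U" and \<theta>G: "(\<lambda>z. \<theta> z *\<^sub>C G z) \<in> arrays"
    for G :: "complex \<Rightarrow> ('a, 'n) tuple"
  proof -
    have "coords G k \<in> F" if "k < CARD('n)" for k
      using that
    proof (induction k rule: less_induct)
      case (less k)
      \<comment> \<open>By induction the right-hand side of \<open>diag\<close> lies in
        \<open>F\<close>; the division property of \<open>F\<close> then removes the factor
        \<open>\<theta>\<close>.\<close>
      have "(\<lambda>z. \<theta> z *\<^sub>C coords G k z) \<in> F"
        unfolding diag [OF G less.prems]
        using less by (intro diff_mem sum_mem term_mem arraysD(2) [OF \<theta>G]) auto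
      then show ?case
        using K(2) coords_analytic(1) [OF G] by blast
    qed
    with G show ?thesis
      by (simp add: arrays_def)
  qed
  have "\<exists>D\<ge>0. \<forall>G::complex \<Rightarrow> ('a, 'n) tuple. G \<in> arrays \<longrightarrow>
      N (coords G k) \<le> D * array_norm (\<lambda>z. \<theta> z *\<^sub>C G z)" if "k < CARD('n)" for k
    using that
  proof (induction k rule: less_induct)
    case (less k)
    have "\<exists>D\<ge>0. \<forall>G::complex \<Rightarrow> ('a, 'n) tuple. G \<in> arrays \<longrightarrow>
        N (coords G j) \<le> D * array_norm (\<lambda>z. \<theta> z *\<^sub>C G z)" if "j < k" for j
      using less.IH [OF that] less.prems that by simp
    then obtain D where D: "\<And>j. j < k \<Longrightarrow> D j \<ge> 0"
      "\<And>j (G::complex \<Rightarrow> ('a, 'n) tuple). j < k \<Longrightarrow> G \<in> arrays \<Longrightarrow>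
        N (coords G j) \<le> D j * array_norm (\<lambda>z. \<theta> z *\<^sub>C G z)"
      by metis
    \<comment> \<open>\<open>K\<close> is the cost of dividing by \<open>\<theta>\<close> in
      \<open>F\<close>. In the bracket, \<open>1\<close> accounts for the coordinate of the product
      and the sum for the coordinates of smaller index.\<close>
    define E where "E = K * (1 + (\<Sum>i\<in>{1..k}. cmod (c i) * C i * D (k - i)))"
    have "E \<ge> 0"
      unfolding E_def using K(1) C(1) D(1) by (intro mult_nonneg_nonneg add_nonneg_nonneg sum_nonneg) auto
    moreover have "N (coords G k) \<le> E * array_norm (\<lambda>z. \<theta> z *\<^sub>C G z)"
      if G: "G \<in> arrays" for G :: "complex \<Rightarrow> ('a, 'n) tuple"
    proof -
      let ?M = "array_norm (\<lambda>z. \<theta> z *\<^sub>C G z)"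
      have G_coords: "coords G (k - i) \<in> F" for i
        using less.prems by (intro arraysD(2) [OF G]) simp
      have "N (\<lambda>z. \<Sum>i\<in>{1..k}. c i *\<^sub>C B i z *\<^sub>C coords G (k - i) z)
          \<le> (\<Sum>i\<in>{1..k}. N (\<lambda>z. c i *\<^sub>C B i z *\<^sub>C coords G (k - i) z))"
        by (intro N_sum_le term_mem G_coords)
      also have "\<dots> \<le> (\<Sum>i\<in>{1..k}. cmod (c i) * C i * D (k - i) * ?M)"
      proof (rule sum_mono)
        fix i assume "i \<in> {1..k}"
        then have "N (coords G (k - i)) \<le> D (k - i) * ?M"
          by (intro D G) auto
        then have "cmod (c i) * C i * N (coords G (k - i)) \<le> cmod (c i) * C i * (D (k - i) * ?M)"
          using C(1) by (intro mult_left_mono) auto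
        then show "N (\<lambda>z. c i *\<^sub>C B i z *\<^sub>C coords G (k - i) z) \<le> cmod (c i) * C i * D (k - i) * ?M"
          using term_le [OF G_coords, of i i] by (simp add: mult.assoc)
      qed
      finally have rest: "N (\<lambda>z. \<Sum>i\<in>{1..k}. c i *\<^sub>C B i z *\<^sub>C coords G (k - i) z)
          \<le> (\<Sum>i\<in>{1..k}. cmod (c i) * C i * D (k - i)) * ?M"
        by (simp add: sum_distrib_right)
      have "N (coords G k) \<le> K * N (\<lambda>z. \<theta> z *\<^sub>C coords G k z)"
        using G_coords [of 0] by (intro K) simp
      also have "N (\<lambda>z. \<theta> z *\<^sub>C coords G k z) \<le> N (coords (\<lambda>z. \<theta> z *\<^sub>C G z) k)
          + N (\<lambda>z. \<Sum>i\<in>{1..k}. c i *\<^sub>C B i z *\<^sub>C coords G (k - i) z)"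
        unfolding diag [OF arraysD(1) [OF G] less.prems]
        by (intro N_diff_le sum_mem term_mem G_coords arraysD(2) [OF closed [OF G]] less.prems)
      also have "\<dots> \<le> ?M + (\<Sum>i\<in>{1..k}. cmod (c i) * C i * D (k - i)) * ?M"
        by (intro add_mono rest N_coords_le closed G less.prems)
      finally show ?thesis
        using K(1) by (simp add: E_def algebra_simps)
    qed
    ultimately show ?case
      by blast
  qed
  then obtain D where D: "\<And>k. k < CARD('n) \<Longrightarrow> D k \<ge> 0"
    "\<And>k (G::complex \<Rightarrow> ('a, 'n) tuple). k < CARD('n) \<Longrightarrow> G \<in> arrays \<Longrightarrow>
      N (coords G k) \<le> D k * array_norm (\<lambda>z. \<theta> z *\<^sub>C G z)"
    by metis
  \<comment> \<open>\<open>K1\<close> bounds multiplication by \<open>\<theta>\<close> on arrays and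
    \<open>K2\<close> bounds the division. The constant \<open>K1 + K2 + 1\<close> dominates both
    and is positive.\<close>
  define K1 where "K1 = (\<Sum>k<CARD('n). \<Sum>i\<le>k. cmod (c i) * C i)"
  define K2 where "K2 = (\<Sum>k<CARD('n). D k)"
  have K1_nonneg: "K1 \<ge> 0" and K2_nonneg: "K2 \<ge> 0"
    unfolding K1_def K2_def using C(1) D(1) by (auto intro!: sum_nonneg)
  have upper: "array_norm (\<lambda>z. \<theta> z *\<^sub>C G z) \<le> K1 * array_norm G"
    if G: "G \<in> arrays" for G :: "complex \<Rightarrow> ('a, 'n) tuple"
  proof -
    have "N (coords (\<lambda>z. \<theta> z *\<^sub>C G z) k) \<le> (\<Sum>i\<le>k. cmod (c i) * C i) * array_norm G" if k: "k < CARD('n)" for k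
    proof -
      have G_coords: "coords G (k - i) \<in> F" for i
        using k by (intro arraysD(2) [OF G]) simp
      have "N (coords (\<lambda>z. \<theta> z *\<^sub>C G z) k) \<le> (\<Sum>i\<le>k. N (\<lambda>z. c i *\<^sub>C B i z *\<^sub>C coords G (k - i) z))"
        unfolding coords_mult [OF arraysD(1) [OF G] k] by (intro N_sum_le term_mem G_coords)
      also have "\<dots> \<le> (\<Sum>i\<le>k. cmod (c i) * C i * array_norm G)"
      proof (rule sum_mono)
        fix i
        have "cmod (c i) * C i * N (coords G (k - i)) \<le> cmod (c i) * C i * array_norm G"
          using C(1) k by (intro mult_left_mono N_coords_le G) auto
        then show "N (\<lambda>z. c i *\<^sub>C B i z *\<^sub>C coords G (k - i) z) \<le> cmod (c i) * C i * array_norm G"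
          using term_le [OF G_coords, of i i] by linarith
      qed
      finally show ?thesis
        by (simp add: sum_distrib_right)
    qed
    then have "array_norm (\<lambda>z. \<theta> z *\<^sub>C G z) \<le> (\<Sum>k<CARD('n). (\<Sum>i\<le>k. cmod (c i) * C i) * array_norm G)"
      unfolding array_norm_def [of "\<lambda>z. \<theta> z *\<^sub>C G z"] by (intro sum_mono) auto
    then show ?thesis
      by (simp add: K1_def sum_distrib_right)
  qed
  have lower: "array_norm G \<le> K2 * array_norm (\<lambda>z. \<theta> z *\<^sub>C G z)"
    if G: "G \<in> arrays" for G :: "complex \<Rightarrow> ('a, 'n) tuple"
    unfolding array_norm_def [of G] K2_def sum_distrib_right using D(2) G by (intro sum_mono) auto
  show ?thesis
  proof (intro exI conjI ballI impI)
    show "0 < K1 + K2 + 1"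
      using K1_nonneg K2_nonneg by simp
    fix G :: "complex \<Rightarrow> ('a, 'n) tuple" assume "G \<in> analytic_funs U"
    then show "(\<lambda>z. \<theta> z *\<^sub>C G z) \<in> arrays \<longleftrightarrow> G \<in> arrays"
      using closed mem by blast
    assume G: "G \<in> arrays"
    have "array_norm (\<lambda>z. \<theta> z *\<^sub>C G z) \<le> (K1 + K2 + 1) * array_norm G"
      using upper [OF G] K2_nonneg array_norm_nonneg [OF G] mult_right_mono [of K1 "K1 + K2 + 1" "array_norm G"]
      by linarith
    then show "inverse (K1 + K2 + 1) * array_norm (\<lambda>z. \<theta> z *\<^sub>C G z) \<le> array_norm G"
      using K1_nonneg K2_nonneg by (simp add: field_simps add_nonneg_pos)
    show "array_norm G \<le> (K1 + K2 + 1) * array_norm (\<lambda>z. \<theta> z *\<^sub>C G z)"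
      using lower [OF G] K1_nonneg array_norm_nonneg [OF closed [OF G]]
        mult_right_mono [of K2 "K1 + K2 + 1" "array_norm (\<lambda>z. \<theta> z *\<^sub>C G z)"]
      by linarith
  qed
qed

section \<open>Fibres\<close>

text \<open>Multiplication by \<open>\<psi> - w\<close> is the action of an element of the algebra
  minus a multiple of the identity, so each further factor costs \<open>C0 + cmod w\<close>.\<close>

lemma shift_bounded:
  obtains C where "C \<ge> 0" "\<And>f. f \<in> F \<Longrightarrow> (\<lambda>z. (\<psi> z - w) ^ j *\<^sub>C f z) \<in> F"
    "\<And>f. f \<in> F \<Longrightarrow> N (\<lambda>z. (\<psi> z - w) ^ j *\<^sub>C f z) \<le> C * N f"
proof -
  note \<psi>_mem = conformal_mem_Ainf_on [OF conformal_\<psi>]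
  obtain C0 where C0: "C0 \<ge> 0" "\<And>f. f \<in> F \<Longrightarrow> N (\<lambda>z. zero_ext U \<psi> z *\<^sub>C f z) \<le> C0 * N f"
    using module_bounded [OF conformal_\<psi> \<psi>_mem] by blast
  have \<psi>f: "(\<lambda>z. \<psi> z *\<^sub>C f z) \<in> F" "N (\<lambda>z. \<psi> z *\<^sub>C f z) \<le> C0 * N f" if "f \<in> F" for f
    using module_closed [OF conformal_\<psi> \<psi>_mem that] C0(2) [OF that]
      zero_ext_scaleC_analytic [OF mem_analytic [OF that], of \<psi>] by simp_all
  have "\<exists>C\<ge>0. \<forall>f\<in>F. (\<lambda>z. (\<psi> z - w) ^ j *\<^sub>C f z) \<in> F \<and> N (\<lambda>z. (\<psi> z - w) ^ j *\<^sub>C f z) \<le> C * N f"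
  proof (induction j)
    case 0
    show ?case
      by (rule exI [where x = 1]) simp
  next
    case (Suc j)
    then obtain C where C: "C \<ge> 0" "\<And>f. f \<in> F \<Longrightarrow> (\<lambda>z. (\<psi> z - w) ^ j *\<^sub>C f z) \<in> F"
      "\<And>f. f \<in> F \<Longrightarrow> N (\<lambda>z. (\<psi> z - w) ^ j *\<^sub>C f z) \<le> C * N f"
      by blast
    have "(\<lambda>z. (\<psi> z - w) ^ Suc j *\<^sub>C f z) \<in> F \<and> N (\<lambda>z. (\<psi> z - w) ^ Suc j *\<^sub>C f z) \<le> (C0 + cmod w) * C * N f"
      if "f \<in> F" for f
    proof -
      define g where "g = (\<lambda>z. (\<psi> z - w) ^ j *\<^sub>C f z)"
      have g: "g \<in> F" "N g \<le> C * N f"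
        unfolding g_def using C that by auto
      have eq: "(\<lambda>z. (\<psi> z - w) ^ Suc j *\<^sub>C f z) = (\<lambda>z. \<psi> z *\<^sub>C g z - w *\<^sub>C g z)"
        by (simp add: g_def fun_eq_iff scaleC_scaleC left_diff_distrib flip: scaleC_diff_left)
      have "N (\<lambda>z. \<psi> z *\<^sub>C g z - w *\<^sub>C g z) \<le> N (\<lambda>z. \<psi> z *\<^sub>C g z) + N (\<lambda>z. w *\<^sub>C g z)"
        using g by (intro N_diff_le \<psi>f scale_mem)
      also have "\<dots> \<le> (C0 + cmod w) * N g"
        using \<psi>f(2) [OF g(1)] N_scale [OF g(1), of w] by (simp add: distrib_right)
      also have "\<dots> \<le> (C0 + cmod w) * (C * N f)"
        using g C0 by (intro mult_left_mono) auto
      finally show ?thesis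
        unfolding eq using g \<psi>f by (simp add: diff_mem scale_mem mult.assoc)
    qed
    then show ?case
      using C C0 by (intro exI [where x = "(C0 + cmod w) * C"]) auto
  qed
  with that show thesis by blast
qed

text \<open>The function \<open>f\<close> varies with \<open>G\<close>, but \<open>C\<close> depends
  only on \<open>u\<close>. Continuity of the evaluations, one inclusion between the fibres and one
  half of the norm equivalence all rest on this uniformity.\<close>

lemma array_value_eq_jet:
  assumes u: "u \<in> U"
  obtains C where "C > 0" "\<And>G :: complex \<Rightarrow> ('a, 'n::{finite,linorder}) tuple. G \<in> arrays \<Longrightarrow>
    \<exists>f\<in>F. G u = jet f u \<and> N f \<le> C * array_norm G"
proof -
  have "\<exists>C. C > 0 \<and> (\<forall>G :: complex \<Rightarrow> ('a, 'n) tuple. G \<in> arrays \<longrightarrow>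
    (\<exists>f\<in>F. G u = jet f u \<and> N f \<le> C * array_norm G))"
  proof -
    have "\<exists>C. \<forall>j. 0 \<le> C j \<and> (\<forall>f\<in>F. (\<lambda>z. (\<psi> z - \<psi> u) ^ j *\<^sub>C f z) \<in> F \<and>
        N (\<lambda>z. (\<psi> z - \<psi> u) ^ j *\<^sub>C f z) \<le> C j * N f)"
    proof (rule choice, rule allI)
      fix j
      show "\<exists>C. 0 \<le> C \<and> (\<forall>f\<in>F. (\<lambda>z. (\<psi> z - \<psi> u) ^ j *\<^sub>C f z) \<in> F \<and>
          N (\<lambda>z. (\<psi> z - \<psi> u) ^ j *\<^sub>C f z) \<le> C * N f)"
        by (rule shift_bounded [of "\<psi> u" j]) blast
    qed
    then obtain C where C: "\<And>j. C j \<ge> 0" "\<And>j f. f \<in> F \<Longrightarrow> (\<lambda>z. (\<psi> z - \<psi> u) ^ j *\<^sub>C f z) \<in> F"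
      "\<And>j f. f \<in> F \<Longrightarrow> N (\<lambda>z. (\<psi> z - \<psi> u) ^ j *\<^sub>C f z) \<le> C j * N f"
      by blast
    \<comment> \<open>The summand \<open>1\<close> makes the constant positive, as it is inverted
      when the quotient norms are compared.\<close>
    define K where "K = (\<Sum>j<CARD('n). C j) + 1"
    have "K > 0"
      unfolding K_def using C(1) by (intro add_nonneg_pos sum_nonneg) auto
    moreover have "\<exists>f\<in>F. G u = jet f u \<and> N f \<le> K * array_norm G"
      if G: "G \<in> arrays" for G :: "complex \<Rightarrow> ('a, 'n) tuple"
    proof (intro bexI conjI)
      let ?f = "\<lambda>z. \<Sum>j<CARD('n). (\<psi> z - \<psi> u) ^ j *\<^sub>C coords G j z"
      show "?f \<in> F"
        by (intro sum_mem C(2) arraysD(2) [OF G]) auto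
      show "G u = jet ?f u"
        using assemble_eq_jet [where 'n = 'n and g = "coords G", OF coords_analytic(1) [OF arraysD(1) [OF G]] u]
        by (simp add: coords_analytic(2) [OF arraysD(1) [OF G]])
      have "N ?f \<le> (\<Sum>j<CARD('n). N (\<lambda>z. (\<psi> z - \<psi> u) ^ j *\<^sub>C coords G j z))"
        by (intro N_sum_le C(2) arraysD(2) [OF G]) auto
      also have "\<dots> \<le> (\<Sum>j<CARD('n). C j * array_norm G)"
      proof (rule sum_mono)
        fix j assume j: "j \<in> {..<CARD('n)}"
        have "N (\<lambda>z. (\<psi> z - \<psi> u) ^ j *\<^sub>C coords G j z) \<le> C j * N (coords G j)"
          using j by (intro C(3) arraysD(2) [OF G]) auto
        also have "\<dots> \<le> C j * array_norm G"
          using j C(1) by (intro mult_left_mono N_coords_le G) auto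
        finally show "N (\<lambda>z. (\<psi> z - \<psi> u) ^ j *\<^sub>C coords G j z) \<le> C j * array_norm G" .
      qed
      also have "\<dots> \<le> K * array_norm G"
        using array_norm_nonneg [OF G] by (simp add: K_def distrib_right sum_distrib_right)
      finally show "N ?f \<le> K * array_norm G" .
    qed
    ultimately show ?thesis by blast
  qed
  with that show thesis by blast
qed

text \<open>The value at \<open>u\<close> is the jet of a member of \<open>F\<close> whose norm is
  controlled by that of the array, and the Taylor coefficients at \<open>u\<close> are bounded on
  \<open>F\<close>.\<close>

lemma arrays_eval_continuous:
  assumes u: "u \<in> U"
  shows "continuous_map (norm_topology (arrays :: (complex \<Rightarrow> ('a, 'n::{finite,linorder}) tuple) set) array_norm)
    euclidean (\<lambda>G. G u)"
proof -
  interpret T: normed_function_space "arrays :: (complex \<Rightarrow> ('a, 'n) tuple) set" array_norm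
    by (rule normed_function_space_arrays)
  obtain C where C: "C > 0" "\<And>G :: complex \<Rightarrow> ('a, 'n) tuple. G \<in> arrays \<Longrightarrow>
      \<exists>f\<in>F. G u = jet f u \<and> N f \<le> C * array_norm G"
    by (rule array_value_eq_jet [OF u]) blast
  have "\<exists>D\<ge>0. \<forall>f\<in>F. norm (vec_coeff_at k f u) \<le> D * N f" for k
    by (rule vec_coeff_at_bounded [OF open_U u, of k]) blast
  then obtain D where D: "\<And>k. D k \<ge> 0" "\<And>k f. f \<in> F \<Longrightarrow> norm (vec_coeff_at k f u) \<le> D k * N f"
    by metis
  define E where "E = (\<Sum>i\<in>(UNIV :: 'n set). D (tuple_pos i))"
  have "E \<ge> 0"
    unfolding E_def using D(1) by (intro sum_nonneg)
  show ?thesis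
  proof (rule T.continuous_map_euclidean_bounded)
    fix G :: "complex \<Rightarrow> ('a, 'n) tuple" assume "G \<in> arrays"
    then obtain f where f: "f \<in> F" "G u = jet f u" "N f \<le> C * array_norm G"
      using C by blast
    have "norm (G u) = (\<Sum>i\<in>(UNIV :: 'n set). norm (vec_coeff_at (tuple_pos i) f u))"
      by (simp add: f(2) norm_tuple_def jet_eq)
    also have "\<dots> \<le> E * N f"
      unfolding E_def sum_distrib_right by (intro sum_mono D f)
    also have "\<dots> \<le> E * (C * array_norm G)"
      using f(3) \<open>E \<ge> 0\<close> by (rule mult_left_mono)
    finally show "norm (G u) \<le> E * C * array_norm G"
      by (simp add: mult.assoc)
  qed simp
qed

lemma acceptable_space_arrays:
  "acceptable_space U (arrays :: (complex \<Rightarrow> ('a, 'n::{finite,linorder}) tuple) set) array_norm"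
proof -
  interpret T: normed_function_space "arrays :: (complex \<Rightarrow> ('a, 'n) tuple) set" array_norm
    by (rule normed_function_space_arrays)
  show ?thesis
  proof
    show "(arrays :: (complex \<Rightarrow> ('a, 'n) tuple) set) \<subseteq> analytic_funs U"
      using arraysD(1) by blast
  qed (fact T.zero_mem T.add_mem T.scale_mem T.N_nonneg T.N_eq_0_iff T.N_add_le T.N_scale
      mcomplete_arrays arrays_eval_continuous arrays_module arrays_module_continuous
      arrays_conformal_mult)+
qed

text \<open>All coordinates of index below \<open>CARD('n)\<close> vanish except the one of index
  \<open>0\<close>, so the sum norm has a single term and equality holds without a constant.\<close>

lemma jet_mem_arrays:
  assumes f: "f \<in> F"
  shows "zero_ext U (jet f) \<in> (arrays :: (complex \<Rightarrow> ('a, 'n::{finite,linorder}) tuple) set)"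
    and "array_norm (zero_ext U (jet f) :: complex \<Rightarrow> ('a, 'n) tuple) = N f"
proof -
  define g where "g = (\<lambda>k :: nat. if k = 0 then f else (\<lambda>z. 0))"
  have g: "g k \<in> F" for k
    using f by (simp add: g_def zero_mem)
  have eq: "zero_ext U (jet f) = (assemble g :: complex \<Rightarrow> ('a, 'n) tuple)"
    unfolding g_def by (rule assemble_single [symmetric, OF mem_analytic [OF f]])
  show "zero_ext U (jet f) \<in> (arrays :: (complex \<Rightarrow> ('a, 'n) tuple) set)"
    unfolding eq using g by (intro assemble_mem_arrays)
  have "array_norm (assemble g :: complex \<Rightarrow> ('a, 'n) tuple) = (\<Sum>k<CARD('n). N (g k))"
    unfolding array_norm_def using g mem_analytic by (intro sum.cong refl) (simp add: coords_assemble)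
  also have "\<dots> = (\<Sum>k\<in>{0}. N (g k))"
    by (rule sum.mono_neutral_right) (auto simp: g_def N_zero)
  finally show "array_norm (zero_ext U (jet f) :: complex \<Rightarrow> ('a, 'n) tuple) = N f"
    unfolding eq by (simp add: g_def)
qed

lemma fibre_arrays:
  assumes u: "u \<in> U"
  shows "fibre arrays u = (rochberg_space F u :: ('a, 'n::{finite,linorder}) tuple set)"
proof
  obtain C where C: "C > 0" "\<And>G :: complex \<Rightarrow> ('a, 'n) tuple. G \<in> arrays \<Longrightarrow>
      \<exists>f\<in>F. G u = jet f u \<and> N f \<le> C * array_norm G"
    by (rule array_value_eq_jet [OF u]) blast
  then show "fibre arrays u \<subseteq> (rochberg_space F u :: ('a, 'n) tuple set)"
    unfolding fibre_def rochberg_space_def by blast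
  show "(rochberg_space F u :: ('a, 'n) tuple set) \<subseteq> fibre arrays u"
  proof
    fix w :: "('a, 'n) tuple" assume "w \<in> rochberg_space F u"
    then obtain f where f: "f \<in> F" "w = jet f u"
      by (auto simp: rochberg_space_def)
    then have "w = zero_ext U (jet f) u"
      using u by (simp add: zero_ext_def)
    then show "w \<in> fibre arrays u"
      unfolding fibre_def using jet_mem_arrays(1) [OF f(1)] by blast
  qed
qed

text \<open>A function with jet \<open>w\<close> yields an array of the same norm through
  \<open>w\<close>, whence the constant \<open>1\<close>. An array through \<open>w\<close> yields a
  function of at most \<open>C\<close> times its norm, whence \<open>inverse C\<close>.\<close>

lemma equivalent_norms_fibre:
  assumes u: "u \<in> U"
  shows "equivalent_norms_on (fibre arrays u :: ('a, 'n::{finite,linorder}) tuple set)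
    (fibre_norm arrays array_norm u) (rochberg_norm F N u)"
proof -
  obtain C where C: "C > 0" "\<And>G :: complex \<Rightarrow> ('a, 'n) tuple. G \<in> arrays \<Longrightarrow>
      \<exists>f\<in>F. G u = jet f u \<and> N f \<le> C * array_norm G"
    by (rule array_value_eq_jet [OF u]) blast
  have "inverse C * rochberg_norm F N u w \<le> fibre_norm arrays array_norm u w \<and>
      fibre_norm arrays array_norm u w \<le> 1 * rochberg_norm F N u w"
    if w: "w \<in> fibre arrays u" for w :: "('a, 'n) tuple"
  proof -
    let ?P = "{array_norm G | G. G \<in> arrays \<and> G u = w}" and ?Q = "{N f | f. f \<in> F \<and> jet f u = w}"
    \<comment> \<open>Infima of real sets are informative only for nonempty sets bounded below; this
      is what membership in the fibre secures.\<close>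
    have P: "?P \<noteq> {}" "bdd_below ?P"
      using w array_norm_nonneg by (auto simp: fibre_def intro!: bdd_belowI [where m = 0])
    have "w \<in> rochberg_space F u"
      using w fibre_arrays [OF u] by blast
    then have Q: "?Q \<noteq> {}" "bdd_below ?Q"
      using N_nonneg by (auto simp: rochberg_space_def intro!: bdd_belowI [where m = 0])
    have "Inf ?P \<le> Inf ?Q"
    proof (rule cInf_greatest [OF Q(1)])
      fix x assume "x \<in> ?Q"
      then obtain f where f: "f \<in> F" "jet f u = w" "x = N f"
        by blast
      have "x \<in> ?P"
        using jet_mem_arrays [where 'n = 'n, OF f(1)] f u
        by (intro CollectI exI [where x = "zero_ext U (jet f)"]) (simp add: zero_ext_def)
      then show "Inf ?P \<le> x"
        using P(2) by (rule cInf_lower)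
    qed
    moreover have "inverse C * Inf ?Q \<le> Inf ?P"
    proof (rule cInf_greatest [OF P(1)])
      fix x assume "x \<in> ?P"
      then obtain G where G: "G \<in> arrays" "G u = w" "x = array_norm G"
        by blast
      then obtain f where f: "f \<in> F" "w = jet f u" "N f \<le> C * x"
        using C(2) [OF G(1)] by blast
      have "Inf ?Q \<le> N f"
        using f by (intro cInf_lower Q(2)) auto
      also note f(3)
      finally show "inverse C * Inf ?Q \<le> x"
        using C(1) by (simp add: field_simps)
    qed
    ultimately show ?thesis
      by (simp add: fibre_norm_def rochberg_norm_def quotient_norm_def)
  qed
  moreover have "inverse C > 0" "(1 :: real) > 0"
    using C by simp_all
  ultimately show ?thesis
    unfolding equivalent_norms_on_def by blast
qed

end

theorem theorem6p8:
  fixes U :: "complex set"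
    and F :: "(complex \<Rightarrow> 'a::complex_banach) set"
    and N :: "(complex \<Rightarrow> 'a) \<Rightarrow> real"
  assumes "open U"
    and "\<exists>\<psi>. conformal_equiv \<psi> U unit_disc"
    and "acceptable_space U F N"
    and "CARD('n::{finite,linorder}) \<ge> 2"
  shows "\<exists>(T :: (complex \<Rightarrow> ('a, 'n) tuple) set) (M :: (complex \<Rightarrow> ('a, 'n) tuple) \<Rightarrow> real).
    acceptable_space U T M \<and>
    (\<forall>f\<in>F. zero_ext U (jet f) \<in> T \<and> M (zero_ext U (jet f)) = N f) \<and>
    (\<forall>u\<in>U. fibre T u = rochberg_space F u \<and>
      equivalent_norms_on (fibre T u) (fibre_norm T M u) (rochberg_norm F N u))"
proof -
  obtain \<psi> where "conformal_equiv \<psi> U unit_disc"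
    using assms(2) by blast
  with assms(1,3) interpret coordinate_acceptable_space U F N \<psi>
    by (simp add: coordinate_acceptable_space_def coordinate_acceptable_space_axioms_def)
  show ?thesis
    using acceptable_space_arrays jet_mem_arrays fibre_arrays equivalent_norms_fibre by blast
qed

end
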